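(* Let $V$, $W$, $\Gamma$, $X=V/\Gamma$ be as in the context, let $\mathcal L$ be a topologically trivial holomorphic line bundle on $X$ such that $(\mathcal L^w)^*\otimes\mathcal L$ is holomorphically nontrivial for all $w\in W\setminus\{1\}$, let $\nabla$ be a flat holomorphic connection on $\mathcal L$, and let $C$ be a $W$-invariant complex-valued function on $\mathcal S$. Then the elliptic Dunkl operators commute: for all $u,v\in V$, $$[\mathcal D^{\mathcal L,\nabla}_{v,C},\mathcal D^{\mathcal L,\nabla}_{u,C}]=0.$$
   Context: Setting: $V$ a finite-dimensional complex vector space, $W\subset GL(V)$ finite, $\Gamma\subset V$ a full-rank $W$-invariant lattice, $X=V/\Gamma$. A reflection is a nontrivial semisimple element fixing a hyperplane pointwise; a reflection hypertorus is a codimension-one connected component of the fixed locus in $X$ of a reflection of $W$. For such $H$, $W_H$ (stabilizer of a generic point of $H$) is cyclic of order $n_H$ with generator $g_H$ of determinant $e^{2\pi i/n_H}$; $V^*=(V^* )^{g_H}\oplus V_H^*$ with $V_H^*$ the one-dimensional nontrivial $g_H$-eigenline; $\mathcal S=\{(H,j): 1\le j\le n_H-1\}$, with $W$ acting by $g(H,j)=(gH,j)$. Line bundles: with $V^\vee$ the antilinear forms on $V$, $\omega(\alpha,v)=\mathrm{Im}\,\alpha(v)$, $\Gamma^\vee=\{\alpha:\omega(\alpha,\Gamma)\subset\mathbb Z\}$, $X^\vee=V^\vee/\Gamma^\vee$, the bundle $\mathcal L_\alpha$ ($\alpha\in X^\vee$) is $(V\times\mathbb C)/\Gamma$ with $\gamma(z,\xi)=(z+\gamma,e^{2\pi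 i\omega(\alpha,\gamma)}\xi)$; every topologically trivial line bundle has this form; $W$ acts on $X^\vee$ dually via $\omega$, and $\mathcal L_\alpha^w=\mathcal L_{w\alpha}$. An element $w\in W$ maps local sections of $\mathcal M$ to local sections of $\mathcal M^w$. Sections $f^{\mathcal L}_{H,j}$: for $(H,j)\in\mathcal S$, $f^{\mathcal L}_{H,j}$ is the unique global meromorphic section of $(\mathcal L^{g_H^j})^*\otimes\mathcal L\otimes V_H^*$ with a simple pole along $H$, no other singularities, and Poincaré residue $1$ along $H$ (fibers of $T^*X$ canonically identified with $V^*$; the residue is constant since the bundle restricted to $H$ is trivial and $H$ is compact). Elliptic Dunkl operator: for $v\in V$, acting on local meromorphic sections of $\mathcal L$, $$\mathcal D^{\mathcal L,\nabla}_{v,C}=\nabla_v-\sum_{(H,j)\in\mathcal S}C(H,j)\langle f^{\mathcal L}_{H,j},v\rangle\, g_H^j.$$ *)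

theory Defs
  imports "HOL-Analysis.Analysis"
begin

text \<open>Model: V = complex^'n, covectors are represented by vectors via the bilinear pairing
  pair l v; antilin_form forms (elements of the antilin_form dual) are functions V => complex.
  Sections of line bundles on X = V/Gamma are represented by their lifts to V
  (quasi-periodic functions); holomorphic connections by their connection form in the
  lifted trivialization.\<close>

definition pair :: "complex^'n \<Rightarrow> complex^'n \<Rightarrow> complex" where
  "pair l v = (\<Sum>i\<in>UNIV. l$i * v$i)"

definition eC :: "real \<Rightarrow> complex" where
  "eC x = exp (2 * of_real pi * \<i> * of_real x)"

definition full_lattice :: "(complex^'n) set \<Rightarrow> bool" where
  "full_lattice \<Gamma> \<longleftrightarrow> (\<exists>b::nat \<Rightarrow> complex^'n.
     (\<forall>c::nat \<Rightarrow> real. (\<Sum>i<2*CARD('n). c i *\<^sub>R b i) = 0 \<longrightarrow> (\<forall>i<2*CARD('n). c i = 0)) \<and>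
     \<Gamma> = {(\<Sum>i<2*CARD('n). of_int (k i) *\<^sub>R b i) | k::nat \<Rightarrow> int. True})"

definition finite_matrix_group :: "(complex^'n^'n) set \<Rightarrow> bool" where
  "finite_matrix_group W \<longleftrightarrow> finite W \<and> mat 1 \<in> W \<and> (\<forall>a\<in>W. \<forall>b\<in>W. a ** b \<in> W) \<and>
     (\<forall>a\<in>W. invertible a \<and> matrix_inv a \<in> W)"

definition semisimple :: "complex^'n^'n \<Rightarrow> bool" where
  "semisimple g \<longleftrightarrow> (\<exists>P::complex^'n^'n. invertible P \<and>
     (\<forall>i j. i \<noteq> j \<longrightarrow> (P ** g ** matrix_inv P) $ i $ j = 0))"

definition is_reflection :: "complex^'n^'n \<Rightarrow> bool" where
  "is_reflection g \<longleftrightarrow> g \<noteq> mat 1 \<and> semisimple g \<and>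
     (\<exists>l. l \<noteq> 0 \<and> (\<forall>v. pair l v = 0 \<longrightarrow> g *v v = v))"

definition fixlift :: "(complex^'n) set \<Rightarrow> complex^'n^'n \<Rightarrow> (complex^'n) set" where
  "fixlift \<Gamma> g = {z. g *v z - z \<in> \<Gamma>}"

text \<open>Reflection hypertori are represented by their (Gamma-invariant) preimages in V:
  the Gamma-saturation of a connected component of the preimage of the fixed locus.\<close>
definition refl_hypertorus :: "(complex^'n^'n) set \<Rightarrow> (complex^'n) set \<Rightarrow> (complex^'n) set \<Rightarrow> bool" where
  "refl_hypertorus W \<Gamma> Ht \<longleftrightarrow> (\<exists>g\<in>W. is_reflection g \<and> (\<exists>p\<in>fixlift \<Gamma> g.
     Ht = {z + \<gamma> | z \<gamma>. z \<in> connected_component_set (fixlift \<Gamma> g) p \<and> \<gamma> \<in> \<Gamma>}))"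

definition stabH :: "(complex^'n^'n) set \<Rightarrow> (complex^'n) set \<Rightarrow> (complex^'n) set \<Rightarrow> (complex^'n^'n) set" where
  "stabH W \<Gamma> Ht = {w\<in>W. \<forall>z\<in>Ht. w *v z - z \<in> \<Gamma>}"

definition nH :: "(complex^'n^'n) set \<Rightarrow> (complex^'n) set \<Rightarrow> (complex^'n) set \<Rightarrow> nat" where
  "nH W \<Gamma> Ht = card (stabH W \<Gamma> Ht)"

definition gH :: "(complex^'n^'n) set \<Rightarrow> (complex^'n) set \<Rightarrow> (complex^'n) set \<Rightarrow> complex^'n^'n" where
  "gH W \<Gamma> Ht = (THE g. g \<in> stabH W \<Gamma> Ht \<and> det g = exp (2 * of_real pi * \<i> / of_nat (nH W \<Gamma> Ht)))"

definition ellH :: "(complex^'n^'n) set \<Rightarrow> (complex^'n) set \<Rightarrow> (complex^'n) set \<Rightarrow> complex^'n" where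
  "ellH W \<Gamma> Ht = (SOME l. l \<noteq> 0 \<and> (\<exists>\<mu>. \<mu> \<noteq> 1 \<and> (\<forall>v. pair l (gH W \<Gamma> Ht *v v) = \<mu> * pair l v)))"

definition Sset :: "(complex^'n^'n) set \<Rightarrow> (complex^'n) set \<Rightarrow> ((complex^'n) set \<times> nat) set" where
  "Sset W \<Gamma> = {(Ht, j). refl_hypertorus W \<Gamma> Ht \<and> 1 \<le> j \<and> j \<le> nH W \<Gamma> Ht - 1}"

definition ginv_pow :: "complex^'n^'n \<Rightarrow> nat \<Rightarrow> complex^'n \<Rightarrow> complex^'n" where
  "ginv_pow g j z = ((\<lambda>y. matrix_inv g *v y) ^^ j) z"

definition holo :: "(complex^'n) set \<Rightarrow> (complex^'n \<Rightarrow> complex) \<Rightarrow> bool" where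
  "holo U f \<longleftrightarrow> (\<forall>z\<in>U. \<exists>D. (f has_derivative D) (at z) \<and> (\<forall>c v. D (c *s v) = c * D v))"

definition meromorphic :: "(complex^'n) set \<Rightarrow> (complex^'n \<Rightarrow> complex) \<Rightarrow> bool" where
  "meromorphic U f \<longleftrightarrow> (\<forall>z0\<in>U. \<exists>r>0. \<exists>g h. holo (ball z0 r) g \<and> holo (ball z0 r) h \<and>
     (\<exists>z\<in>ball z0 r. h z \<noteq> 0) \<and> (\<forall>z\<in>ball z0 r. h z \<noteq> 0 \<longrightarrow> f z = g z / h z))"

definition antilin_form :: "(complex^'n \<Rightarrow> complex) \<Rightarrow> bool" where
  "antilin_form \<kappa> \<longleftrightarrow> (\<forall>x y. \<kappa> (x + y) = \<kappa> x + \<kappa> y) \<and> (\<forall>c x. \<kappa> (c *s x) = cnj c * \<kappa> x)"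

text \<open>s is (the lift of) a section of L_chi over (the image of) U.\<close>
definition qp :: "(complex^'n) set \<Rightarrow> (complex^'n \<Rightarrow> complex) \<Rightarrow> (complex^'n) set \<Rightarrow> (complex^'n \<Rightarrow> complex) \<Rightarrow> bool" where
  "qp \<Gamma> \<kappa> U s \<longleftrightarrow> (\<forall>z\<in>U. \<forall>\<gamma>\<in>\<Gamma>. s (z + \<gamma>) = eC (Im (\<kappa> \<gamma>)) * s z)"

definition holo_trivial :: "(complex^'n) set \<Rightarrow> (complex^'n \<Rightarrow> complex) \<Rightarrow> bool" where
  "holo_trivial \<Gamma> \<kappa> \<longleftrightarrow> (\<exists>s. holo UNIV s \<and> (\<forall>z. s z \<noteq> 0) \<and> qp \<Gamma> \<kappa> UNIV s)"

definition dd :: "complex^'n \<Rightarrow> (complex^'n \<Rightarrow> complex) \<Rightarrow> complex^'n \<Rightarrow> complex" where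
  "dd v f z = deriv (\<lambda>t. f (z + t *s v)) 0"

text \<open>f_{H,j}: the unique meromorphic section of (L^{g_H^j})^* (x) L (x) V_H^*, written
  as phi * ellH, with phi quasi-periodic for alpha - g_H^j alpha, holomorphic off H
  (normalised to 0 on H), simple pole along H with Poincare residue 1 (with respect to the
  canonical identification of the fibres of L^{g_H^j} and L at points of H).\<close>
definition fsec :: "(complex^'n^'n) set \<Rightarrow> (complex^'n) set \<Rightarrow> (complex^'n \<Rightarrow> complex)
    \<Rightarrow> (complex^'n) set \<Rightarrow> nat \<Rightarrow> complex^'n \<Rightarrow> complex^'n \<Rightarrow> complex" where
  "fsec W \<Gamma> \<alpha> Ht j = (THE F. \<exists>\<phi>.
     (\<forall>z v. F z v = \<phi> z * pair (ellH W \<Gamma> Ht) v) \<and>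
     holo (- Ht) \<phi> \<and> (\<forall>z\<in>Ht. \<phi> z = 0) \<and>
     qp \<Gamma> (\<lambda>\<gamma>. \<alpha> \<gamma> - \<alpha> (ginv_pow (gH W \<Gamma> Ht) j \<gamma>)) UNIV \<phi> \<and>
     (\<forall>z0\<in>Ht. \<exists>\<rho>>0. \<exists>h. holo (ball z0 \<rho>) h \<and>
        (\<forall>z\<in>ball z0 \<rho>. z \<notin> Ht \<longrightarrow>
            h z = (pair (ellH W \<Gamma> Ht) z - pair (ellH W \<Gamma> Ht) z0) * \<phi> z) \<and>
        (\<forall>z\<in>ball z0 \<rho>. pair (ellH W \<Gamma> Ht) z = pair (ellH W \<Gamma> Ht) z0 \<longrightarrow>
            h z = eC (- Im (\<alpha> (ginv_pow (gH W \<Gamma> Ht) j z - z))))))"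

text \<open>Flat holomorphic connection on L_alpha: nabla_v s = dd v s + A z v * s with A a
  Gamma-periodic holomorphic connection 1-form, closed (flat).\<close>
definition flat_hol_conn :: "(complex^'n) set \<Rightarrow> (complex^'n \<Rightarrow> complex^'n \<Rightarrow> complex) \<Rightarrow> bool" where
  "flat_hol_conn \<Gamma> A \<longleftrightarrow> (\<forall>v. holo UNIV (\<lambda>z. A z v)) \<and>
     (\<forall>z u v. A z (u + v) = A z u + A z v) \<and> (\<forall>z c u. A z (c *s u) = c * A z u) \<and>
     (\<forall>z v \<gamma>. \<gamma> \<in> \<Gamma> \<longrightarrow> A (z + \<gamma>) v = A z v) \<and>
     (\<forall>z u v. dd u (\<lambda>y. A y v) z = dd v (\<lambda>y. A y u) z)"

definition dunkl :: "(complex^'n^'n) set \<Rightarrow> (complex^'n) set \<Rightarrow> (complex^'n \<Rightarrow> complex)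
    \<Rightarrow> (complex^'n \<Rightarrow> complex^'n \<Rightarrow> complex) \<Rightarrow> ((complex^'n) set \<times> nat \<Rightarrow> complex)
    \<Rightarrow> complex^'n \<Rightarrow> (complex^'n \<Rightarrow> complex) \<Rightarrow> complex^'n \<Rightarrow> complex" where
  "dunkl W \<Gamma> \<alpha> A C v s z = dd v s z + A z v * s z -
     (\<Sum>(Ht, j)\<in>Sset W \<Gamma>. C (Ht, j) * fsec W \<Gamma> \<alpha> Ht j z v * s (ginv_pow (gH W \<Gamma> Ht) j z))"

end

theory Submission
  imports Defs "HOL-Complex_Analysis.Complex_Analysis"
begin

text \<open>
  A reflection \<open>g = g\<^sub>H\<^sup>j\<close> has rank one over the identity, so everything attached to \<open>(H, j)\<close> factors
  through one linear form \<open>\<ell>\<close>: the bundle is pulled back from the elliptic curve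
  \<open>\<complex> / \<ell>(\<Gamma>)\<close>, and \<open>f\<^sub>H\<^sub>,\<^sub>j\<close> is \<open>\<ell>\<close> times a Kronecker function of \<open>\<ell>(z)\<close>. A holomorphic connection
  form is constant by Liouville's theorem. Hence in \<open>[D\<^sub>v, D\<^sub>u]\<close> all terms cancel except
  \<open>\<Sum>\<^sub>w R\<^sub>w w\<close>, where \<open>R\<^sub>w\<close> collects the products \<open>f\<^sub>S \<and> g\<^sub>S f\<^sub>T\<close> with \<open>g\<^sub>S g\<^sub>T = w\<close>. For \<open>w = 1\<close> the
  wedge vanishes. For \<open>w \<noteq> 1\<close> the pairs \<open>(S, T)\<close> and \<open>(T, g\<^sub>T\<^sup>-\<^sup>1 S)\<close> have opposite residues,
  so \<open>R\<^sub>w\<close> is regular at the generic points of all hypertori. It is therefore entire on generic complex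
  lines, locally bounded by the maximum principle on small circles, bounded by compactness of
  \<open>V / \<Gamma>\<close>, and constant; being a section of a nontrivial flat bundle it is zero. The same vanishing
  principle gives the uniqueness of \<open>f\<^sub>H\<^sub>,\<^sub>j\<close>.
\<close>

section \<open>The Kronecker function of a lattice in the complex plane\<close>

text \<open>The obstacle is codimension two. Where several hypertori meet, the coefficient of a
  group element has products of poles about which the residue computation says nothing. Residues are
  therefore examined only at points whose singular hyperplanes are all parallel, and everything else
  is reached through complex lines chosen to miss the remaining points. At such a point a summand
  \<open>phi S z * phi T (rinv S z)\<close> is singular along the hypertorus of \<open>S\<close>
  through its first factor and along \<open>rho S\<close> applied to that of \<open>T\<close>
  through its second; when both occur together the forms are proportional and the wedge removes the
  double pole. The partner of \<open>(S, T)\<close> is designed so that its second factor is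
  singular along the hypertorus of \<open>S\<close>: conjugation by \<open>rho T\<close> keeps the
  product of the two group elements. On that hypertorus \<open>rinv S z\<close> and \<open>z\<close>
  differ by a lattice vector, and the multiplier by which \<open>phi T\<close> changes is exactly
  the discrepancy between the two residue normalizations. The sign is the alternation of the wedge,
  since \<open>rho T\<close> changes the form of \<open>S\<close> only by a multiple of the form of
  \<open>T\<close>.\<close>

lemma eC_add: "eC (x + y) = eC x * eC y"
  by (simp add: eC_def exp_add[symmetric] algebra_simps)

lemma eC_0 [simp]: "eC 0 = 1"
  by (simp add: eC_def)

lemma norm_eC [simp]: "norm (eC x) = 1"
  by (simp add: eC_def)

lemma eC_minus: "eC (- x) = inverse (eC x)"
  by (simp add: eC_def exp_minus)

lemma eC_int [simp]: "eC (of_int n) = 1"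
proof -
  have "eC (of_int n) = cis (2 * pi * of_int n)"
    by (simp add: eC_def cis_conv_exp mult_ac)
  then show ?thesis by (simp add: cis_multiple_2pi)
qed

text \<open>Summand of Kronecker's series: simple poles at the integers only and multiplier
  \<open>eC a\<close> under the unit translation. The second multiplier is created later by summing
  over translates along \<open>\<tau>\<close>.\<close>

definition kern :: "real \<Rightarrow> complex \<Rightarrow> complex" where
  "kern a y = exp (2 * pi * \<i> * a * y) / (1 - exp (2 * pi * \<i> * y))"

text \<open>For \<open>Im y \<ge> 1\<close> the denominator has modulus at least 1/2 and the
  numerator supplies the rate \<open>a\<close>. For \<open>Im y \<le> -1\<close> the exponential in
  the denominator dominates, again at the cost of a factor 2, and the quotient decays at rate
  \<open>1 - a\<close>. The minimum covers both.\<close>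

lemma kern_bound:
  assumes a: "0 < a" "a < 1" and y: "\<bar>Im y\<bar> \<ge> 1"
  shows "norm (kern a y) \<le> 2 * exp (- (2 * pi * min a (1 - a)) * \<bar>Im y\<bar>)"
proof -
  have n1: "norm (exp (2 * pi * \<i> * a * y)) = exp (- 2 * pi * a * Im y)"
    by (simp add: norm_exp_eq_Re)
  have n2: "norm (exp (2 * pi * \<i> * y)) = exp (- 2 * pi * Im y)"
    by (simp add: norm_exp_eq_Re)
  have pi1: "pi > 1" using pi_gt3 by linarith
  have e2: "exp (2*pi) \<ge> (2::real)"
    using exp_ge_add_one_self[of "2*pi"] pi1 by linarith
  show ?thesis
  proof (cases "Im y \<ge> 0")
    case True
    then have y1: "Im y \<ge> 1" using y by simp
    have "2 * pi * 1 \<le> 2 * pi * Im y" using y1 pi1 by (intro mult_left_mono) auto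
    then have "exp (2*pi) \<le> exp (2*pi*Im y)" by simp
    then have "exp (2*pi*Im y) \<ge> 2" using e2 by linarith
    then have "exp (- 2 * pi * Im y) \<le> 1/2"
      by (simp add: exp_minus field_simps)
    then have d: "norm (1 - exp (2 * pi * \<i> * y)) \<ge> 1/2"
      using norm_triangle_ineq2[of 1 "exp (2 * pi * \<i> * y)"] n2 by simp
    have "norm (kern a y) \<le> exp (- 2 * pi * a * Im y) / (1/2)"
      unfolding kern_def norm_divide n1 using d by (intro divide_left_mono) (auto intro!: mult_pos_pos simp: less_le_trans[OF _ d])
    also have "\<dots> = 2 * exp (- 2 * pi * a * Im y)" by simp
    also have "\<dots> \<le> 2 * exp (- (2 * pi * min a (1 - a)) * \<bar>Im y\<bar>)"
    proof -
      have "min a (1-a) * Im y \<le> a * Im y" using True by (intro mult_right_mono) auto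
      then have "pi * (min a (1-a) * Im y) \<le> pi * (a * Im y)" using pi1 by (intro mult_left_mono) auto
      then show ?thesis using True by (simp add: algebra_simps)
    qed
    finally show ?thesis .
  next
    case False
    then have y1: "- Im y \<ge> 1" using y by simp
    have "2 * pi * 1 \<le> 2 * pi * (-Im y)" using y1 pi1 by (intro mult_left_mono) auto
    then have "exp (2*pi) \<le> exp (-2*pi*Im y)" by simp
    then have g2: "exp (-2*pi*Im y) \<ge> 2" using e2 by linarith
    have d: "norm (1 - exp (2 * pi * \<i> * y)) \<ge> exp (-2*pi*Im y) / 2"
      using norm_triangle_ineq3[of 1 "exp (2 * pi * \<i> * y)"] n2 g2 by simp
    have pos: "norm (1 - exp (2 * pi * \<i> * y)) > 0" using d g2 by linarith
    have "norm (kern a y) \<le> exp (- 2 * pi * a * Im y) / (exp (-2*pi*Im y) / 2)"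
      unfolding kern_def norm_divide n1 using d pos by (intro divide_left_mono) (auto intro!: mult_pos_pos)
    also have "\<dots> = 2 * exp (- 2 * pi * a * Im y - (-2*pi*Im y))" by (simp only: exp_diff) simp
    also have "\<dots> \<le> 2 * exp (- (2 * pi * min a (1 - a)) * \<bar>Im y\<bar>)"
    proof -
      have "min a (1-a) * (-Im y) \<le> (1-a) * (-Im y)" using False by (intro mult_right_mono) auto
      then have "pi * (min a (1-a) * (-Im y)) \<le> pi * ((1-a) * (-Im y))" using pi1 by (intro mult_left_mono) auto
      then show ?thesis using False by (simp add: algebra_simps)
    qed
    finally show ?thesis .
  qed
qed

lemma summable_on_power_abs_int:
  fixes r :: real
  assumes "0 \<le> r" "r < 1"
  shows "(\<lambda>n::int. r ^ nat \<bar>n\<bar>) summable_on UNIV"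
proof -
  have s: "(\<lambda>n::nat. r ^ n) summable_on UNIV"
    using assms by (intro summable_nonneg_imp_summable_on) (auto intro: summable_geometric)
  have "(\<lambda>n::int. r ^ nat \<bar>n\<bar>) summable_on range int"
    by (subst summable_on_reindex) (auto simp: o_def s)
  moreover have "(\<lambda>n::int. r ^ nat \<bar>n\<bar>) summable_on range (\<lambda>n. - int n)"
    by (subst summable_on_reindex) (auto simp: o_def s inj_on_def)
  ultimately have "(\<lambda>n::int. r ^ nat \<bar>n\<bar>) summable_on (range int \<union> range (\<lambda>n. - int n))"
    by (rule summable_on_union)
  moreover have "range int \<union> range (\<lambda>n. - int n) = UNIV"
  proof (intro equalityI subsetI)
    fix x :: int show "x \<in> range int \<union> range (\<lambda>n. - int n)" by (cases "x \<ge> 0") (auto simp: image_iff intro: exI[of _ "nat x"] exI[of _ "nat (- x)"])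
  qed auto
  ultimately show ?thesis by simp
qed

lemma kern_holomorphic:
  assumes "\<And>y. y \<in> S \<Longrightarrow> y \<notin> \<int>"
  shows "kern a holomorphic_on S"
proof -
  have "exp (2 * pi * \<i> * y) \<noteq> 1" if "y \<in> S" for y
  proof
    assume "exp (2 * pi * \<i> * y) = 1"
    then obtain n :: int where "Im (2 * pi * \<i> * y) = of_int (2*n) * pi" "Re (2 * pi * \<i> * y) = 0"
      unfolding exp_eq_1 by auto
    then have "y = of_int n" by (auto simp: complex_eq_iff)
    then show False using assms[OF that] by auto
  qed
  then show ?thesis unfolding kern_def by (intro holomorphic_intros) auto
qed

lemma kern_add_int: "kern a (y + of_int m) = eC (a * of_int m) * kern a y"
proof -
  have "exp (2 * pi * \<i> * a * (y + of_int m)) = eC (a * of_int m) * exp (2 * pi * \<i> * a * y)"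
    by (simp add: eC_def exp_add[symmetric] algebra_simps)
  moreover have "exp (2 * pi * \<i> * (y + of_int m)) = eC (of_int m) * exp (2 * pi * \<i> * y)"
    by (simp only: eC_def exp_add[symmetric]) (simp add: algebra_simps)
  ultimately show ?thesis unfolding kern_def by simp
qed

lemma kern_residue: "((\<lambda>y. y * kern a y) \<longlongrightarrow> - 1 / (2 * pi * \<i>)) (at 0)"
proof -
  have "((\<lambda>y. exp (2 * pi * \<i> * y)) has_field_derivative (2 * pi * \<i>)) (at 0)"
    by (auto intro!: derivative_eq_intros)
  then have "((\<lambda>y. (exp (2 * pi * \<i> * y) - 1) / y) \<longlongrightarrow> 2 * pi * \<i>) (at 0)"
    by (simp add: has_field_derivative_iff)
  then have "((\<lambda>y. exp (2 * pi * \<i> * a * y) * (- inverse ((exp (2 * pi * \<i> * y) - 1) / y)))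
     \<longlongrightarrow> exp (2 * pi * \<i> * a * 0) * (- inverse (2 * pi * \<i>))) (at 0)"
    by (intro tendsto_intros) auto
  moreover have "exp (2 * pi * \<i> * a * y) * (- inverse ((exp (2 * pi * \<i> * y) - 1) / y)) = y * kern a y" for y
  proof -
    have "inverse (1 - x) = - inverse (x - 1)" for x :: complex
      by (metis inverse_minus_eq minus_diff_eq)
    then show ?thesis unfolding kern_def by (simp add: divide_inverse mult_ac)
  qed
  ultimately show ?thesis by (simp add: inverse_eq_divide)
qed

text \<open>The kernel decays exponentially in both imaginary directions because \<open>0 < a < 1\<close>; this is what
  makes Kronecker's series converge absolutely, away from its poles.\<close>
definition kron_sum :: "real \<Rightarrow> real \<Rightarrow> complex \<Rightarrow> complex \<Rightarrow> complex" where
  "kron_sum a b \<tau> y = (\<Sum>\<^sub>\<infinity>n::int. eC (- of_int n * b) * kern a (y + of_int n * \<tau>))"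

lemma kron_sum_add_int: "kron_sum a b \<tau> (y + of_int m) = eC (a * of_int m) * kron_sum a b \<tau> y"
proof -
  have "kern a (y + of_int m + of_int n * \<tau>) = eC (a * of_int m) * kern a (y + of_int n * \<tau>)" for n
    using kern_add_int[of a "y + of_int n * \<tau>" m] by (simp add: add_ac)
  then show ?thesis
    unfolding kron_sum_def
    by (subst infsum_cmult_right'[symmetric]) (simp add: mult.left_commute)
qed

text \<open>Moving the summation index by \<open>m\<close> turns translation along
  \<open>\<tau>\<close> into the phase carried by the coefficients.\<close>

lemma kron_sum_add_tau: "kron_sum a b \<tau> (y + of_int m * \<tau>) = eC (b * of_int m) * kron_sum a b \<tau> y"
proof -
  let ?f = "\<lambda>n::int. eC (- of_int n * b) * kern a (y + of_int n * \<tau>)"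
  have "bij (\<lambda>n::int. n + m)" by (rule bij_betwI[of _ _ _ "\<lambda>n. n - m"]) auto
  then have "infsum ?f UNIV = infsum (\<lambda>n. ?f (n + m)) UNIV"
    using infsum_reindex_bij_betw[of "\<lambda>n::int. n + m" UNIV UNIV ?f] by simp
  also have "(\<lambda>n. ?f (n + m)) = (\<lambda>n. eC (- of_int m * b) * (eC (- of_int n * b) * kern a (y + of_int m * \<tau> + of_int n * \<tau>)))"
  proof
    fix n
    have "- of_int (n + m) * b = - of_int m * b + - of_int n * b" by (simp add: algebra_simps)
    then show "?f (n + m) = eC (- of_int m * b) * (eC (- of_int n * b) * kern a (y + of_int m * \<tau> + of_int n * \<tau>))"
      by (simp only: eC_add) (simp add: algebra_simps)
  qed
  also have "infsum \<dots> UNIV = eC (- of_int m * b) * kron_sum a b \<tau> (y + of_int m * \<tau>)"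
    unfolding kron_sum_def by (rule infsum_cmult_right')
  finally have "kron_sum a b \<tau> y = eC (- of_int m * b) * kron_sum a b \<tau> (y + of_int m * \<tau>)"
    unfolding kron_sum_def .
  then show ?thesis by (simp add: eC_add[symmetric] mult.assoc[symmetric] mult.commute)
qed

text \<open>Only finitely many translates of the integers come near a unit ball, so the remaining
  tail is majorized by a geometric series and is holomorphic. The index 0 is forced into
  \<open>J\<close> because the residue at the origin has to be read off from that summand.\<close>

lemma kron_sum_split:
  assumes a: "0 < a" "a < 1" and \<tau>: "Im \<tau> > 0"
  shows "\<exists>J G. finite J \<and> (0::int) \<in> J \<and> G holomorphic_on ball y0 1 \<and>
     (\<forall>y\<in>ball y0 1. kron_sum a b \<tau> y = (\<Sum>n\<in>J. eC (- of_int n * b) * kern a (y + of_int n * \<tau>)) + G y)"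
proof -
  define t where "t = Im \<tau>"
  define d where "d = 2 * pi * min a (1 - a)"
  have d: "d > 0" unfolding d_def using a by (auto intro!: mult_pos_pos)
  define f where "f = (\<lambda>(n::int) y. eC (- of_int n * b) * kern a (y + of_int n * \<tau>))"
  \<comment> \<open>\<open>K\<close> bounds the imaginary part on the closed unit ball.
    \<open>N\<close> in turn makes \<open>|n| * t \<ge> K + 1\<close> for every index outside
    \<open>J\<close>, so the kernel argument has imaginary part at least 1 in modulus, as
    \<open>kern_bound\<close> requires.\<close>
  define K where "K = \<bar>Im y0\<bar> + 1"
  define N where "N = nat \<lceil>(K + 1) / t\<rceil>"
  define J where "J = {n::int. \<bar>n\<bar> \<le> int N}"
  have J: "finite J" "0 \<in> J"
    unfolding J_def by (auto intro!: finite_subset[of _ "{- int N..int N}"])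
  define r where "r = exp (- d * t)"
  define M where "M = (\<lambda>n::int. 2 * exp (d * K) * r ^ nat \<bar>n\<bar>)"
  have r: "0 \<le> r" "r < 1" unfolding r_def using d \<tau> by (auto simp: t_def)
  have M: "M summable_on A" for A
    unfolding M_def by (intro summable_on_cmult_right summable_on_subset_banach[OF summable_on_power_abs_int[OF r]]) auto
  have bd: "norm (f n y) \<le> M n" if "n \<in> - J" "y \<in> cball y0 1" for n y
  proof -
    have "\<bar>Im y - Im y0\<bar> \<le> 1" using that(2) abs_Im_le_cmod[of "y - y0"] by (auto simp: dist_norm norm_minus_commute)
    then have K: "\<bar>Im y\<bar> \<le> K" unfolding K_def by linarith
    have "real_of_int \<bar>n\<bar> > real N" using that(1) unfolding J_def by auto
    then have "real_of_int \<bar>n\<bar> \<ge> (K + 1) / t" unfolding N_def by linarith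
    then have n1: "real_of_int \<bar>n\<bar> * t \<ge> K + 1" using \<tau> by (simp add: t_def field_simps)
    have im: "\<bar>Im (y + of_int n * \<tau>)\<bar> \<ge> real_of_int \<bar>n\<bar> * t - K"
    proof -
      have "\<bar>of_int n * t\<bar> = real_of_int \<bar>n\<bar> * t" using \<tau> by (simp add: abs_mult t_def)
      then show ?thesis using K by (simp add: t_def[symmetric])
    qed
    have "norm (f n y) = norm (kern a (y + of_int n * \<tau>))" by (simp add: f_def norm_mult)
    also have "\<dots> \<le> 2 * exp (- d * \<bar>Im (y + of_int n * \<tau>)\<bar>)"
      unfolding d_def using im n1 by (intro kern_bound[OF a]) linarith
    also have "\<dots> \<le> 2 * exp (- d * (real_of_int \<bar>n\<bar> * t - K))"
      using d im by simp
    also have "\<dots> = M n"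
    proof -
      have "r ^ nat \<bar>n\<bar> = exp (real (nat \<bar>n\<bar>) * (- d * t))" unfolding r_def by (rule exp_of_nat_mult[symmetric])
      also have "real (nat \<bar>n\<bar>) = real_of_int \<bar>n\<bar>" by simp
      finally show ?thesis unfolding M_def by (simp add: exp_add[symmetric] algebra_simps)
    qed
    finally show ?thesis .
  qed
  define G where "G = (\<lambda>y. \<Sum>\<^sub>\<infinity>n\<in>-J. f n y)"
  have hol: "f n holomorphic_on cball y0 1" if "n \<in> - J" for n
  proof -
    have "y + of_int n * \<tau> \<notin> \<int>" if y: "y \<in> cball y0 1" for y
    proof
      assume "y + of_int n * \<tau> \<in> \<int>"
      then obtain k where "y + of_int n * \<tau> = of_int k" by (auto elim!: Ints_cases)
      then have "Im (y + of_int n * \<tau>) = 0" by (metis Im_complex_of_real of_real_of_int_eq)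
      moreover have "\<bar>Im y - Im y0\<bar> \<le> 1" using y abs_Im_le_cmod[of "y - y0"] by (auto simp: dist_norm norm_minus_commute)
      ultimately have "\<bar>of_int n * t\<bar> \<le> K" unfolding K_def t_def by simp
      then have "real_of_int \<bar>n\<bar> \<le> K / t" using \<tau> by (simp add: abs_mult t_def field_simps)
      also have "\<dots> \<le> (K+1)/t" using \<tau> by (simp add: t_def divide_right_mono)
      finally have "\<bar>n\<bar> \<le> int N" unfolding N_def by linarith
      then show False using \<open>n \<in> - J\<close> by (simp add: J_def)
    qed
    then have "kern a \<circ> (\<lambda>y. y + of_int n * \<tau>) holomorphic_on cball y0 1"
      by (intro holomorphic_on_compose kern_holomorphic holomorphic_intros) auto
    then show ?thesis unfolding f_def o_def by (rule holomorphic_on_mult[OF holomorphic_on_const])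
  qed
  have u: "uniform_limit (cball y0 1) (\<lambda>X y. \<Sum>n\<in>X. f n y) G (finite_subsets_at_top (-J))"
    unfolding G_def by (rule Weierstrass_m_test_general[OF bd M])
  have "G holomorphic_on ball y0 1"
  proof (rule holomorphic_uniform_limit[OF _ u])
    have "continuous_on (cball y0 1) (\<lambda>y. \<Sum>n\<in>X. f n y) \<and> (\<lambda>y. \<Sum>n\<in>X. f n y) holomorphic_on ball y0 1"
      if "finite X \<and> X \<subseteq> - J" for X
    proof -
      have "(\<lambda>y. \<Sum>n\<in>X. f n y) holomorphic_on cball y0 1"
        using that hol by (intro holomorphic_on_sum) auto
      then show ?thesis
        using holomorphic_on_imp_continuous_on holomorphic_on_subset ball_subset_cball by blast
    qed
    then show "\<forall>\<^sub>F X in finite_subsets_at_top (-J). continuous_on (cball y0 1) (\<lambda>y. \<Sum>n\<in>X. f n y) \<and> (\<lambda>y. \<Sum>n\<in>X. f n y) holomorphic_on ball y0 1"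
      by (intro eventually_finite_subsets_at_top_weakI) auto
  qed (auto simp: finite_subsets_at_top_neq_bot)
  moreover have "kron_sum a b \<tau> y = (\<Sum>n\<in>J. f n y) + G y" if "y \<in> ball y0 1" for y
  proof -
    have s: "(\<lambda>n. f n y) summable_on (-J)"
    proof (rule abs_summable_summable)
      show "(\<lambda>n. norm (f n y)) summable_on (-J)"
        by (rule summable_on_comparison_test[OF M]) (use that bd in auto)
    qed
    have "(\<Sum>\<^sub>\<infinity>n\<in>J \<union> -J. f n y) = (\<Sum>\<^sub>\<infinity>n\<in>J. f n y) + (\<Sum>\<^sub>\<infinity>n\<in>-J. f n y)"
      using J s by (intro infsum_Un_disjoint) auto
    then show ?thesis using J by (simp add: kron_sum_def f_def G_def)
  qed
  ultimately show ?thesis using J unfolding f_def by blast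
qed


lemma kron_sum_differentiable:
  assumes a: "0 < a" "a < 1" and \<tau>: "Im \<tau> > 0"
    and y: "\<And>m n::int. y \<noteq> of_int m + of_int n * \<tau>"
  shows "kron_sum a b \<tau> field_differentiable at y"
proof -
  obtain J G where J: "finite J" and G: "G holomorphic_on ball y 1"
    and e: "\<And>x. x \<in> ball y 1 \<Longrightarrow> kron_sum a b \<tau> x = (\<Sum>n\<in>J. eC (- of_int n * b) * kern a (x + of_int n * \<tau>)) + G x"
    using kron_sum_split[OF a \<tau>, of y b] by blast
  have k: "(\<lambda>x. kern a (x + of_int n * \<tau>)) field_differentiable at y" for n :: int
  proof -
    have "y + of_int n * \<tau> \<notin> \<int>"
    proof
      assume "y + of_int n * \<tau> \<in> \<int>"
      then obtain m where "y + of_int n * \<tau> = of_int m" by (auto elim: Ints_cases)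
      then have "y = of_int m + of_int (-n) * \<tau>" by (simp add: algebra_simps)
      then show False using y by blast
    qed
    moreover have "open (- \<int> :: complex set)" by (simp add: closed_Ints open_Compl)
    ultimately have "kern a field_differentiable at (y + of_int n * \<tau>)"
      using kern_holomorphic[of "- \<int>" a] holomorphic_on_imp_differentiable_at[of "kern a" "-\<int>"] by auto
    then show ?thesis
      using field_differentiable_compose[of "\<lambda>x. x + of_int n * \<tau>" y "kern a"]
      by (simp add: o_def field_differentiable_add)
  qed
  have "(\<lambda>x. (\<Sum>n\<in>J. eC (- of_int n * b) * kern a (x + of_int n * \<tau>)) + G x) field_differentiable at y"
    using G k by (intro field_differentiable_add field_differentiable_sum field_differentiable_mult) 
      (auto intro: holomorphic_on_imp_differentiable_at)
  moreover have "\<forall>\<^sub>F x in nhds y. (\<Sum>n\<in>J. eC (- of_int n * b) * kern a (x + of_int n * \<tau>)) + G x = kron_sum a b \<tau> x"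
    using e by (intro eventually_nhds_in_open[of "ball y 1" y, THEN eventually_mono]) auto
  ultimately show ?thesis
    unfolding field_differentiable_def using DERIV_cong_ev[OF refl _ refl, of _ _ y] by fast
qed

text \<open>For \<open>n \<noteq> 0\<close> the point \<open>n * \<tau>\<close> has nonzero
  imaginary part and is no integer, so the summand \<open>n = 0\<close> alone carries the
  pole.\<close>

lemma kron_sum_residue:
  assumes a: "0 < a" "a < 1" and \<tau>: "Im \<tau> > 0"
  shows "((\<lambda>y. y * kron_sum a b \<tau> y) \<longlongrightarrow> - 1 / (2 * pi * \<i>)) (at 0)"
proof -
  obtain J G where J: "finite J" "0 \<in> J" and G: "G holomorphic_on ball 0 1"
    and e: "\<And>x. x \<in> ball 0 1 \<Longrightarrow> kron_sum a b \<tau> x = (\<Sum>n\<in>J. eC (- of_int n * b) * kern a (x + of_int n * \<tau>)) + G x"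
    using kron_sum_split[OF a \<tau>, of 0 b] by blast
  have k: "((\<lambda>x. kern a (x + of_int n * \<tau>)) \<longlongrightarrow> kern a (0 + of_int n * \<tau>)) (at 0)" if "n \<noteq> 0" for n :: int
  proof -
    have "0 + of_int n * \<tau> \<notin> \<int>"
    proof
      assume "0 + of_int n * \<tau> \<in> \<int>"
      then obtain k where "of_int n * \<tau> = of_int k" by (auto elim!: Ints_cases)
      then have "Im (of_int n * \<tau>) = 0" by (metis Im_complex_of_real of_real_of_int_eq)
      then show False using \<tau> that by simp
    qed
    moreover have "open (- \<int> :: complex set)" by (simp add: closed_Ints open_Compl)
    ultimately have "isCont (kern a) (0 + of_int n * \<tau>)"
      using kern_holomorphic[of "- \<int>" a] holomorphic_on_imp_continuous_on continuous_on_eq_continuous_at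
      by blast
    then show ?thesis
      by (rule isCont_tendsto_compose) (intro tendsto_intros)
  qed
  have Gc: "(G \<longlongrightarrow> G 0) (at 0)"
    using G holomorphic_on_imp_continuous_on[OF G] continuous_on_eq_continuous_at[of "ball 0 1" G]
    by (simp add: isCont_def)
  have "((\<lambda>x. x * kern a x + x * ((\<Sum>n\<in>J-{0}. eC (- of_int n * b) * kern a (x + of_int n * \<tau>)) + G x))
     \<longlongrightarrow> - 1 / (2 * pi * \<i>) + 0 * ((\<Sum>n\<in>J-{0}. eC (- of_int n * b) * kern a (0 + of_int n * \<tau>)) + G 0)) (at 0)"
    using k Gc by (intro tendsto_add[OF kern_residue] tendsto_intros) auto
  moreover have "\<forall>\<^sub>F x in at 0. x * kern a x + x * ((\<Sum>n\<in>J-{0}. eC (- of_int n * b) * kern a (x + of_int n * \<tau>)) + G x)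
      = x * kron_sum a b \<tau> x"
    unfolding eventually_at_filter
  proof (intro eventually_nhds_in_open[of "ball 0 1" 0, THEN eventually_mono] impI)
    fix x :: complex assume "x \<in> ball 0 1"
    then show "x * kern a x + x * ((\<Sum>n\<in>J-{0}. eC (- of_int n * b) * kern a (x + of_int n * \<tau>)) + G x)
      = x * kron_sum a b \<tau> x"
      using e[of x] J by (simp add: sum.remove[of J 0] algebra_simps)
  qed auto
  ultimately show ?thesis by (simp add: tendsto_cong)
qed

section \<open>Discrete subgroups of the plane and reduced bases\<close>

lemma uniformly_discrete_bounded_finite:
  fixes S :: "'a::heine_borel set"
  assumes d: "d > 0" and s: "\<And>x y. x \<in> S \<Longrightarrow> y \<in> S \<Longrightarrow> x \<noteq> y \<Longrightarrow> dist x y \<ge> d" and b: "bounded S"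
  shows "finite S"
proof (rule ccontr)
  assume inf: "infinite S"
  have "closed S" by (rule discrete_imp_closed[OF d]) (use s in \<open>force\<close>)
  then have "compact S" using b by (simp add: compact_eq_bounded_closed)
  then obtain x where x: "x \<in> S" "x islimpt S" using inf using Heine_Borel_imp_Bolzano_Weierstrass[of S S] by auto
  then obtain y where "y \<in> S" "y \<noteq> x" "dist y x < d" using d by (auto simp: islimpt_approachable)
  then show False using s[of y x] x by auto
qed

lemma norm_minimal_exists:
  fixes A :: "'a::real_normed_vector set"
  assumes ne: "A \<noteq> {}" and f: "\<And>R. finite {x\<in>A. norm x \<le> R}"
  shows "\<exists>m\<in>A. \<forall>x\<in>A. norm m \<le> norm x"
proof -
  obtain a where a: "a \<in> A" using ne by blast
  define B where "B = {x\<in>A. norm x \<le> norm a}"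
  have "finite B" "B \<noteq> {}" using f a by (auto simp: B_def)
  then obtain m where m: "m \<in> B" "\<And>x. x \<in> B \<Longrightarrow> norm m \<le> norm x"
    using arg_min_if_finite[of B norm] by (metis not_le)
  show ?thesis
  proof (rule bexI[of _ m])
    show "m \<in> A" using m(1) by (simp add: B_def)
    show "\<forall>x\<in>A. norm m \<le> norm x"
    proof
      fix x assume "x \<in> A"
      then show "norm m \<le> norm x" using m unfolding B_def by (cases "norm x \<le> norm a") auto
    qed
  qed
qed

text \<open>Gauss reduction: \<open>\<omega>1\<close> is a shortest nonzero vector and
  \<open>\<omega>2\<close> a shortest one off the real line of \<open>\<omega>1\<close>. Rounding
  the real coordinates of a lattice vector leaves a remainder too short to be anything but
  zero.\<close>

lemma complex_lattice_basis:
  fixes \<Lambda> :: "complex set"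
  assumes zero: "0 \<in> \<Lambda>" and diff: "\<And>x y. x \<in> \<Lambda> \<Longrightarrow> y \<in> \<Lambda> \<Longrightarrow> x - y \<in> \<Lambda>"
    and d: "d > 0" "\<And>x. x \<in> \<Lambda> \<Longrightarrow> x \<noteq> 0 \<Longrightarrow> norm x \<ge> d"
    and sp: "\<And>u. u \<noteq> 0 \<Longrightarrow> \<exists>x\<in>\<Lambda>. Im (x / u) \<noteq> 0"
  shows "\<exists>\<omega>1 \<omega>2. Im (\<omega>2 / \<omega>1) > 0 \<and> \<Lambda> = {of_int m * \<omega>1 + of_int n * \<omega>2 | m n. True}"
proof -
  have neg: "- x \<in> \<Lambda>" if "x \<in> \<Lambda>" for x using diff[OF zero that] by simp
  have add: "x + y \<in> \<Lambda>" if "x \<in> \<Lambda>" "y \<in> \<Lambda>" for x y using diff[OF that(1) neg[OF that(2)]] by simp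
  have natm: "of_nat n * x \<in> \<Lambda>" if "x \<in> \<Lambda>" for x n
    by (induction n) (auto simp: zero distrib_right intro: add that)
  have intm: "of_int n * x \<in> \<Lambda>" if "x \<in> \<Lambda>" for x n
    using natm[OF that, of "nat n"] neg[OF natm[OF that, of "nat (-n)"]] by (cases "n \<ge> 0") auto
  have fin: "finite {x\<in>A. norm x \<le> R}" if "A \<subseteq> \<Lambda>" for A R
  proof (rule uniformly_discrete_bounded_finite[OF d(1)])
    show "dist x y \<ge> d" if "x \<in> {x\<in>A. norm x \<le> R}" "y \<in> {x\<in>A. norm x \<le> R}" "x \<noteq> y" for x y
      unfolding dist_norm using that \<open>A \<subseteq> \<Lambda>\<close> by (intro d(2) diff) auto
    show "bounded {x\<in>A. norm x \<le> R}" by (auto simp: bounded_iff)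
  qed
  have "\<Lambda> - {0} \<noteq> {}" using sp[of 1] by auto
  from norm_minimal_exists[OF this fin] obtain \<omega>1 where w1: "\<omega>1 \<in> \<Lambda>" "\<omega>1 \<noteq> 0" "\<And>x. x \<in> \<Lambda> \<Longrightarrow> x \<noteq> 0 \<Longrightarrow> norm \<omega>1 \<le> norm x"
    by auto
  have "{x\<in>\<Lambda>. Im (x/\<omega>1) \<noteq> 0} \<noteq> {}" using sp[OF w1(2)] by auto
  from norm_minimal_exists[OF this fin] obtain \<omega>2 where w2: "\<omega>2 \<in> \<Lambda>" "Im (\<omega>2/\<omega>1) \<noteq> 0" 
    "\<And>x. x \<in> \<Lambda> \<Longrightarrow> Im (x/\<omega>1) \<noteq> 0 \<Longrightarrow> norm \<omega>2 \<le> norm x"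
    by auto
  have le: "norm \<omega>1 \<le> norm \<omega>2" using w1(3)[OF w2(1)] w2(2) by (cases "\<omega>2 = 0") auto
  have sq: "(norm (x *\<^sub>R \<omega>1 + y *\<^sub>R \<omega>2))\<^sup>2 = x\<^sup>2 * (norm \<omega>1)\<^sup>2 + y\<^sup>2 * (norm \<omega>2)\<^sup>2 + 2 * x * y * (\<omega>1 \<bullet> \<omega>2)" for x y
    by (simp add: power2_norm_eq_inner inner_simps inner_commute) (simp add: power2_eq_square algebra_simps)
  \<comment> \<open>Minimality of \<open>\<omega>2\<close> against
    \<open>\<omega>2 + \<omega>1\<close> and \<open>\<omega>2 - \<omega>1\<close> bounds the inner
    product on both sides.\<close>
  have ip: "2 * \<bar>\<omega>1 \<bullet> \<omega>2\<bar> \<le> (norm \<omega>1)\<^sup>2"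
  proof -
    have "Im ((\<omega>1 + \<omega>2)/\<omega>1) \<noteq> 0" "Im ((-\<omega>1 + \<omega>2)/\<omega>1) \<noteq> 0"
      using w1(2) w2(2) by (simp_all add: add_divide_distrib diff_divide_distrib)
    then have "norm \<omega>2 \<le> norm (\<omega>1 + \<omega>2)" "norm \<omega>2 \<le> norm (- \<omega>1 + \<omega>2)"
      using w2(3)[OF add[OF w1(1) w2(1)]] w2(3)[OF add[OF neg[OF w1(1)] w2(1)]] by blast+
    then have "(norm \<omega>2)\<^sup>2 \<le> (norm (1 *\<^sub>R \<omega>1 + 1 *\<^sub>R \<omega>2))\<^sup>2" "(norm \<omega>2)\<^sup>2 \<le> (norm ((-1) *\<^sub>R \<omega>1 + 1 *\<^sub>R \<omega>2))\<^sup>2"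
      by (auto intro!: power_mono)
    then show ?thesis unfolding sq by simp
  qed
  have main: "\<exists>m n. x = of_int m * \<omega>1 + of_int n * \<omega>2" if x: "x \<in> \<Lambda>" for x
  proof -
    define t where "t = \<omega>2 / \<omega>1"
    define q where "q = Im (x / \<omega>1) / Im t"
    define p where "p = Re (x / \<omega>1) - q * Re t"
    have "x / \<omega>1 = of_real p + of_real q * t"
      using w2(2)[folded t_def] by (simp add: complex_eq_iff p_def q_def)
    then have xpq: "x = p *\<^sub>R \<omega>1 + q *\<^sub>R \<omega>2"
      using w1(2) by (simp add: t_def field_simps scaleR_conv_of_real)
    define m n where "m = round p" and "n = round q"
    define x' y' where "x' = p - of_int m" and "y' = q - of_int n"
    have xy: "\<bar>x'\<bar> \<le> 1/2" "\<bar>y'\<bar> \<le> 1/2"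
      using of_int_round_abs_le[of p] of_int_round_abs_le[of q] by (auto simp: x'_def y'_def m_def n_def abs_minus_commute)
    define z where "z = x - (of_int m * \<omega>1 + of_int n * \<omega>2)"
    have z: "z = x' *\<^sub>R \<omega>1 + y' *\<^sub>R \<omega>2"
      unfolding z_def xpq x'_def y'_def by (simp add: scaleR_conv_of_real algebra_simps)
    have zL: "z \<in> \<Lambda>" unfolding z_def using x w1 w2 by (intro diff add intm)
    have x2: "x'\<^sup>2 \<le> 1/4" "y'\<^sup>2 \<le> 1/4"
      using xy power_mono[of "\<bar>x'\<bar>" "1/2" 2] power_mono[of "\<bar>y'\<bar>" "1/2" 2] by (auto simp: power2_eq_square)
    \<comment> \<open>Otherwise the remainder competes with \<open>\<omega>2\<close>. Its squared
      norm is bounded by three terms, each at most a quarter of the squared norm of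
      \<open>\<omega>2\<close>, in total 3/4 of it.\<close>
    have "y' = 0"
    proof (rule ccontr)
      assume "y' \<noteq> 0"
      have "Im (z / \<omega>1) = y' * Im (\<omega>2/\<omega>1)" 
      proof -
        have "z / \<omega>1 = of_real x' + of_real y' * (\<omega>2 / \<omega>1)" unfolding z using w1(2) by (simp add: add_divide_distrib scaleR_conv_of_real)
        moreover have "Im (of_real x' + of_real y' * w) = y' * Im w" for w by simp
        ultimately show ?thesis by metis
      qed
      then have "norm \<omega>2 \<le> norm z" using w2(2) \<open>y' \<noteq> 0\<close> zL by (intro w2(3)) auto
      then have "(norm \<omega>2)\<^sup>2 \<le> (norm z)\<^sup>2" by (simp add: power_mono)
      also have "\<dots> = x'\<^sup>2 * (norm \<omega>1)\<^sup>2 + y'\<^sup>2 * (norm \<omega>2)\<^sup>2 + 2 * x' * y' * (\<omega>1 \<bullet> \<omega>2)" unfolding z sq ..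
      also have "\<dots> \<le> 1/4 * (norm \<omega>1)\<^sup>2 + 1/4 * (norm \<omega>2)\<^sup>2 + 1/4 * (norm \<omega>1)\<^sup>2"
      proof (intro add_mono mult_right_mono)
        have "\<bar>x' * y'\<bar> \<le> 1/4" using mult_mono[OF xy] by (simp add: abs_mult)
        then have "\<bar>x' * y'\<bar> * (2 * \<bar>\<omega>1 \<bullet> \<omega>2\<bar>) \<le> 1/4 * (norm \<omega>1)\<^sup>2" using ip by (intro mult_mono) auto
        moreover have "2 * x' * y' * (\<omega>1 \<bullet> \<omega>2) \<le> \<bar>2 * x' * y' * (\<omega>1 \<bullet> \<omega>2)\<bar>" by simp
        moreover have "\<bar>2 * x' * y' * (\<omega>1 \<bullet> \<omega>2)\<bar> = \<bar>x' * y'\<bar> * (2 * \<bar>\<omega>1 \<bullet> \<omega>2\<bar>)" by (simp add: abs_mult)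
        ultimately show "2 * x' * y' * (\<omega>1 \<bullet> \<omega>2) \<le> 1/4 * (norm \<omega>1)\<^sup>2" by linarith
      qed (use x2 in auto)
      finally have "(norm \<omega>2)\<^sup>2 \<le> 3/4 * (norm \<omega>2)\<^sup>2"
        using power_mono[OF le norm_ge_zero, of 2] by linarith
      then show False using w2(2) by (auto simp: mult_le_cancel_right1)
    qed
    then have "z = x' *\<^sub>R \<omega>1" using z by simp
    then have "norm z = \<bar>x'\<bar> * norm \<omega>1" by simp
    also have "\<dots> \<le> 1/2 * norm \<omega>1" using xy by (intro mult_right_mono) auto
    also have "\<dots> < norm \<omega>1" using w1(2) by simp
    finally have "z = 0" using w1(3)[OF zL] by fastforce
    then show ?thesis unfolding z_def by auto
  qed
  have L: "\<Lambda> = {of_int m * \<omega>1 + of_int n * \<omega>2 | m n. True}"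
    using main add[OF intm[OF w1(1)] intm[OF w2(1)]] by blast
  show ?thesis
  proof (cases "Im (\<omega>2/\<omega>1) > 0")
    case True then show ?thesis using L by blast
  next
    case False
    \<comment> \<open>Changing the sign of \<open>\<omega>2\<close> orients the basis and keeps the
      group it generates.\<close>
    have "{of_int m * \<omega>1 + of_int n * \<omega>2 | m n. True} = {of_int m * \<omega>1 + of_int n * (-\<omega>2) | m n. True}"
      (is "?A = ?B")
    proof (intro equalityI subsetI)
      fix x assume "x \<in> ?A"
      then obtain m n :: int where "x = of_int m * \<omega>1 + of_int n * \<omega>2" by auto
      then have "x = of_int m * \<omega>1 + of_int (-n) * (-\<omega>2)" by simp
      then show "x \<in> ?B" by blast
    next
      fix x assume "x \<in> ?B"
      then obtain m n :: int where "x = of_int m * \<omega>1 + of_int n * (-\<omega>2)" by auto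
      then have "x = of_int m * \<omega>1 + of_int (-n) * \<omega>2" by simp
      then show "x \<in> ?A" by blast
    qed
    then show ?thesis using L False w2(2) by (intro exI[of _ \<omega>1] exI[of _ "-\<omega>2"]) (auto simp: not_less)
  qed
qed

section \<open>Kronecker functions for an arbitrary plane lattice\<close>

lemma kronecker_function_basis:
  fixes c \<omega>1 \<omega>2 :: complex
  assumes im: "Im (\<omega>2 / \<omega>1) > 0" and \<Lambda>: "\<Lambda> = {of_int m * \<omega>1 + of_int n * \<omega>2 | m n. True}"
    and nt: "eC (Im (c * cnj \<omega>1)) \<noteq> 1"
  shows "\<exists>F. (\<forall>x. x \<notin> \<Lambda> \<longrightarrow> F field_differentiable at x) \<and>
     (\<forall>x. \<forall>q\<in>\<Lambda>. F (x + q) = eC (Im (c * cnj q)) * F x) \<and> ((\<lambda>x. x * F x) \<longlongrightarrow> 1) (at 0)"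
proof -
  define \<tau> where "\<tau> = \<omega>2 / \<omega>1"
  have w1: "\<omega>1 \<noteq> 0" using im by auto
  define a0 where "a0 = Im (c * cnj \<omega>1)"
  \<comment> \<open>The kernel needs an exponent strictly between 0 and 1. Nontriviality on
    \<open>\<omega>1\<close> says that \<open>a0\<close> is no integer, and passing to the
    fractional part changes no multiplier.\<close>
  define a where "a = frac a0"
  define b where "b = Im (c * cnj \<omega>2)"
  have "a0 \<notin> \<int>" using nt by (auto simp: a0_def elim!: Ints_cases)
  then have a: "0 < a" "a < 1" by (auto simp: a_def frac_gt_0_iff frac_lt_1)
  have a0: "eC (a * of_int m) = eC (a0 * of_int m)" for m
  proof -
    have "a0 * of_int m = a * of_int m + of_int (\<lfloor>a0\<rfloor> * m)" by (simp add: a_def frac_def algebra_simps)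
    then show ?thesis by (simp only: eC_add eC_int mult_1_right)
  qed
  have \<tau>0: "Im \<tau> > 0" using im by (simp add: \<tau>_def)
  \<comment> \<open>The prefactor undoes the residue -1/(2 pi i) of the series and the rescaling by
    \<open>\<omega>1\<close>, so that the residue becomes 1.\<close>
  define F where "F = (\<lambda>x. (- 2 * pi * \<i> / \<omega>1) * kron_sum a b \<tau> (x / \<omega>1))"
  show ?thesis
  proof (intro exI[of _ F] conjI allI ballI impI)
    fix x assume x: "x \<notin> \<Lambda>"
    have "kron_sum a b \<tau> field_differentiable at (x / \<omega>1)"
    proof (rule kron_sum_differentiable[OF a \<tau>0])
      fix m n :: int
      show "x / \<omega>1 \<noteq> of_int m + of_int n * \<tau>"
      proof
        assume "x / \<omega>1 = of_int m + of_int n * \<tau>"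
        then have "x = of_int m * \<omega>1 + of_int n * \<omega>2" using w1 by (simp add: \<tau>_def field_simps)
        then show False using x \<Lambda> by blast
      qed
    qed
    then have "(kron_sum a b \<tau> \<circ> (\<lambda>x. x / \<omega>1)) field_differentiable at x"
      using w1 by (intro field_differentiable_compose field_differentiable_divide) auto
    then show "F field_differentiable at x" unfolding F_def o_def
      by (intro field_differentiable_mult) auto
  next
    fix x q assume "q \<in> \<Lambda>"
    then obtain m n :: int where l: "q = of_int m * \<omega>1 + of_int n * \<omega>2" using \<Lambda> by auto
    have "(x + q) / \<omega>1 = (x / \<omega>1 + of_int m) + of_int n * \<tau>" using w1 by (simp add: l \<tau>_def field_simps)
    then have "F (x + q) = eC (b * of_int n) * eC (a0 * of_int m) * F x"
      unfolding F_def by (simp add: kron_sum_add_tau kron_sum_add_int a0)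
    also have "eC (b * of_int n) * eC (a0 * of_int m) = eC (b * of_int n + a0 * of_int m)"
      by (simp add: eC_add)
    also have "b * of_int n + a0 * of_int m = Im (c * cnj q)"
      by (simp add: l a0_def b_def algebra_simps)
    finally show "F (x + q) = eC (Im (c * cnj q)) * F x" .
  next
    have "((\<lambda>x. (x/\<omega>1) * kron_sum a b \<tau> (x/\<omega>1)) \<longlongrightarrow> - 1 / (2 * pi * \<i>)) (at 0)"
    proof -
      have "filterlim (\<lambda>x. x / \<omega>1) (at 0) (at (0::complex))"
        using w1 by (auto simp: filterlim_at eventually_at_filter intro!: tendsto_eq_intros)
      from filterlim_compose[OF kron_sum_residue[OF a \<tau>0] this] show ?thesis by simp
    qed
    then have "((\<lambda>x. (- 2 * pi * \<i>) * ((x/\<omega>1) * kron_sum a b \<tau> (x/\<omega>1))) \<longlongrightarrow> (- 2 * pi * \<i>) * (- 1 / (2 * pi * \<i>))) (at 0)"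
      by (intro tendsto_intros)
    then show "((\<lambda>x. x * F x) \<longlongrightarrow> 1) (at 0)" unfolding F_def by (simp add: mult_ac)
  qed
qed

text \<open>The series demands a nontrivial multiplier along the first basis vector. If
  \<open>\<omega>1\<close> has multiplier 1, nontriviality somewhere forces it on
  \<open>\<omega>2\<close>, and \<open>(-\<omega>2, \<omega>1)\<close> is again a positively
  oriented basis.\<close>

lemma kronecker_function_exists:
  fixes \<Lambda> :: "complex set" and c :: complex
  assumes zero: "0 \<in> \<Lambda>" and diff: "\<And>x y. x \<in> \<Lambda> \<Longrightarrow> y \<in> \<Lambda> \<Longrightarrow> x - y \<in> \<Lambda>"
    and d: "d > 0" "\<And>x. x \<in> \<Lambda> \<Longrightarrow> x \<noteq> 0 \<Longrightarrow> norm x \<ge> d"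
    and sp: "\<And>u. u \<noteq> 0 \<Longrightarrow> \<exists>x\<in>\<Lambda>. Im (x / u) \<noteq> 0"
    and nt: "q0 \<in> \<Lambda>" "eC (Im (c * cnj q0)) \<noteq> 1"
  shows "\<exists>F. (\<forall>x. x \<notin> \<Lambda> \<longrightarrow> F field_differentiable at x) \<and>
     (\<forall>x. \<forall>q\<in>\<Lambda>. F (x + q) = eC (Im (c * cnj q)) * F x) \<and> ((\<lambda>x. x * F x) \<longlongrightarrow> 1) (at 0)"
proof -
  obtain \<omega>1 \<omega>2 where im: "Im (\<omega>2 / \<omega>1) > 0" and L: "\<Lambda> = {of_int m * \<omega>1 + of_int n * \<omega>2 | m n. True}"
    using complex_lattice_basis[OF zero diff d sp] by blast
  show ?thesis
  proof (cases "eC (Im (c * cnj \<omega>1)) = 1")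
    case False
    then show ?thesis by (rule kronecker_function_basis[OF im L])
  next
    case True
    have nz: "\<omega>1 \<noteq> 0" "\<omega>2 \<noteq> 0" using im by auto
    have e2: "eC (Im (c * cnj (-\<omega>2))) \<noteq> 1"
    proof
      assume "eC (Im (c * cnj (-\<omega>2))) = 1"
      then have w2: "eC (Im (c * cnj \<omega>2)) = 1" using eC_minus[of "Im (c * cnj \<omega>2)"] by simp
      have pw: "eC (of_int n * x) = 1" if "eC x = 1" for n x
      proof -
        have nn: "eC (real k * x) = 1" for k
          by (induction k) (simp_all add: distrib_right eC_add that)
        show ?thesis
          using nn[of "nat n"] nn[of "nat (-n)"] eC_minus[of "real (nat (-n)) * x"] by (cases "n \<ge> 0") auto
      qed
      obtain m n :: int where q: "q0 = of_int m * \<omega>1 + of_int n * \<omega>2" using nt(1) L by auto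
      have "Im (c * cnj q0) = of_int m * Im (c * cnj \<omega>1) + of_int n * Im (c * cnj \<omega>2)"
        by (simp add: q algebra_simps)
      then have "eC (Im (c * cnj q0)) = 1" by (simp only: eC_add pw[OF True] pw[OF w2] mult_1_right)
      then show False using nt(2) by simp
    qed
    have "\<omega>1 / (-\<omega>2) = - inverse (\<omega>2 / \<omega>1)" by simp
    then have "Im (\<omega>1 / (-\<omega>2)) = Im (\<omega>2 / \<omega>1) / ((Re (\<omega>2/\<omega>1))\<^sup>2 + (Im (\<omega>2/\<omega>1))\<^sup>2)"
      by (simp only: uminus_complex.simps inverse_complex.simps)
    then have im': "Im (\<omega>1 / (-\<omega>2)) > 0" using im
      by (metis divide_pos_pos add_nonneg_pos zero_le_power2 zero_less_power)
    have L': "\<Lambda> = {of_int m * (-\<omega>2) + of_int n * \<omega>1 | m n. True}"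
    proof (intro equalityI subsetI)
      fix x assume "x \<in> \<Lambda>"
      then obtain m n :: int where "x = of_int m * \<omega>1 + of_int n * \<omega>2" using L by auto
      then have "x = of_int (-n) * (-\<omega>2) + of_int m * \<omega>1" by simp
      then show "x \<in> {of_int m * (-\<omega>2) + of_int n * \<omega>1 | m n. True}" by blast
    next
      fix x assume "x \<in> {of_int m * (-\<omega>2) + of_int n * \<omega>1 | m n. True}"
      then obtain m n :: int where "x = of_int m * (-\<omega>2) + of_int n * \<omega>1" by auto
      then have "x = of_int n * \<omega>1 + of_int (-m) * \<omega>2" by simp
      then show "x \<in> \<Lambda>" unfolding L by blast
    qed
    show ?thesis by (rule kronecker_function_basis[OF im' L' e2])
  qed
qed

section \<open>Holomorphic functions of several variables\<close>

lemma pair_add: "pair l (x + y) = pair l x + pair l y"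
  by (simp add: pair_def algebra_simps sum.distrib)

lemma pair_diff: "pair l (x - y) = pair l x - pair l y"
  by (simp add: pair_def algebra_simps sum_subtractf)

lemma pair_scale: "pair l (c *s x) = c * pair l x"
  by (simp add: pair_def sum_distrib_left mult_ac)

lemma pair_0 [simp]: "pair l 0 = 0" "pair 0 x = 0"
  by (simp_all add: pair_def)

lemma bounded_linear_pair: "bounded_linear (pair l)"
proof -
  have "linear (pair l)"
    by (rule linearI) (simp add: pair_add, simp add: pair_def scaleR_sum_right)
  then show ?thesis by (simp add: linear_conv_bounded_linear)
qed

lemma isCont_pair [continuous_intros]: "isCont (pair l) z"
  using bounded_linear_pair by (rule linear_continuous_at)

lemma pair_axis: "pair l (axis i 1) = l $ i"
  by (simp add: pair_def axis_def if_distrib[of "\<lambda>x. _ * x"] cong: if_cong)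

lemma pair_eq_0_iff: "(\<forall>v. pair l v = 0) \<longleftrightarrow> l = 0"
proof
  assume "\<forall>v. pair l v = 0"
  then show "l = 0" using pair_axis[of l] by (simp add: vec_eq_iff)
qed simp

lemma norm_smult: "norm (a *s w) = norm a * norm w" for a :: complex and w :: "complex^'n"
  by (simp add: norm_vec_def norm_mult L2_set_right_distrib)

lemma has_derivative_line: "((\<lambda>t. z + t *s v) has_derivative (\<lambda>t. t *s v)) (at (t0::complex))"
  for v :: "complex^'n"
proof -
  have "linear (\<lambda>t::complex. t *s v)"
    by (rule linearI) (simp_all add: vec_eq_iff distrib_right)
  then have "((\<lambda>t. t *s v) has_derivative (\<lambda>t. t *s v)) (at t0)"
    by (simp add: linear_conv_bounded_linear bounded_linear_imp_has_derivative)
  from has_derivative_add[OF has_derivative_const[of z] this] show ?thesis by simp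
qed

lemma isCont_line: "isCont (\<lambda>t::complex. z + t *s v) t0"
  using has_derivative_line by (rule has_derivative_continuous)

lemma continuous_on_line: "continuous_on S (\<lambda>t::complex. z + t *s v)"
  by (intro continuous_at_imp_continuous_on ballI isCont_line)

text \<open>\<open>dd\<close> is a derivative at the parameter 0; shifting the parameter makes it
  the derivative at every point of a line, so that one-variable theorems apply to
  restrictions.\<close>

lemma holo_line_deriv:
  assumes f: "holo U f" and z: "z + t0 *s v \<in> U"
  shows "((\<lambda>t. f (z + t *s v)) has_field_derivative dd v f (z + t0 *s v)) (at t0)"
proof -
  have *: "\<exists>c. ((\<lambda>t. f (y + t *s v)) has_field_derivative c) (at t1)" if y: "y + t1 *s v \<in> U" for y t1
  proof -
    obtain D where D: "(f has_derivative D) (at (y + t1 *s v))" "\<And>c v. D (c *s v) = c * D v"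
      using f y unfolding holo_def by blast
    have "((\<lambda>t. f (y + t *s v)) has_derivative (\<lambda>t. D (t *s v))) (at t1)"
      using has_derivative_compose[OF has_derivative_line D(1)] .
    then have "((\<lambda>t. f (y + t *s v)) has_field_derivative D v) (at t1)"
      by (simp add: D(2) has_field_derivative_def mult.commute[of _ "D v"])
    then show ?thesis by blast
  qed
  obtain c where c: "((\<lambda>t. f (z + t *s v)) has_field_derivative c) (at t0)" using *[OF z] by blast
  have "((\<lambda>t. f (z + (t + t0) *s v)) has_field_derivative c) (at 0)"
    using c DERIV_shift[of "\<lambda>t. f (z + t *s v)" c 0 t0] by simp
  moreover have "z + (t + t0) *s v = z + t0 *s v + t *s v" for t
    by (simp add: vec_eq_iff algebra_simps)
  ultimately have "dd v f (z + t0 *s v) = c"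
    unfolding dd_def by (simp only: DERIV_imp_deriv)
  then show ?thesis using c by simp
qed

lemma holo_has_derivative:
  assumes f: "holo U f" and z: "z \<in> U"
  shows "(f has_derivative (\<lambda>v. dd v f z)) (at z)" and "dd (c *s v) f z = c * dd v f z"
    and "dd (v + w) f z = dd v f z + dd w f z"
proof -
  obtain D where D: "(f has_derivative D) (at z)" "\<And>c v. D (c *s v) = c * D v"
    using f z unfolding holo_def by blast
  have DD: "D v = dd v f z" for v
  proof -
    have "(f has_derivative D) (at (z + 0 *s v))" using D(1) by simp
    then have "((\<lambda>t. f (z + t *s v)) has_derivative (\<lambda>t. D (t *s v))) (at 0)"
      using has_derivative_compose[OF has_derivative_line] by blast
    then have "((\<lambda>t. f (z + t *s v)) has_field_derivative D v) (at 0)"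
      by (simp add: D(2) has_field_derivative_def mult.commute[of _ "D v"])
    then show ?thesis unfolding dd_def by (simp add: DERIV_imp_deriv)
  qed
  then have "D = (\<lambda>v. dd v f z)" by auto
  then show "(f has_derivative (\<lambda>v. dd v f z)) (at z)" "dd (c *s v) f z = c * dd v f z"
    using D by auto
  show "dd (v + w) f z = dd v f z + dd w f z"
    using has_derivative_linear[OF D(1)] by (simp add: DD[symmetric] linear_add)
qed

lemma holo_isCont: "holo U f \<Longrightarrow> z \<in> U \<Longrightarrow> isCont f z"
  using holo_has_derivative(1) has_derivative_continuous by blast

lemma holo_subset: "holo U f \<Longrightarrow> V \<subseteq> U \<Longrightarrow> holo V f"
  unfolding holo_def by blast

text \<open>Uniformity in \<open>b\<close> is the point: Cauchy's estimate bounds all second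
  derivatives by one constant, and the first-order Taylor remainder divided by \<open>h\<close> is
  at most that constant times \<open>|h|\<close>.\<close>

lemma difference_quotient_uniform_limit:
  fixes F :: "'b \<Rightarrow> complex \<Rightarrow> complex"
  assumes R: "R > 0" 
    and h: "\<And>b. b \<in> B \<Longrightarrow> F b holomorphic_on ball 0 R"
    and M: "\<And>b a. b \<in> B \<Longrightarrow> a \<in> ball 0 R \<Longrightarrow> norm (F b a) < M"
  shows "uniform_limit B (\<lambda>h b. (F b h - F b 0) / h) (\<lambda>b. deriv (F b) 0) (at 0)"
proof -
  \<comment> \<open>The 2 is the factorial of 2 in Cauchy's estimate; discs of radius
    \<open>R/3\<close> around points of \<open>cball 0 (R/3)\<close> stay in
    \<open>ball 0 R\<close>.\<close>
  define C where "C = 2 * M / (R/3)^2"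
  have b2: "norm ((deriv ^^ 2) (F b) x) \<le> C" if "b \<in> B" "x \<in> cball 0 (R/3)" for b x
  proof -
    have sub: "cball x (R/3) \<subseteq> ball 0 R"
    proof
      fix y assume "y \<in> cball x (R/3)"
      then have "norm y \<le> 2 * R / 3" using that(2) norm_triangle_ineq[of "y - x" x]
        by (auto simp: dist_norm norm_minus_commute)
      then show "y \<in> ball 0 R" using R by simp
    qed
    have "norm ((deriv ^^ 2) (F b) x) \<le> fact 2 * M / (R/3)^2"
    proof (rule Cauchy_higher_deriv_bound[of _ _ _ 0])
      show "F b holomorphic_on ball x (R/3)"
        using h[OF that(1)] sub by (meson ball_subset_cball holomorphic_on_subset)
      show "continuous_on (cball x (R/3)) (F b)"
        using h[OF that(1)] sub holomorphic_on_imp_continuous_on continuous_on_subset by blast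
      show "F b w \<in> ball 0 M" if "w \<in> ball x (R/3)" for w
        using M[OF \<open>b \<in> B\<close>, of w] that sub by force
    qed (use R in auto)
    then show ?thesis by (simp add: C_def)
  qed
  have est: "norm ((F b x - F b 0) / x - deriv (F b) 0) \<le> C * norm x"
    if "b \<in> B" "x \<in> cball 0 (R/3)" "x \<noteq> 0" for b x
  proof -
    have sub: "cball (0::complex) (R/3) \<subseteq> ball 0 R" using R by auto
    have "norm ((deriv ^^ 0) (F b) x - (\<Sum>i\<le>1. (deriv ^^ i) (F b) 0 * (x - 0)^i / fact i))
        \<le> C * norm (x - 0) ^ Suc 1 / fact 1"
    proof (rule complex_Taylor[where S = "cball 0 (R/3)" and f = "\<lambda>i. (deriv ^^ i) (F b)"])
      fix i y assume y: "y \<in> cball (0::complex) (R/3)"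
      have "(deriv ^^ i) (F b) holomorphic_on ball 0 R" by (rule holomorphic_higher_deriv[OF h[OF that(1)]]) simp
      then have "((deriv ^^ i) (F b) has_field_derivative deriv ((deriv ^^ i) (F b)) y) (at y)"
        using y sub by (intro holomorphic_derivI[of _ "ball 0 R"]) auto
      then show "((deriv ^^ i) (F b) has_field_derivative (deriv ^^ Suc i) (F b) y) (at y within cball 0 (R/3))"
        by (simp add: has_field_derivative_at_within)
    next
      fix y assume "y \<in> cball (0::complex) (R/3)"
      then show "norm ((deriv ^^ Suc 1) (F b) y) \<le> C" using b2[OF that(1)] by (simp add: numeral_2_eq_2)
    qed (use R that in auto)
    then have "norm (F b x - F b 0 - deriv (F b) 0 * x) \<le> C * norm x ^ 2" by (simp add: power2_eq_square diff_diff_eq)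
    then have "norm (F b x - F b 0 - deriv (F b) 0 * x) / norm x \<le> C * norm x"
      using that(3) by (simp add: field_simps power2_eq_square)
    moreover have "(F b x - F b 0) / x - deriv (F b) 0 = (F b x - F b 0 - deriv (F b) 0 * x) / x"
      using that(3) by (simp add: field_simps)
    ultimately show ?thesis by (simp add: norm_divide)
  qed
  show ?thesis
  proof (rule uniform_limitI)
    fix e :: real assume e: "e > 0"
    define \<delta> where "\<delta> = min (R/3) (e / (\<bar>C\<bar> + 1))"
    have \<delta>: "\<delta> > 0" using R e by (simp add: \<delta>_def)
    have "dist ((F b x - F b 0) / x) (deriv (F b) 0) < e" if "b \<in> B" "x \<noteq> 0" "norm x < \<delta>" for b x
    proof -
      have "norm ((F b x - F b 0) / x - deriv (F b) 0) \<le> C * norm x"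
        using that by (intro est) (auto simp: \<delta>_def)
      also have "\<dots> \<le> (\<bar>C\<bar> + 1) * norm x" by (intro mult_right_mono) auto
      also have "\<dots> < (\<bar>C\<bar> + 1) * (e / (\<bar>C\<bar> + 1))" 
        using that by (intro mult_strict_left_mono) (auto simp: \<delta>_def)
      finally show ?thesis by (simp add: dist_norm)
    qed
    then show "\<forall>\<^sub>F x in at 0. \<forall>b\<in>B. dist ((F b x - F b 0) / x) (deriv (F b) 0) < e"
      unfolding eventually_at using \<delta> by (intro exI[of _ \<delta>]) auto
  qed
qed

text \<open>\<open>holo\<close> gives one complex derivative only. Along \<open>v\<close>, the
  function \<open>dd u f\<close> is a uniform limit of the difference quotients \<open>Q h\<close>,
  so their derivatives \<open>Q' h\<close> converge as well; these are the difference quotients of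
  \<open>dd v f\<close> along \<open>u\<close>. The existence of the second derivative and the
  symmetry come out of the same limit.\<close>

lemma holo_second_derivative:
  assumes f: "holo U f" and U: "open U" and z: "z \<in> U"
  shows "((\<lambda>t. dd u f (z + t *s v)) has_field_derivative dd v (dd u f) z) (at 0)"
    and "dd v (dd u f) z = dd u (dd v f) z"
proof -
  obtain r where r: "r > 0" "cball z r \<subseteq> U" using U z open_contains_cball by blast
  \<comment> \<open>Small enough for \<open>z + a *s u + b *s v\<close> to remain in
    \<open>cball z r\<close> when both parameters have modulus at most \<open>R\<close>; the added 1
    keeps the denominator positive when both directions are 0.\<close>
  define R where "R = r / (2 * (norm u + norm v + 1))"
  have R: "R > 0" using r by (simp add: R_def add_nonneg_pos)
  have inU: "z + a *s u + b *s v \<in> cball z r" if "norm a \<le> R" "norm b \<le> R" for a b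
  proof -
    have "norm (a *s u + b *s v) \<le> norm a * norm u + norm b * norm v"
      using norm_triangle_ineq[of "a *s u" "b *s v"] by (simp add: norm_smult)
    also have "\<dots> \<le> R * norm u + R * norm v" using that by (intro add_mono mult_right_mono) auto
    also have "\<dots> \<le> R * (2 * (norm u + norm v + 1))" 
      using R by (simp add: algebra_simps)
    also have "\<dots> = r"
    proof -
      have "2 * (norm u + norm v + 1) \<noteq> 0" using add_nonneg_pos[of "norm u + norm v" 1] by simp
      then show ?thesis unfolding R_def by simp
    qed
    finally show ?thesis by (simp add: dist_norm norm_minus_commute add.assoc add.commute)
  qed
  have "compact (f ` cball z r)"
    using f r by (intro compact_continuous_image continuous_at_imp_continuous_on ballI holo_isCont) auto
  then obtain M0 where M0: "\<And>x. x \<in> cball z r \<Longrightarrow> norm (f x) \<le> M0"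
    using compact_imp_bounded bounded_iff by (metis image_eqI)
  define M where "M = M0 + 1"
  have M: "norm (f x) < M" if "x \<in> cball z r" for x using M0[OF that] by (simp add: M_def)
  have comm: "z + a *s u + b *s v = z + b *s v + a *s u" for a b by simp
  define g where "g = (\<lambda>b. dd u f (z + b *s v))"
  define Q where "Q = (\<lambda>h b. (f (z + b *s v + h *s u) - f (z + b *s v)) / h)"
  define Q' where "Q' = (\<lambda>h b. (dd v f (z + h *s u + b *s v) - dd v f (z + b *s v)) / h)"
  have gder: "g b = deriv (\<lambda>a. f (z + b *s v + a *s u)) 0" for b
    unfolding g_def dd_def by (simp add: add.assoc)
  have ul: "uniform_limit (cball 0 R) Q g (at 0)"
  proof -
    have "uniform_limit (cball 0 R) (\<lambda>h b. (f (z + b *s v + h *s u) - f (z + b *s v + 0 *s u)) / h)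
        (\<lambda>b. deriv (\<lambda>a. f (z + b *s v + a *s u)) 0) (at 0)"
    proof (rule difference_quotient_uniform_limit[OF R])
      fix b assume b: "b \<in> cball (0::complex) R"
      show "(\<lambda>a. f (z + b *s v + a *s u)) holomorphic_on ball 0 R"
        unfolding holomorphic_on_def field_differentiable_def
      proof
        fix x assume x: "x \<in> ball (0::complex) R"
        have "z + b *s v + x *s u \<in> U" using inU[of x b] x b r(2) by (auto simp: comm)
        from holo_line_deriv[OF f this]
        show "\<exists>f'. ((\<lambda>a. f (z + b *s v + a *s u)) has_field_derivative f') (at x within ball 0 R)"
          using has_field_derivative_at_within by blast
      qed
      show "norm (f (z + b *s v + a *s u)) < M" if "a \<in> ball 0 R" for a
        using inU[of a b] that b by (intro M) (auto simp: comm)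
    qed
    then show ?thesis unfolding Q_def gder[abs_def] by simp
  qed
  have ev: "\<forall>\<^sub>F h in at 0. continuous_on (cball 0 R) (Q h) \<and>
      (\<forall>w\<in>ball 0 R. (Q h has_field_derivative Q' h w) (at w))"
  proof -
    have D: "((\<lambda>b. f (z + b *s v + h *s u)) has_field_derivative dd v f (z + h *s u + w *s v)) (at w)"
      if "norm h \<le> R" "norm w \<le> R" for h w
    proof -
      have "z + h *s u + w *s v \<in> U" using inU that r by auto
      from holo_line_deriv[OF f this] show ?thesis by (simp add: comm)
    qed
    have "(Q h has_field_derivative Q' h w) (at w)" if "norm h \<le> R" "norm w \<le> R" "h \<noteq> 0" for h w
      unfolding Q_def Q'_def using D[OF that(1,2)] D[of 0, OF _ that(2)] R that(3)
      by (auto intro!: derivative_eq_intros)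
    then have "continuous_on (cball 0 R) (Q h) \<and> (\<forall>w\<in>ball 0 R. (Q h has_field_derivative Q' h w) (at w))"
      if "norm h \<le> R" "h \<noteq> 0" for h
      using that by (auto intro!: continuous_at_imp_continuous_on DERIV_isCont)
    then show ?thesis unfolding eventually_at using R by (intro exI[of _ R]) auto
  qed
  obtain g' where g': "\<And>w. w \<in> ball 0 R \<Longrightarrow> (g has_field_derivative (g' w)) (at w) \<and> ((\<lambda>h. Q' h w) \<longlongrightarrow> g' w) (at 0)"
    using has_complex_derivative_uniform_limit[OF ev ul _ R] by auto
  have 1: "(g has_field_derivative g' 0) (at 0)" using g'[of 0] R by auto
  have "((\<lambda>h. (dd v f (z + h *s u) - dd v f z) / h) \<longlongrightarrow> g' 0) (at 0)"
    using g'[of 0] R by (simp add: Q'_def)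
  then have 2: "((\<lambda>h. dd v f (z + h *s u)) has_field_derivative g' 0) (at 0)"
    by (simp add: has_field_derivative_iff)
  have "dd v (dd u f) z = g' 0" "dd u (dd v f) z = g' 0"
    using 1 2 unfolding g_def by (simp_all add: dd_def[of v "dd u f"] dd_def[of u "dd v f"] DERIV_imp_deriv)
  then show "((\<lambda>t. dd u f (z + t *s v)) has_field_derivative dd v (dd u f) z) (at 0)" "dd v (dd u f) z = dd u (dd v f) z"
    using 1 unfolding g_def by auto
qed

text \<open>The identity theorem on the complex line joining a point of \<open>B\<close> to a point
  where \<open>h\<close> is nonzero. The parameters that stay in the ball form a convex set, hence a
  connected domain.\<close>

lemma holo_nonzero_dense:
  assumes h: "holo (ball z0 r) h" and nz: "\<exists>z\<in>ball z0 r. h z \<noteq> 0" and B: "open B" "B \<inter> ball z0 r \<noteq> {}"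
  shows "\<exists>z\<in>B \<inter> ball z0 r. h z \<noteq> 0"
proof (rule ccontr)
  assume z: "\<not> ?thesis"
  obtain y where y: "y \<in> B" "y \<in> ball z0 r" using B by blast
  obtain x where x: "x \<in> ball z0 r" "h x \<noteq> 0" using nz by blast
  define L where "L = (\<lambda>t::complex. y + t *s (x - y))"
  define T where "T = L -` ball z0 r"
  have Lc: "continuous_on UNIV L" unfolding L_def by (rule continuous_on_line)
  have "open T" unfolding T_def using Lc by (simp add: open_vimage)
  have "convex T"
  proof (rule convexI)
    fix s t :: complex and a b :: real
    assume st: "s \<in> T" "t \<in> T" and ab: "0 \<le> a" "0 \<le> b" "a + b = 1"
    have "L (a *\<^sub>R s + b *\<^sub>R t) = a *\<^sub>R L s + b *\<^sub>R L t"
    proof -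
      have "y = a *\<^sub>R y + b *\<^sub>R y" using ab by (simp add: scaleR_add_left[symmetric])
      then have "L (a *\<^sub>R s + b *\<^sub>R t) = a *\<^sub>R y + b *\<^sub>R y + (a *\<^sub>R s + b *\<^sub>R t) *s (x - y)"
        unfolding L_def by metis
      also have "\<dots> = a *\<^sub>R L s + b *\<^sub>R L t" unfolding L_def by (simp add: vec_eq_iff algebra_simps)
      finally show ?thesis .
    qed
    then show "a *\<^sub>R s + b *\<^sub>R t \<in> T" using st ab convex_ball[of z0 r] unfolding T_def convex_def by auto
  qed
  then have "connected T" by (rule convex_connected)
  have hol: "(h \<circ> L) holomorphic_on T"
    unfolding holomorphic_on_def field_differentiable_def
  proof
    fix t assume "t \<in> T"
    then have "y + t *s (x - y) \<in> ball z0 r" by (simp add: T_def L_def)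
    from holo_line_deriv[OF h this] show "\<exists>f'. (h \<circ> L has_field_derivative f') (at t within T)"
      unfolding o_def L_def using has_field_derivative_at_within by blast
  qed
  define V where "V = L -` (B \<inter> ball z0 r)"
  have V: "open V" "V \<subseteq> T" "0 \<in> V"
    unfolding V_def T_def using Lc B y by (auto simp: open_vimage open_Int L_def)
  have "(h \<circ> L) 1 = 0"
  proof (rule analytic_continuation[OF hol \<open>open T\<close> \<open>connected T\<close> V(2)])
    show "0 \<in> T" using V by auto
    show "0 islimpt V" using V by (simp add: interior_limit_point interior_open)
    show "(h \<circ> L) t = 0" if "t \<in> V" for t using z that unfolding V_def by auto
    show "1 \<in> T" using x by (simp add: T_def L_def)
  qed
  then show False using x by (simp add: L_def)
qed

section \<open>Quasi-periodic functions with removable singularities along hyperplanes\<close>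

text \<open>In the inductive step \<open>d\<close> moves along a vector on which the new form is
  nonzero. Each form excludes at most one multiple of that vector, so a good multiple
  remains.\<close>

lemma vector_off_kernels:
  fixes L :: "(complex^'n) set"
  assumes "finite L" "0 \<notin> L"
  shows "\<exists>d. \<forall>m\<in>L. pair m d \<noteq> 0"
  using assms
proof (induction rule: finite_induct)
  case (insert m L)
  then obtain d where d: "\<And>k. k \<in> L \<Longrightarrow> pair k d \<noteq> 0" by auto
  show ?case
  proof (cases "pair m d = 0")
    case True
    have "m \<noteq> 0" using insert by auto
    then obtain f where f: "pair m f \<noteq> 0" using pair_eq_0_iff[of m] by blast
    have "finite (insert 0 ((\<lambda>k. - pair k d / pair k f) ` L))" using insert by auto
    then obtain s where s: "s \<notin> insert 0 ((\<lambda>k. - pair k d / pair k f) ` L)"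
      using ex_new_if_finite[OF infinite_UNIV_char_0] by blast
    have "pair k (d + s *s f) \<noteq> 0" if "k \<in> L" for k
    proof
      assume e: "pair k (d + s *s f) = 0"
      then have e': "pair k d + s * pair k f = 0" by (simp add: pair_add pair_scale)
      then have "pair k f \<noteq> 0" using d[OF that] by auto
      then have "s = - pair k d / pair k f" using e' by (simp add: field_simps add_eq_0_iff)
      then show False using s that by auto
    qed
    moreover have "pair m (d + s *s f) \<noteq> 0" using True f s by (simp add: pair_add pair_scale)
    ultimately show ?thesis by blast
  next
    case False then show ?thesis using d by blast
  qed
qed auto

text \<open>On a line transverse to every form, each condition excludes only countably many
  parameters out of uncountably many. Countability rather than discreteness is asked because linear
  combinations of two discrete sets of values occur in the application.\<close>

lemma dense_off_countable_hyperplanes: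
  fixes m :: "'j \<Rightarrow> complex^'n"
  assumes J: "finite J" and nz: "\<And>j. j \<in> J \<Longrightarrow> m j \<noteq> 0" and Q: "\<And>j. j \<in> J \<Longrightarrow> countable (Q j)"
    and O: "open X" "z0 \<in> X"
  shows "\<exists>z\<in>X. \<forall>j\<in>J. pair (m j) z \<notin> Q j"
proof -
  have "finite (m ` J)" "0 \<notin> m ` J" using J nz by force+
  from vector_off_kernels[OF this] obtain d where d: "\<And>j. j \<in> J \<Longrightarrow> pair (m j) d \<noteq> 0" by auto
  have "open ((\<lambda>t::complex. z0 + t *s d) -` X)"
    using continuous_on_line[of UNIV z0 d] O(1) by (simp add: open_vimage)
  moreover have "0 \<in> (\<lambda>t::complex. z0 + t *s d) -` X" using O(2) by simp
  ultimately obtain r where r: "r > 0" "ball 0 r \<subseteq> (\<lambda>t::complex. z0 + t *s d) -` X"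
    using open_contains_ball by blast
  define B where "B = (\<Union>j\<in>J. (\<lambda>q. (q - pair (m j) z0) / pair (m j) d) ` Q j)"
  have "countable B" unfolding B_def using countable_finite[OF J] Q by (intro countable_UN countable_image) auto
  then have "uncountable (ball 0 r - B)" using uncountable_minus_countable[OF uncountable_ball[OF r(1), of "0::complex"]] by blast
  then obtain t where t: "t \<in> ball 0 r" "t \<notin> B" by (metis Diff_iff countable_empty equals0I)
  have "pair (m j) (z0 + t *s d) \<notin> Q j" if "j \<in> J" for j
  proof
    assume a: "pair (m j) (z0 + t *s d) \<in> Q j"
    have "t = (pair (m j) (z0 + t *s d) - pair (m j) z0) / pair (m j) d"
      using d[OF that] by (simp add: pair_add pair_scale)
    then have "t \<in> B" unfolding B_def using a that by blast
    then show False using t by blast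
  qed
  then show ?thesis using r t by (intro bexI[of _ "z0 + t *s d"]) auto
qed

section \<open>Removable singularities along finitely many families of parallel hyperplanes\<close>

lemma not_islimpt_ball:
  assumes "\<not> x islimpt (S::'a::metric_space set)"
  obtains d where "d > 0" "\<And>y. y \<in> S \<Longrightarrow> dist y x < d \<Longrightarrow> y = x"
  using assms unfolding islimpt_approachable by blast

text \<open>\<open>residue_free\<close> is required only at points where all singular forms are
  proportional to one of them, that is, away from intersections of transverse hyperplanes. It speaks
  of limits along single complex lines, so it can be computed summand by summand.\<close>

locale removable_along_hyperplanes =
  fixes I :: "'i set" and l :: "'i \<Rightarrow> complex^'n" and P :: "'i \<Rightarrow> complex set"
    and N :: "(complex^'n) set" and R :: "complex^'n \<Rightarrow> complex"
  assumes finI: "finite I" and lnz: "\<And>i. i \<in> I \<Longrightarrow> l i \<noteq> 0"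
    and ctb: "\<And>i. i \<in> I \<Longrightarrow> countable (P i)"
    and nolim: "\<And>i x. i \<in> I \<Longrightarrow> \<not> x islimpt P i"
    and N_def: "N = {z. \<exists>i\<in>I. pair (l i) z \<in> P i}"
    and cont: "\<And>z. z \<notin> N \<Longrightarrow> isCont R z"
    and hol: "\<And>z e. z \<notin> N \<Longrightarrow> (\<lambda>t. R (z + t *s e)) field_differentiable at 0"
    and residue_free: "\<And>z e i. i \<in> I \<Longrightarrow> pair (l i) z \<in> P i \<Longrightarrow>
       (\<And>k. k \<in> I \<Longrightarrow> pair (l k) z \<in> P k \<Longrightarrow> \<exists>c. l k = c *s l i) \<Longrightarrow> pair (l i) e \<noteq> 0 \<Longrightarrow>
       ((\<lambda>t. t * R (z + t *s e)) \<longlongrightarrow> 0) (at 0)"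
begin

text \<open>Families whose form kills \<open>e\<close> are avoided through
  \<open>z \<notin> N\<close>, since that form is constant on the line. Hence every singular
  parameter of a generic line is one to which \<open>residue_free\<close> applies.\<close>

definition generic :: "complex^'n \<Rightarrow> complex^'n \<Rightarrow> bool" where
  "generic e z \<longleftrightarrow> z \<notin> N \<and> (\<forall>i\<in>I. \<forall>k\<in>I. pair (l i) e \<noteq> 0 \<longrightarrow> pair (l k) e \<noteq> 0 \<longrightarrow>
     (\<nexists>c. l k = c *s l i) \<longrightarrow> (\<forall>t. \<not> (pair (l i) (z + t *s e) \<in> P i \<and> pair (l k) (z + t *s e) \<in> P k)))"

lemma closed_P: "i \<in> I \<Longrightarrow> closed (P i)"
  using nolim by (simp add: closed_limpt)

lemma closed_N: "closed N"
proof -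
  have "N = (\<Union>i\<in>I. pair (l i) -` P i)" by (auto simp: N_def)
  also have "closed \<dots>"
    using finI closed_P
    by (intro closed_UN ballI continuous_closed_vimage isCont_pair) auto
  finally show ?thesis .
qed

text \<open>Eliminating \<open>t\<close> from two simultaneous membership conditions leaves one
  linear condition on \<open>z\<close> with countably many excluded values.\<close>

lemma generic_dense:
  assumes X: "open X" "z0 \<in> X"
  shows "\<exists>z\<in>X. generic e z"
proof -
  define J where "J = {(i,k). i \<in> I \<and> k \<in> I \<and> (i = k \<or> (pair (l i) e \<noteq> 0 \<and> pair (l k) e \<noteq> 0 \<and> (\<nexists>c. l k = c *s l i)))}"
  \<comment> \<open>On the diagonal the form encodes \<open>z \<notin> N\<close>; off the diagonal
    it is the combination of the two forms that vanishes on \<open>e\<close>, hence does not see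
    \<open>t\<close>.\<close>
  define m where "m = (\<lambda>(i,k). if i = k then l i else pair (l k) e *s l i - pair (l i) e *s l k)"
  define Q where "Q = (\<lambda>(i,k). if i = k then P i else (\<lambda>(p,q). pair (l k) e * p - pair (l i) e * q) ` (P i \<times> P k))"
  have pm: "pair (a *s x - b *s y) z = a * pair x z - b * pair y z" for a b x y z
    by (simp add: pair_def sum_distrib_left sum_subtractf[symmetric] algebra_simps)
  have "\<exists>z\<in>X. \<forall>j\<in>J. pair (m j) z \<notin> Q j"
  proof (rule dense_off_countable_hyperplanes[OF _ _ _ X])
    show "finite J" by (rule finite_subset[of _ "I \<times> I"]) (auto simp: J_def finI)
    fix j assume j: "j \<in> J"
    obtain i k where jk: "j = (i,k)" by (cases j)
    show "m j \<noteq> 0"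
    proof (cases "i = k")
      case True then show ?thesis using j lnz by (simp add: jk m_def J_def)
    next
      case False
      have p: "pair (l i) e \<noteq> 0" "\<nexists>c. l k = c *s l i" using j False by (auto simp: jk J_def)
      show ?thesis
      proof
        assume "m j = 0"
        then have "pair (l k) e *s l i = pair (l i) e *s l k" using False by (simp add: jk m_def)
        then have "(1 / pair (l i) e) *s (pair (l k) e *s l i) = (1 / pair (l i) e) *s (pair (l i) e *s l k)" by simp
        then have "l k = (pair (l k) e / pair (l i) e) *s l i" using p(1) by (simp add: vector_smult_assoc)
        then show False using p(2) by blast
      qed
    qed
    show "countable (Q j)" using j ctb by (auto simp: jk Q_def J_def)
  qed
  then obtain z where z: "z \<in> X" "\<And>j. j \<in> J \<Longrightarrow> pair (m j) z \<notin> Q j" by blast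
  have "generic e z"
    unfolding generic_def
  proof (intro conjI ballI impI allI notI)
    assume "z \<in> N"
    then obtain i where "i \<in> I" "pair (l i) z \<in> P i" by (auto simp: N_def)
    then show False using z(2)[of "(i,i)"] by (simp add: J_def m_def Q_def)
  next
    fix i k t assume a: "i \<in> I" "k \<in> I" "pair (l i) e \<noteq> 0" "pair (l k) e \<noteq> 0" "\<nexists>c. l k = c *s l i"
      "pair (l i) (z + t *s e) \<in> P i \<and> pair (l k) (z + t *s e) \<in> P k"
    have ik: "i \<noteq> k" using a(5) vector_smult_lid by metis
    have "pair (m (i,k)) z = pair (l k) e * pair (l i) (z + t *s e) - pair (l i) e * pair (l k) (z + t *s e)"
      using ik by (simp add: m_def pm pair_add pair_scale algebra_simps)
    moreover have "\<dots> \<in> Q (i,k)" using a(6) ik unfolding Q_def by (auto intro!: image_eqI)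
    ultimately show False using z(2)[of "(i,k)"] a by (simp add: J_def)
  qed
  then show ?thesis using z(1) by blast
qed

lemma bound_from_generic:
  assumes X: "open X" and b: "\<And>y. y \<in> X \<Longrightarrow> generic e y \<Longrightarrow> norm (R y) \<le> M" and z: "z \<in> X" "z \<notin> N"
  shows "norm (R z) \<le> M"
proof (rule ccontr)
  assume "\<not> norm (R z) \<le> M"
  moreover have "isCont (\<lambda>z. norm (R z)) z" using cont[OF z(2)] by (intro continuous_intros)
  ultimately have "\<forall>\<^sub>F y in nhds z. M < norm (R y)"
    by (intro order_tendstoD(1)[of _ "norm (R z)"]) (auto simp: isCont_def tendsto_at_iff_tendsto_nhds[of "\<lambda>z. norm (R z)" z, symmetric])
  then obtain Y where Y: "open Y" "z \<in> Y" "\<And>y. y \<in> Y \<Longrightarrow> M < norm (R y)"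
    by (auto simp: eventually_nhds)
  obtain y where "y \<in> X \<inter> Y" "generic e y" using generic_dense[of "X \<inter> Y" z] X Y z by auto
  then show False using b[of y] Y(3)[of y] by auto
qed

text \<open>Singular parameters are isolated, and at each of them the vanishing limit of
  \<open>(s - t) * f s\<close> makes the singularity removable. The bound is part of the statement
  because Liouville's theorem needs it at the filled-in parameters too.\<close>

lemma entire_along_generic_line:
  assumes g: "generic e z"
  shows "\<exists>g. g holomorphic_on UNIV \<and> (\<forall>t. z + t *s e \<notin> N \<longrightarrow> g t = R (z + t *s e)) \<and>
     (\<forall>M. (\<forall>t. z + t *s e \<notin> N \<longrightarrow> norm (R (z + t *s e)) \<le> M) \<longrightarrow> (\<forall>t. norm (g t) \<le> M))"
proof -
  define f where "f = (\<lambda>t. R (z + t *s e))"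
  define T where "T = {t. z + t *s e \<in> N}"
  have zN: "z \<notin> N" using g by (simp add: generic_def)
  have act: "pair (l i) e \<noteq> 0" if "i \<in> I" "pair (l i) (z + t *s e) \<in> P i" for i t
  proof
    assume "pair (l i) e = 0"
    then have "pair (l i) z \<in> P i" using that by (simp add: pair_add pair_scale)
    then show False using zN that by (auto simp: N_def)
  qed
  have Tlim: "\<not> x islimpt T" for x
  proof
    assume "x islimpt T"
    moreover have "T = (\<Union>i\<in>I. {t. pair (l i) (z + t *s e) \<in> P i})" by (auto simp: T_def N_def)
    ultimately obtain i where i: "i \<in> I" "x islimpt {t. pair (l i) (z + t *s e) \<in> P i}"
      using finI by (auto simp: islimpt_finite_union_iff)
    then have "{t. pair (l i) (z + t *s e) \<in> P i} \<noteq> {}" using islimpt_EMPTY by metis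
    then have nz: "pair (l i) e \<noteq> 0" using act[OF i(1)] by auto
    obtain d where d: "d > 0" "\<And>y. y \<in> P i \<Longrightarrow> dist y (pair (l i) (z + x *s e)) < d \<Longrightarrow> y = pair (l i) (z + x *s e)"
      using nolim[OF i(1)] not_islimpt_ball by blast
    obtain t where t: "pair (l i) (z + t *s e) \<in> P i" "t \<noteq> x" "dist t x < d / norm (pair (l i) e)"
      using i(2) d(1) nz unfolding islimpt_approachable by (metis (no_types, lifting) divide_pos_pos mem_Collect_eq zero_less_norm_iff)
    have "dist (pair (l i) (z + t *s e)) (pair (l i) (z + x *s e)) = norm ((t - x) * pair (l i) e)"
      by (simp add: dist_norm pair_add pair_scale algebra_simps)
    also have "\<dots> < d" using t(3) nz unfolding norm_mult dist_norm by (simp add: pos_less_divide_eq)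
    finally have "pair (l i) (z + t *s e) = pair (l i) (z + x *s e)" using d t by blast
    then show False using nz t(2) by (simp add: pair_add pair_scale)
  qed
  have fd: "f field_differentiable at t" if "t \<notin> T" for t
  proof -
    have "(\<lambda>s. R (z + t *s e + s *s e)) field_differentiable at 0"
      using that by (intro hol) (auto simp: T_def)
    then obtain c where "((\<lambda>s. R (z + t *s e + s *s e)) has_field_derivative c) (at 0)"
      by (auto simp: field_differentiable_def)
    moreover have "(\<lambda>s. R (z + t *s e + s *s e)) = (\<lambda>s. f (s + t))"
      unfolding f_def by (simp add: vector_sadd_rdistrib add_ac)
    ultimately have "(f has_field_derivative c) (at t)" using DERIV_shift[of f c 0 t] by simp
    then show ?thesis by (auto simp: field_differentiable_def)
  qed
  have lim0: "((\<lambda>s. (s - t) * f s) \<longlongrightarrow> 0) (at t)" if t: "t \<in> T" for t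
  proof -
    obtain i where i: "i \<in> I" "pair (l i) (z + t *s e) \<in> P i" using t by (auto simp: T_def N_def)
    have "((\<lambda>s. s * R ((z + t *s e) + s *s e)) \<longlongrightarrow> 0) (at 0)"
    proof (rule residue_free[OF i])
      fix k assume k: "k \<in> I" "pair (l k) (z + t *s e) \<in> P k"
      show "\<exists>c. l k = c *s l i"
        using g act[OF i] act[OF k] i k unfolding generic_def by blast
    qed (rule act[OF i])
    moreover have "(\<lambda>s. s * R ((z + t *s e) + s *s e)) = (\<lambda>s. ((t + s) - t) * f (t + s))"
      unfolding f_def by (auto simp: fun_eq_iff vector_sadd_rdistrib add.assoc)
    ultimately show ?thesis by (simp add: LIM_offset_zero_iff[of t])
  qed
  have ext: "\<exists>r>0. \<exists>h. h holomorphic_on ball t r \<and> (\<forall>s\<in>ball t r - {t}. s \<notin> T \<and> h s = f s) \<and> (t \<notin> T \<longrightarrow> h t = f t)" for t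
  proof -
    obtain r where r: "r > 0" "\<And>s. s \<in> T \<Longrightarrow> dist s t < r \<Longrightarrow> s = t" using Tlim[of t] not_islimpt_ball by blast
    have offT: "s \<notin> T" if "s \<in> ball t r - {t}" for s
    proof
      assume "s \<in> T"
      then have "s = t" by (rule r(2)) (use that in \<open>simp add: dist_commute\<close>)
      then show False using that by simp
    qed
    show ?thesis
    proof (cases "t \<in> T")
      case True
      have "f holomorphic_on ball t r - {t}"
        unfolding holomorphic_on_def using offT fd field_differentiable_at_within by blast
      moreover have "t \<in> interior (ball t r)" using r by simp
      ultimately obtain h where "h holomorphic_on ball t r" "\<And>s. s \<in> ball t r - {t} \<Longrightarrow> h s = f s"
        using holomorphic_on_extend_lim[of f "ball t r" t] lim0[OF True] by blast
      then show ?thesis using r(1) True offT by (intro exI[of _ r] conjI exI[of _ h]) simp_all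
    next
      case False
      then have "f holomorphic_on ball t r"
        unfolding holomorphic_on_def using offT fd field_differentiable_at_within by blast
      then show ?thesis using r(1) offT by (intro exI[of _ r] conjI exI[of _ f]) simp_all
    qed
  qed
  \<comment> \<open>Taking the limit defines one global function; \<open>loc\<close> then shows that
    every local extension agrees with it.\<close>
  define g where "g = (\<lambda>t. if t \<in> T then Lim (at t) f else f t)"
  have loc: "g s = h s" if h: "h holomorphic_on ball t r" "r > 0" "\<forall>s\<in>ball t r - {t}. s \<notin> T \<and> h s = f s" "t \<notin> T \<longrightarrow> h t = f t" "s \<in> ball t r" for h t r s
  proof (cases "s = t \<and> t \<in> T")
    case True
    have "isCont h t" using h(1,2) holomorphic_on_imp_continuous_on continuous_on_eq_continuous_at[of "ball t r" h] by auto
    then have "(h \<longlongrightarrow> h t) (at t)" by (simp add: isCont_def)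
    moreover have "\<forall>\<^sub>F x in at t. h x = f x" unfolding eventually_at using h by (intro exI[of _ r]) (auto simp: dist_commute)
    ultimately have "(f \<longlongrightarrow> h t) (at t)" by (simp add: tendsto_cong)
    then have "Lim (at t) f = h t" by (intro tendsto_Lim) auto
    then show ?thesis using True by (simp add: g_def)
  next
    case False
    then have "s \<notin> T \<and> h s = f s" using h(3-5) by (cases "s = t") blast+
    then show ?thesis by (simp add: g_def)
  qed
  have "g holomorphic_on UNIV"
    unfolding holomorphic_on_def
  proof
    fix t :: complex
    obtain r h where r: "r > 0" and h: "h holomorphic_on ball t r" "\<forall>s\<in>ball t r - {t}. s \<notin> T \<and> h s = f s" "t \<notin> T \<longrightarrow> h t = f t"
      using ext[of t] by auto
    have "g holomorphic_on ball t r"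
      using h(1) by (rule holomorphic_transform) (use loc[OF h(1) r h(2,3)] in auto)
    then show "g field_differentiable at t within UNIV" using r by (intro holomorphic_on_imp_differentiable_at[of _ "ball t r"]) auto
  qed
  moreover have "norm (g t) \<le> M" if M: "\<forall>t. z + t *s e \<notin> N \<longrightarrow> norm (R (z + t *s e)) \<le> M" for t M
  proof (cases "t \<in> T")
    case False then show ?thesis using M by (auto simp: g_def T_def f_def)
  next
    case True
    obtain r h where r: "r > 0" and h: "h holomorphic_on ball t r" "\<forall>s\<in>ball t r - {t}. s \<notin> T \<and> h s = f s" "t \<notin> T \<longrightarrow> h t = f t"
      using ext[of t] by auto
    have "isCont h t" using h(1) r holomorphic_on_imp_continuous_on continuous_on_eq_continuous_at[of "ball t r" h] by auto
    then have "((\<lambda>x. norm (h x)) \<longlongrightarrow> norm (h t)) (at t)" by (intro tendsto_norm) (simp add: isCont_def)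
    moreover have "\<forall>\<^sub>F x in at t. norm (h x) \<le> M" unfolding eventually_at using h r M
      by (intro exI[of _ r]) (auto simp: dist_commute T_def f_def)
    ultimately have "norm (h t) \<le> M" by (intro tendsto_upperbound[of _ _ "at t"]) auto
    then show ?thesis using loc[OF h(1) r h(2,3), of t] r by simp
  qed
  ultimately show ?thesis
    by (intro exI[of _ g]) (auto simp: g_def T_def f_def)
qed

text \<open>Near an arbitrary point, even one where several hyperplanes meet, small circles in a direction
  transverse to all hyperplanes avoid the singular set, so the maximum principle on generic parallel
  discs bounds the function.\<close>
lemma locally_bounded:
  "\<exists>\<epsilon>>0. \<exists>M. \<forall>z\<in>ball z0 \<epsilon> - N. norm (R z) \<le> M"
proof -
  have "finite (l ` I)" "0 \<notin> l ` I" using finI lnz by force+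
  from vector_off_kernels[OF this] obtain e where e: "\<And>i. i \<in> I \<Longrightarrow> pair (l i) e \<noteq> 0" by auto
  have "\<exists>d. d > 0 \<and> (\<forall>t. t \<noteq> 0 \<longrightarrow> norm t < d \<longrightarrow> pair (l i) (z0 + t *s e) \<notin> P i)" if i: "i \<in> I" for i
  proof -
    obtain d where d: "d > 0" "\<And>y. y \<in> P i \<Longrightarrow> dist y (pair (l i) z0) < d \<Longrightarrow> y = pair (l i) z0"
      using nolim[OF i] not_islimpt_ball by blast
    have "pair (l i) (z0 + t *s e) \<notin> P i" if "t \<noteq> 0" "norm t < d / norm (pair (l i) e)" for t
    proof
      assume "pair (l i) (z0 + t *s e) \<in> P i"
      moreover have "dist (pair (l i) (z0 + t *s e)) (pair (l i) z0) < d"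
        using that e[OF i] by (simp add: dist_norm pair_add pair_scale norm_mult field_simps)
      ultimately show False using d(2) e[OF i] that(1) by (fastforce simp: pair_add pair_scale)
    qed
    then show ?thesis using d(1) e[OF i] by (intro exI[of _ "d / norm (pair (l i) e)"]) auto
  qed
  then obtain dl where dl: "\<And>i. i \<in> I \<Longrightarrow> dl i > 0" "\<And>i t. i \<in> I \<Longrightarrow> t \<noteq> 0 \<Longrightarrow> norm t < dl i \<Longrightarrow> pair (l i) (z0 + t *s e) \<notin> P i"
    by metis
  \<comment> \<open>Half of the minimum keeps the circle strictly inside every punctured disc in
    which the family \<open>i\<close> is avoided; the inserted 1 covers an empty
    \<open>I\<close>.\<close>
  define \<rho> where "\<rho> = Min (insert 1 (dl ` I)) / 2"
  have \<rho>: "\<rho> > 0" "\<And>i. i \<in> I \<Longrightarrow> \<rho> < dl i"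
  proof -
    have "Min (insert 1 (dl ` I)) > 0" using finI dl by (subst Min_gr_iff) auto
    then show "\<rho> > 0" by (simp add: \<rho>_def)
    show "\<rho> < dl i" if "i \<in> I" for i
    proof -
      have "Min (insert 1 (dl ` I)) \<le> dl i" using finI that by (intro Min_le) auto
      then show ?thesis using dl(1)[OF that] unfolding \<rho>_def by linarith
    qed
  qed
  define C where "C = (\<lambda>t::complex. z0 + t *s e) ` sphere 0 \<rho>"
  have "compact C" unfolding C_def by (intro compact_continuous_image continuous_on_line) auto
  moreover have "open (- N)" using closed_N by auto
  moreover have "C \<subseteq> - N" using \<rho> dl(2) by (fastforce simp: C_def N_def)
  \<comment> \<open>A whole neighbourhood of the circle stays off \<open>N\<close>. Circles on
    parallel lines through points of \<open>ball z0 \<epsilon>\<close> lie in this compact set, so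
    one constant bounds \<open>R\<close> on all of them.\<close>
  ultimately obtain \<epsilon> where \<epsilon>: "\<epsilon> > 0" "(\<Union>x\<in>C. cball x \<epsilon>) \<subseteq> - N"
    by (rule compact_subset_open_imp_cball_epsilon_subset)
  have "compact (R ` (\<Union>x\<in>C. cball x \<epsilon>))"
    using \<epsilon>(2) cont \<open>compact C\<close> by (intro compact_continuous_image compact_minkowski_sum_cball continuous_at_imp_continuous_on) auto
  then obtain M where M: "\<And>x. x \<in> (\<Union>x\<in>C. cball x \<epsilon>) \<Longrightarrow> norm (R x) \<le> M"
    using compact_imp_bounded bounded_iff by (metis image_eqI)
  have "norm (R z) \<le> M" if zb: "z \<in> ball z0 \<epsilon>" and gz: "generic e z" for z
  proof -
    obtain g where g: "g holomorphic_on UNIV" "\<And>t. z + t *s e \<notin> N \<Longrightarrow> g t = R (z + t *s e)"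
      using entire_along_generic_line[OF gz] by blast
    have "norm (g t) \<le> M" if "t \<in> sphere 0 \<rho>" for t
    proof -
      have "z + t *s e \<in> cball (z0 + t *s e) \<epsilon>" using zb by (simp add: dist_norm)
      then have "z + t *s e \<in> (\<Union>x\<in>C. cball x \<epsilon>)" using that unfolding C_def by blast
      then have "norm (R (z + t *s e)) \<le> M" "z + t *s e \<notin> N" using M \<epsilon>(2) by blast+
      then show ?thesis using g(2) by simp
    qed
    then have fr: "norm (g t) \<le> M" if "t \<in> frontier (cball 0 \<rho>)" for t using \<rho>(1) that by simp
    have "norm (g 0) \<le> M"
    proof (rule maximum_modulus_frontier[OF _ _ _ fr])
      show "g holomorphic_on interior (cball 0 \<rho>)" using g(1) by (rule holomorphic_on_subset) simp
      show "continuous_on (closure (cball 0 \<rho>)) g"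
        using holomorphic_on_imp_continuous_on[OF g(1)] by (rule continuous_on_subset) simp
    qed (use \<rho>(1) in auto)
    then show ?thesis using g(2)[of 0] gz by (simp add: generic_def)
  qed
  then have "norm (R z) \<le> M" if "z \<in> ball z0 \<epsilon>" "z \<notin> N" for z
    using bound_from_generic[of "ball z0 \<epsilon>" e M z] that by simp
  then show ?thesis using \<epsilon>(1) by blast
qed

text \<open>Local bounds, a compact set of representatives and the periodic modulus give a global
  bound. Liouville's theorem is applied on generic lines in the direction \<open>\<gamma>0\<close>
  itself: the values at the parameters 0 and 1 coincide and also differ by the factor
  \<open>q\<close>.\<close>

theorem vanishes:
  assumes K: "compact K" "\<And>z. \<exists>\<gamma>\<in>G. z + \<gamma> \<in> K"
    and per: "\<And>z \<gamma>. \<gamma> \<in> G \<Longrightarrow> norm (R (z + \<gamma>)) = norm (R z)"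
    and NG: "\<And>z \<gamma>. \<gamma> \<in> G \<Longrightarrow> z \<notin> N \<Longrightarrow> z + \<gamma> \<notin> N"
    and nt: "\<gamma>0 \<in> G" "\<And>z. R (z + \<gamma>0) = q * R z" "q \<noteq> 1"
    and z: "z \<notin> N"
  shows "R z = 0"
proof -
  obtain \<epsilon> M where eM: "\<And>z0. \<epsilon> z0 > 0" "\<And>z0 z. z \<in> ball z0 (\<epsilon> z0) - N \<Longrightarrow> norm (R z) \<le> M z0"
    using locally_bounded by metis
  have "K \<subseteq> (\<Union>z\<in>K. ball z (\<epsilon> z))" using eM(1) by force
  then obtain F where F: "F \<subseteq> K" "finite F" "K \<subseteq> (\<Union>z\<in>F. ball z (\<epsilon> z))"
    using compactE_image[OF K(1), of K "\<lambda>z. ball z (\<epsilon> z)"] by auto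
  define B where "B = Max (insert 0 (M ` F))"
  have B: "norm (R y) \<le> B" if "y \<notin> N" for y
  proof -
    obtain \<gamma> where \<gamma>: "\<gamma> \<in> G" "y + \<gamma> \<in> K" using K(2) by blast
    then obtain f where f: "f \<in> F" "y + \<gamma> \<in> ball f (\<epsilon> f)" using F by blast
    have "norm (R y) = norm (R (y + \<gamma>))" using per \<gamma> by simp
    also have "\<dots> \<le> M f" using eM(2) f NG[OF \<gamma>(1) that] by blast
    also have "\<dots> \<le> B" unfolding B_def using F f by (intro Max_ge) auto
    finally show ?thesis .
  qed
  have "norm (R y) \<le> 0" if y: "generic \<gamma>0 y" for y
  proof -
    obtain g where g: "g holomorphic_on UNIV" "\<And>t. y + t *s \<gamma>0 \<notin> N \<Longrightarrow> g t = R (y + t *s \<gamma>0)" "\<And>t. norm (g t) \<le> B"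
      using entire_along_generic_line[OF y] B by blast
    have yN: "y \<notin> N" using y by (simp add: generic_def)
    have "bounded (range g)" using g(3) by (auto simp: bounded_iff)
    then obtain c where "\<And>t. g t = c" using Liouville_theorem[OF g(1)] by (auto simp: constant_on_def)
    then have "g 0 = g 1" by simp
    moreover have "g 0 = R y" "g 1 = R (y + \<gamma>0)" using g(2)[of 0] g(2)[of 1] yN NG[OF nt(1) yN] by simp_all
    ultimately have "(q - 1) * R y = 0" using nt(2)[of y] by (simp only: left_diff_distrib) simp
    then show ?thesis using nt(3) by simp
  qed
  then have "norm (R z) \<le> 0" using bound_from_generic[of UNIV \<gamma>0 0 z] z by simp
  then show ?thesis by simp
qed

end

section \<open>Lattices and rank-one perturbations of the identity\<close>

text \<open>There are as many real-independent vectors as the real dimension of the space, so they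
  form a basis and the coordinates are bounded functionals.\<close>

lemma full_lattice_coordinates:
  fixes \<Gamma> :: "(complex^'n) set"
  assumes "full_lattice \<Gamma>"
  obtains b c where "\<And>i. i < 2 * CARD('n) \<Longrightarrow> bounded_linear (c i :: complex^'n \<Rightarrow> real)"
    "\<And>z. z = (\<Sum>i<2*CARD('n). c i z *\<^sub>R b i)"
    "\<And>k::nat \<Rightarrow> int. \<And>i. i < 2 * CARD('n) \<Longrightarrow> c i (\<Sum>i<2*CARD('n). of_int (k i) *\<^sub>R b i) = of_int (k i)"
    "\<Gamma> = {(\<Sum>i<2*CARD('n). of_int (k i) *\<^sub>R b i) | k::nat \<Rightarrow> int. True}"
proof -
  define m where "m = 2 * CARD('n)"
  obtain b :: "nat \<Rightarrow> complex^'n" where b: "\<And>c::nat \<Rightarrow> real. (\<Sum>i<m. c i *\<^sub>R b i) = 0 \<Longrightarrow> \<forall>i<m. c i = 0"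
    and G: "\<Gamma> = {(\<Sum>i<m. of_int (k i) *\<^sub>R b i) | k::nat \<Rightarrow> int. True}"
    using assms unfolding full_lattice_def m_def by blast
  have inj: "inj_on b {..<m}"
  proof (rule inj_onI, rule ccontr)
    fix i j assume ij: "i \<in> {..<m}" "j \<in> {..<m}" "b i = b j" "i \<noteq> j"
    \<comment> \<open>Equal vectors with different indices would give a relation with coefficients 1
      and -1.\<close>
    have "(\<Sum>k<m. ((if k = i then 1 else 0) - (if k = j then 1 else 0)) *\<^sub>R b k) = b i - b j"
      using ij by (simp add: scaleR_diff_left sum_subtractf if_distrib[of "\<lambda>x. x *\<^sub>R _"] cong: if_cong)
    then have "\<forall>k<m. (if k = i then 1 else 0) - (if k = j then 1 else 0) = (0::real)" using ij(3) by (intro b) simp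
    then show False using ij by (auto split: if_splits)
  qed
  define B where "B = b ` {..<m}"
  have ind: "independent B"
  proof (rule real_vector.independent_if_scalars_zero)
    fix f x assume s: "(\<Sum>x\<in>B. f x *\<^sub>R x) = 0" and x: "x \<in> B"
    have "(\<Sum>i<m. f (b i) *\<^sub>R b i) = 0" using s unfolding B_def by (subst (asm) sum.reindex[OF inj]) (simp add: o_def)
    from b[OF this] show "f x = 0" using x unfolding B_def by auto
  qed (simp add: B_def)
  have "card B = m" unfolding B_def using card_image[OF inj] by simp
  then have "dim (UNIV :: (complex^'n) set) \<le> card B" by (simp add: m_def)
  then have sp: "v \<in> span B" for v using card_ge_dim_independent[OF _ ind] by blast
  define c where "c = (\<lambda>i z. representation B z (b i))"
  have lin: "linear (c i)" for i
    by (rule linearI) (simp_all add: c_def real_vector.representation_add[OF ind sp sp] real_vector.representation_scale[OF ind sp])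
  have "bounded_linear (c i)" for i using lin by (simp add: linear_conv_bounded_linear)
  moreover have "z = (\<Sum>i<m. c i z *\<^sub>R b i)" for z
  proof -
    have "(\<Sum>x\<in>B. representation B z x *\<^sub>R x) = z"
      by (rule real_vector.sum_representation_eq[OF ind sp]) (auto simp: B_def)
    then show ?thesis unfolding B_def c_def by (subst (asm) sum.reindex[OF inj]) (simp add: o_def B_def)
  qed
  moreover have "c i (\<Sum>j<m. of_int (k j) *\<^sub>R b j) = of_int (k i)" if i: "i < m" for k :: "nat \<Rightarrow> int" and i
  proof -
    have cb: "c i (b j) = (if j = i then 1 else 0)" if "j < m" for j
      using real_vector.representation_basis[OF ind, of "b j"] inj i that
      by (auto simp: c_def B_def dest: inj_onD)
    have "c i (\<Sum>j<m. of_int (k j) *\<^sub>R b j) = (\<Sum>j<m. of_int (k j) * c i (b j))"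
      using lin[of i] by (simp add: linear_sum linear_scale)
    also have "\<dots> = (\<Sum>j<m. if j = i then of_int (k j) else 0)" by (intro sum.cong) (auto simp: cb)
    also have "\<dots> = of_int (k i)" using i by simp
    finally show ?thesis .
  qed
  ultimately show ?thesis using that[of c b] G unfolding m_def by blast
qed

lemma full_lattice_0: "full_lattice \<Gamma> \<Longrightarrow> 0 \<in> \<Gamma>"
  by (erule full_lattice_coordinates) (auto intro!: exI[of _ "\<lambda>_. 0"])

lemma full_lattice_diff:
  assumes "full_lattice \<Gamma>" "x \<in> \<Gamma>" "y \<in> \<Gamma>"
  shows "x - y \<in> \<Gamma>"
proof -
  obtain b c where bl: "\<And>i. i < 2 * CARD('a) \<Longrightarrow> bounded_linear (c i :: complex^'a \<Rightarrow> real)"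
    and z: "\<And>z. z = (\<Sum>i<2*CARD('a). c i z *\<^sub>R b i)"
    and ci: "\<And>k::nat \<Rightarrow> int. \<And>i. i < 2 * CARD('a) \<Longrightarrow> c i (\<Sum>i<2*CARD('a). of_int (k i) *\<^sub>R b i) = of_int (k i)"
    and G: "\<Gamma> = {(\<Sum>i<2*CARD('a). of_int (k i) *\<^sub>R b i) | k::nat \<Rightarrow> int. True}"
    by (rule full_lattice_coordinates[OF assms(1)]) (assumption | blast)+
  obtain k1 k2 where "x = (\<Sum>i<2*CARD('a). of_int (k1 i) *\<^sub>R b i)" "y = (\<Sum>i<2*CARD('a). of_int (k2 i) *\<^sub>R b i)"
    using assms(2,3) unfolding G by auto
  then have "x - y = (\<Sum>i<2*CARD('a). of_int (k1 i - k2 i) *\<^sub>R b i)"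
    by (simp add: sum_subtractf scaleR_diff_left)
  then show ?thesis unfolding G by (auto intro!: exI[of _ "\<lambda>i. k1 i - k2 i"])
qed

lemma full_lattice_minus: "full_lattice \<Gamma> \<Longrightarrow> x \<in> \<Gamma> \<Longrightarrow> - x \<in> \<Gamma>"
  using full_lattice_diff[of \<Gamma> 0 x] full_lattice_0[of \<Gamma>] by simp

lemma full_lattice_add: "full_lattice \<Gamma> \<Longrightarrow> x \<in> \<Gamma> \<Longrightarrow> y \<in> \<Gamma> \<Longrightarrow> x + y \<in> \<Gamma>"
  using full_lattice_diff[of \<Gamma> x "- y"] full_lattice_minus[of \<Gamma> y] by simp

text \<open>A nonzero lattice vector has an integer coordinate of modulus at least 1, while every
  coordinate is at most \<open>S\<close> times the norm.\<close>

lemma full_lattice_discrete: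
  fixes \<Gamma> :: "(complex^'n) set"
  assumes L: "full_lattice \<Gamma>"
  obtains d where "d > 0" "\<And>x. x \<in> \<Gamma> \<Longrightarrow> x \<noteq> 0 \<Longrightarrow> norm x \<ge> d"
proof -
  let ?m = "2 * CARD('n)"
  obtain b c where bl: "\<And>i. i < 2 * CARD('n) \<Longrightarrow> bounded_linear (c i :: complex^'n \<Rightarrow> real)"
    and z: "\<And>z. z = (\<Sum>i<2*CARD('n). c i z *\<^sub>R b i)"
    and ci: "\<And>k::nat \<Rightarrow> int. \<And>i. i < 2 * CARD('n) \<Longrightarrow> c i (\<Sum>i<2*CARD('n). of_int (k i) *\<^sub>R b i) = of_int (k i)"
    and G: "\<Gamma> = {(\<Sum>i<2*CARD('n). of_int (k i) *\<^sub>R b i) | k::nat \<Rightarrow> int. True}"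
    by (rule full_lattice_coordinates[OF L]) (assumption | blast)+
  have "\<forall>i. \<exists>K. K > 0 \<and> (i < ?m \<longrightarrow> (\<forall>x. norm (c i x) \<le> norm x * K))"
    using bounded_linear.pos_bounded[OF bl] by (metis zero_less_one)
  then obtain K where K: "\<And>i. K i > 0" "\<And>i x. i < ?m \<Longrightarrow> norm (c i x) \<le> norm x * K i" by metis
  define S where "S = (\<Sum>i<?m. K i)"
  have KS: "K i \<le> S" if "i < ?m" for i
    unfolding S_def using that K(1) by (intro member_le_sum) (auto simp: less_imp_le)
  have S: "S > 0" using KS[of 0] K(1)[of 0] by (simp add: order.strict_trans2)
  have "norm x \<ge> 1 / S" if x: "x \<in> \<Gamma>" "x \<noteq> 0" for x
  proof -
    obtain k :: "nat \<Rightarrow> int" where k: "x = (\<Sum>i<?m. of_int (k i) *\<^sub>R b i)" using x(1) unfolding G by auto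
    have "\<exists>i<?m. k i \<noteq> 0"
    proof (rule ccontr)
      assume "\<not> ?thesis"
      then have "x = 0" unfolding k by (intro sum.neutral) auto
      then show False using x(2) by simp
    qed
    then obtain i where i: "i < ?m" "k i \<noteq> 0" by blast
    have "1 \<le> \<bar>real_of_int (k i)\<bar>" using i(2) by linarith
    also have "\<dots> = norm (c i x)" unfolding k ci[OF i(1)] by simp
    also have "\<dots> \<le> norm x * K i" by (rule K(2)[OF i(1)])
    also have "\<dots> \<le> norm x * S" using KS[OF i(1)] by (intro mult_left_mono) auto
    finally show ?thesis using S by (simp add: field_simps)
  qed
  then show ?thesis using that[of "1 / S"] S by simp
qed

text \<open>Subtracting the integer parts of the coordinates leaves fractional parts, so a ball
  whose radius is the sum of the norms of the basis vectors suffices.\<close>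

lemma full_lattice_cocompact:
  fixes \<Gamma> :: "(complex^'n) set"
  assumes L: "full_lattice \<Gamma>"
  obtains K where "compact K" "\<And>z. \<exists>\<gamma>\<in>\<Gamma>. z + \<gamma> \<in> K"
proof -
  let ?m = "2 * CARD('n)"
  obtain b c where bl: "\<And>i. i < 2 * CARD('n) \<Longrightarrow> bounded_linear (c i :: complex^'n \<Rightarrow> real)"
    and z: "\<And>z. z = (\<Sum>i<2*CARD('n). c i z *\<^sub>R b i)"
    and ci: "\<And>k::nat \<Rightarrow> int. \<And>i. i < 2 * CARD('n) \<Longrightarrow> c i (\<Sum>i<2*CARD('n). of_int (k i) *\<^sub>R b i) = of_int (k i)"
    and G: "\<Gamma> = {(\<Sum>i<2*CARD('n). of_int (k i) *\<^sub>R b i) | k::nat \<Rightarrow> int. True}"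
    by (rule full_lattice_coordinates[OF L]) (assumption | blast)+
  have "\<exists>\<gamma>\<in>\<Gamma>. z + \<gamma> \<in> cball 0 (\<Sum>i<?m. norm (b i))" for z
  proof
    let ?g = "\<Sum>i<?m. of_int (- \<lfloor>c i z\<rfloor>) *\<^sub>R b i"
    show "?g \<in> \<Gamma>" unfolding G by (auto intro!: exI[of _ "\<lambda>i. - \<lfloor>c i z\<rfloor>"])
    have "z + ?g = (\<Sum>i<?m. frac (c i z) *\<^sub>R b i)"
      by (subst z[of z]) (simp add: sum.distrib[symmetric] scaleR_add_left[symmetric] frac_def scaleR_diff_left sum_subtractf sum_negf)
    also have "norm \<dots> \<le> (\<Sum>i<?m. norm (frac (c i z) *\<^sub>R b i))" by (rule norm_sum)
    also have "\<dots> \<le> (\<Sum>i<?m. norm (b i))"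
      by (intro sum_mono) (simp add: mult_left_le_one_le frac_ge_0 less_imp_le[OF frac_lt_1])
    finally show "z + ?g \<in> cball 0 (\<Sum>i<?m. norm (b i))" by simp
  qed
  then show ?thesis using that[of "cball 0 (\<Sum>i<?m. norm (b i))"] by simp
qed

lemma uniformly_discrete_countable:
  fixes S :: "'a::{heine_borel,real_normed_vector} set"
  assumes "d > 0" "\<And>x y. x \<in> S \<Longrightarrow> y \<in> S \<Longrightarrow> x \<noteq> y \<Longrightarrow> dist x y \<ge> d"
  shows "countable S"
proof -
  have "finite {x\<in>S. norm x \<le> real n}" for n
    by (rule uniformly_discrete_bounded_finite[OF assms(1)]) (auto simp: assms(2) bounded_iff)
  moreover have "S = (\<Union>n. {x\<in>S. norm x \<le> real n})"
    using real_arch_simple by auto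
  moreover have "countable (\<Union>n. {x\<in>S. norm x \<le> real n})"
    using countable_finite[OF calculation(1)] by (intro countable_UN) auto
  ultimately show ?thesis by simp
qed

text \<open>Split \<open>v\<close> along the kernel of \<open>l\<close> and a vector
  \<open>f\<close> with \<open>pair l f = 1\<close>; then \<open>e = g *v f - f\<close>.\<close>

lemma rank_one_form:
  fixes g :: "complex^'n^'n"
  assumes l: "l \<noteq> 0" and g: "\<And>v. pair l v = 0 \<Longrightarrow> g *v v = v"
  shows "\<exists>e. \<forall>v. g *v v = v + pair l v *s e"
proof -
  obtain f0 where f0: "pair l f0 \<noteq> 0" using l pair_eq_0_iff by blast
  define f where "f = (1 / pair l f0) *s f0"
  have f: "pair l f = 1" using f0 by (simp add: f_def pair_scale)
  have "g *v v = v + pair l v *s (g *v f - f)" for v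
  proof -
    have "g *v (v - pair l v *s f) = v - pair l v *s f" by (rule g) (simp add: pair_diff pair_scale f)
    moreover have "g *v (v - pair l v *s f) = g *v v - pair l v *s (g *v f)"
      by (simp add: matrix_vector_mult_diff_distrib vector_scalar_commute)
    ultimately have "g *v v = v - pair l v *s f + pair l v *s (g *v f)" by (simp add: algebra_simps)
    then show ?thesis by (simp add: vec_eq_iff algebra_simps)
  qed
  then show ?thesis by blast
qed

lemma det_identity_column: "det ((\<chi> i j. if j = k then x $ i else mat 1 $ i $ j) :: complex^'n^'n) = x $ k"
  using cramer_lemma[of k "mat 1" x] by (simp only: matrix_vector_mul_lid det_I mult_1_right)

lemma det_identity_row: "det ((\<chi> i j. if i = k then x $ j else mat 1 $ i $ j) :: complex^'n^'n) = x $ k"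
proof -
  have "transpose (\<chi> i j. if j = k then x $ i else mat 1 $ i $ j) = ((\<chi> i j. if i = k then x $ j else mat 1 $ i $ j) :: complex^'n^'n)"
    by (auto simp: transpose_def vec_eq_iff mat_def)
  then show ?thesis using det_identity_column[of k x] det_transpose[of "\<chi> i j. if j = k then x $ i else mat 1 $ i $ j"] by simp
qed

lemma matrix_vector_mult_axis: "A *v axis k 1 = column k A" for A :: "complex^'n^'m"
  by (simp add: vec_eq_iff matrix_vector_mult_def column_def axis_def if_distrib[of "\<lambda>x. _ * x"] cong: if_cong)

text \<open>The determinant of the identity plus a rank-one matrix, obtained from the intertwining
  relation \<open>g ** A = A ** B\<close> with two matrices that differ from the identity in a
  single column or row.\<close>

lemma det_rank_one:
  fixes g :: "complex^'n^'n"
  assumes g: "\<And>v. g *v v = v + pair l v *s e"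
  shows "det g = 1 + pair l e"
proof (cases "e = 0")
  case True
  then have "g = mat 1" using g by (simp add: matrix_eq)
  then show ?thesis using True by simp
next
  case False
  then obtain k where k: "e $ k \<noteq> 0" by (auto simp: vec_eq_iff)
  \<comment> \<open>\<open>A\<close> replaces the \<open>k\<close>th column of the identity by
    \<open>e\<close>, an eigenvector of \<open>g\<close>. In the basis of its columns
    \<open>g\<close> becomes \<open>B\<close>, which differs from the identity in the
    \<open>k\<close>th row only.\<close>
  define A :: "complex^'n^'n" where "A = (\<chi> i j. if j = k then e $ i else mat 1 $ i $ j)"
  define x :: "complex^'n" where "x = (\<chi> j. if j = k then 1 + pair l e else l $ j)"
  define B :: "complex^'n^'n" where "B = (\<chi> i j. if i = k then x $ j else mat 1 $ i $ j)"
  have colA: "A *v axis j 1 = (if j = k then e else axis j 1)" for j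
    unfolding matrix_vector_mult_axis by (simp add: A_def column_def vec_eq_iff mat_def axis_def)
  have colB: "B *v axis j 1 = (if j = k then (1 + pair l e) *s axis k 1 else axis j 1 + l $ j *s axis k 1)" for j
    unfolding matrix_vector_mult_axis by (auto simp: B_def x_def column_def vec_eq_iff mat_def axis_def)
  have "(g ** A) *v axis j 1 = (A ** B) *v axis j 1" for j
    by (simp add: matrix_vector_mul_assoc[symmetric] colA colB g pair_axis matrix_vector_right_distrib
        vector_scalar_commute)
  then have "column j (g ** A) = column j (A ** B)" for j by (simp add: matrix_vector_mult_axis)
  then have "g ** A = A ** B" by (simp add: vec_eq_iff column_def)
  then have "det g * det A = det A * det B" by (metis det_mul)
  moreover have "det A = e $ k" unfolding A_def by (rule det_identity_column)
  moreover have "det B = 1 + pair l e" unfolding B_def using det_identity_row[of k x] by (simp add: x_def)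
  ultimately show ?thesis using k by simp
qed

lemma matrix_inv_mult:
  assumes "invertible (g :: complex^'n^'n)"
  shows "g ** matrix_inv g = mat 1" "matrix_inv g ** g = mat 1"
  using someI_ex[OF assms[unfolded invertible_def]] unfolding matrix_inv_def by auto

lemma matrix_inv_mult_vector:
  assumes "invertible (g :: complex^'n^'n)"
  shows "g *v (matrix_inv g *v x) = x" "matrix_inv g *v (g *v x) = x"
  using matrix_inv_mult[OF assms] by (simp_all add: matrix_vector_mul_assoc)

lemma matrix_inv_unique_vector:
  assumes "invertible (g :: complex^'n^'n)" "g *v y = x"
  shows "matrix_inv g *v x = y"
  using matrix_inv_mult_vector(2)[OF assms(1), of y] assms(2) by simp

section \<open>Stabilizers of reflection hypertori\<close>

definition mpow :: "complex^'n^'n \<Rightarrow> nat \<Rightarrow> complex^'n^'n" where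
  "mpow g j = (((**) g) ^^ j) (mat 1)"

lemma mpow_0 [simp]: "mpow g 0 = mat 1"
  by (simp add: mpow_def)

lemma mpow_Suc: "mpow g (Suc j) = g ** mpow g j"
  by (simp add: mpow_def)

lemma det_mpow: "det (mpow g j) = det g ^ j"
  by (induction j) (simp_all add: mpow_Suc det_mul)

lemma mpow_ginv_pow:
  assumes "invertible g"
  shows "mpow g j *v ginv_pow g j z = z"
proof (induction j arbitrary: z)
  case 0 then show ?case by (simp add: ginv_pow_def)
next
  case (Suc j)
  have "ginv_pow g (Suc j) z = matrix_inv g *v ginv_pow g j z" by (simp add: ginv_pow_def)
  also have "\<dots> = ginv_pow g j (matrix_inv g *v z)"
    by (simp add: ginv_pow_def funpow_swap1)
  finally show ?case
    using Suc[of "matrix_inv g *v z"] matrix_inv_mult_vector(1)[OF assms]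
    by (simp add: mpow_Suc matrix_vector_mul_assoc[symmetric])
qed

text \<open>Multiplication by \<open>x\<close> permutes \<open>D\<close>, so the product over
  \<open>D\<close> equals itself times \<open>x ^ card D\<close>. A root count then turns the
  inclusion into an equality.\<close>

lemma root_of_unity_subgroup:
  fixes D :: "complex set"
  assumes D: "finite D" "1 \<in> D" "0 \<notin> D" "\<And>x y. x \<in> D \<Longrightarrow> y \<in> D \<Longrightarrow> x * y \<in> D"
  shows "D = {x. x ^ card D = 1}"
proof -
  have "x ^ card D = 1" if x: "x \<in> D" for x
  proof -
    have inj: "inj_on ((*) x) D" using x D(3) by (auto simp: inj_on_def)
    have "(*) x ` D \<subseteq> D" using D(4) x by auto
    then have im: "(*) x ` D = D" using inj D(1) by (simp add: endo_inj_surj)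
    have "prod id D = prod id ((*) x ` D)" by (simp add: im)
    also have "\<dots> = (\<Prod>y\<in>D. x * y)" using inj by (simp add: prod.reindex)
    also have "\<dots> = x ^ card D * prod id D" by (simp add: prod.distrib)
    finally have "prod id D = x ^ card D * prod id D" .
    moreover have "prod id D \<noteq> 0" using D(1,3) by auto
    ultimately show ?thesis by simp
  qed
  then have sub: "D \<subseteq> {x. x ^ card D = 1}" by auto
  have c: "card D > 0" using D(1,2) by (auto simp: card_gt_0_iff)
  have "card {x::complex. x ^ card D = 1} = card D" by (rule card_roots_unity_eq[OF c])
  moreover have "finite {x::complex. x ^ card D = 1}" using finite_roots_unity[of "card D"] c by (simp add: Suc_leI)
  ultimately show ?thesis using sub by (simp add: card_subset_eq)
qed

section \<open>Reflection hypertori of a crystallographic group\<close>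

locale crystallographic =
  fixes W :: "(complex^'n^'n) set" and \<Gamma> :: "(complex^'n) set"
  assumes grp: "finite_matrix_group W" and lat: "full_lattice \<Gamma>"
    and inv\<Gamma>: "\<And>w \<gamma>. w \<in> W \<Longrightarrow> \<gamma> \<in> \<Gamma> \<Longrightarrow> w *v \<gamma> \<in> \<Gamma>"
begin

lemma W_fin: "finite W" and W_1: "mat 1 \<in> W" and W_mult: "a \<in> W \<Longrightarrow> b \<in> W \<Longrightarrow> a ** b \<in> W"
  and W_invertible: "a \<in> W \<Longrightarrow> invertible a" and W_inv: "a \<in> W \<Longrightarrow> matrix_inv a \<in> W"
  using grp by (auto simp: finite_matrix_group_def)

lemmas \<Gamma>_0 = full_lattice_0[OF lat] and \<Gamma>_diff = full_lattice_diff[OF lat]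
  and \<Gamma>_minus = full_lattice_minus[OF lat] and \<Gamma>_add = full_lattice_add[OF lat]

lemma W_inv_mult: "w \<in> W \<Longrightarrow> w *v (matrix_inv w *v x) = x" "w \<in> W \<Longrightarrow> matrix_inv w *v (w *v x) = x"
  using matrix_inv_mult_vector W_invertible by blast+

text \<open>With \<open>pair l e = 0\<close> the \<open>k\<close>th power moves \<open>v\<close> by
  \<open>k * pair l v\<close> times \<open>e\<close>, whereas a finite group allows only finitely
  many images of \<open>v\<close>.\<close>

lemma no_unipotent:
  assumes w: "w \<in> W" "\<And>v. w *v v = v + pair l v *s e" and l: "l \<noteq> 0" "pair l e = 0"
  shows "e = 0"
proof (rule ccontr)
  assume e: "e \<noteq> 0"
  obtain v where v: "pair l v \<noteq> 0" using l pair_eq_0_iff by blast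
  have p: "mpow w k *v v = v + (of_nat k * pair l v) *s e" for k
    by (induction k) (simp_all add: mpow_Suc matrix_vector_mul_assoc[symmetric] w(2) pair_add pair_scale l(2),
      simp add: vec_eq_iff algebra_simps)
  have "mpow w k \<in> W" for k by (induction k) (auto simp: W_1 mpow_Suc W_mult w(1))
  then have "(\<lambda>k. mpow w k *v v) ` UNIV \<subseteq> (\<lambda>M. M *v v) ` W" by auto
  then have "finite (range (\<lambda>k::nat. mpow w k *v v))" using W_fin finite_subset finite_imageI by metis
  moreover have "inj (\<lambda>k::nat. mpow w k *v v)"
    unfolding p using e v by (auto simp: inj_def vec_eq_iff)
  ultimately show False using finite_imageD infinite_UNIV_nat by blast
qed

text \<open>The real line through a nonzero \<open>x\<close> would contain arbitrarily short nonzero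
  lattice vectors.\<close>

lemma smult_small_eq_0:
  assumes "\<And>s::real. s *\<^sub>R x \<in> \<Gamma>"
  shows "x = 0"
proof (rule ccontr)
  assume x: "x \<noteq> 0"
  obtain d where d: "d > 0" "\<And>x. x \<in> \<Gamma> \<Longrightarrow> x \<noteq> 0 \<Longrightarrow> norm x \<ge> d"
    using full_lattice_discrete[OF lat] by blast
  have "norm ((d / (2 * norm x)) *\<^sub>R x) \<ge> d" using d x assms by (intro d(2)) auto
  then show False using d(1) x by simp
qed

text \<open>The set \<open>Q\<close> stays abstract because it serves both for the values of a form
  on fixed points and for its values on the lattice; multiplying \<open>e\<close> by its elements
  carries either into \<open>\<Gamma>\<close>.\<close>

lemma form_image_discrete:
  assumes e: "e \<noteq> 0" and Q: "\<And>c. c \<in> Q \<Longrightarrow> c *s e \<in> \<Gamma>"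
  obtains d where "d > 0" "\<And>x y. x \<in> Q \<Longrightarrow> y \<in> Q \<Longrightarrow> x \<noteq> y \<Longrightarrow> dist x y \<ge> d"
proof -
  obtain d where d: "d > 0" "\<And>x. x \<in> \<Gamma> \<Longrightarrow> x \<noteq> 0 \<Longrightarrow> norm x \<ge> d"
    using full_lattice_discrete[OF lat] by blast
  have "dist x y \<ge> d / norm e" if "x \<in> Q" "y \<in> Q" "x \<noteq> y" for x y
  proof -
    have "x *s e - y *s e = (x - y) *s e" by (simp add: vec_eq_iff algebra_simps)
    moreover have "x *s e - y *s e \<in> \<Gamma>" using that by (intro \<Gamma>_diff Q)
    moreover have "(x - y) *s e \<noteq> 0" using that e by (auto simp: vec_eq_iff)
    ultimately have "d \<le> norm ((x - y) *s e)" using d(2) by metis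
    then have "d \<le> dist x y * norm e" by (simp only: norm_smult dist_norm)
    then show ?thesis using e by (simp add: divide_le_eq)
  qed
  then show ?thesis using that[of "d / norm e"] d e by simp
qed

text \<open>On the fixed locus the form takes values in a discrete, hence countable set, and a
  connected set of complex numbers with two points is uncountable. Conversely the fibre of the form
  is convex and stays in the fixed locus.\<close>

lemma component_fixlift:
  assumes g: "\<And>v. g *v v = v + pair l v *s e" and e: "e \<noteq> 0" and p: "p \<in> fixlift \<Gamma> g"
  shows "connected_component_set (fixlift \<Gamma> g) p = {z. pair l z = pair l p}"
proof -
  have fx: "fixlift \<Gamma> g = {z. pair l z *s e \<in> \<Gamma>}" by (simp add: fixlift_def g)
  show ?thesis
  proof
    let ?C = "connected_component_set (fixlift \<Gamma> g) p"
    have conn: "connected (pair l ` ?C)"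
      by (intro connected_continuous_image continuous_at_imp_continuous_on ballI isCont_pair) simp
    obtain d where d: "d > 0" "\<And>x y. x \<in> {c. c *s e \<in> \<Gamma>} \<Longrightarrow> y \<in> {c. c *s e \<in> \<Gamma>} \<Longrightarrow> x \<noteq> y \<Longrightarrow> dist x y \<ge> d"
      by (rule form_image_discrete[OF e, of "{c. c *s e \<in> \<Gamma>}"]) auto
    have "countable {c. c *s e \<in> \<Gamma>}" by (rule uniformly_discrete_countable[OF d])
    moreover have sub: "?C \<subseteq> fixlift \<Gamma> g" by (rule connected_component_subset)
    have "pair l ` ?C \<subseteq> {c. c *s e \<in> \<Gamma>}" using sub unfolding fx by blast
    ultimately have ctb: "countable (pair l ` ?C)" using countable_subset by blast
    have pC: "p \<in> ?C" using p by (simp add: connected_component_refl)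
    show "?C \<subseteq> {z. pair l z = pair l p}"
    proof
      fix z assume z: "z \<in> ?C"
      show "z \<in> {z. pair l z = pair l p}"
        using connected_uncountable[OF conn, of "pair l z" "pair l p"] ctb z pC by blast
    qed
  next
    have "{z. pair l z = pair l p} \<subseteq> fixlift \<Gamma> g" using p unfolding fx by auto
    moreover have "convex {z. pair l z = pair l p}"
    proof (rule convexI)
      fix x y :: "complex^'n" and u v :: real
      assume a: "x \<in> {z. pair l z = pair l p}" "y \<in> {z. pair l z = pair l p}" "u + v = 1"
      have "pair l (u *\<^sub>R x + v *\<^sub>R y) = u *\<^sub>R pair l x + v *\<^sub>R pair l y"
        using bounded_linear_pair[of l] by (simp add: pair_add bounded_linear.linear linear_scale)
      also have "\<dots> = (u + v) *\<^sub>R pair l p" using a(1,2) by (simp add: scaleR_add_left)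
      finally show "u *\<^sub>R x + v *\<^sub>R y \<in> {z. pair l z = pair l p}" using a by simp
    qed
    ultimately show "{z. pair l z = pair l p} \<subseteq> connected_component_set (fixlift \<Gamma> g) p"
      by (intro connected_component_maximal convex_connected) auto
  qed
qed

lemma saturation_eq:
  "{z + \<gamma> | z \<gamma>. z \<in> {z. pair l z = pair l p} \<and> \<gamma> \<in> \<Gamma>} = {z. \<exists>\<gamma>\<in>\<Gamma>. pair l z = pair l p + pair l \<gamma>}"
proof (intro equalityI subsetI)
  fix x assume "x \<in> {z. \<exists>\<gamma>\<in>\<Gamma>. pair l z = pair l p + pair l \<gamma>}"
  then obtain \<gamma> where "\<gamma> \<in> \<Gamma>" "pair l x = pair l p + pair l \<gamma>" by blast
  then have "x = (x - \<gamma>) + \<gamma>" "pair l (x - \<gamma>) = pair l p" "\<gamma> \<in> \<Gamma>" by (simp_all add: pair_diff)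
  then show "x \<in> {z + \<gamma> | z \<gamma>. z \<in> {z. pair l z = pair l p} \<and> \<gamma> \<in> \<Gamma>}" by blast
qed (auto simp: pair_add)

lemma refl_hypertorusE:
  assumes "refl_hypertorus W \<Gamma> H"
  obtains g l e p where "g \<in> W" "is_reflection g" "l \<noteq> 0" "e \<noteq> 0" "\<And>v. g *v v = v + pair l v *s e"
    "p \<in> fixlift \<Gamma> g" "H = {z. \<exists>\<gamma>\<in>\<Gamma>. pair l z = pair l p + pair l \<gamma>}"
proof -
  obtain g p where g: "g \<in> W" "is_reflection g" "p \<in> fixlift \<Gamma> g"
    and H: "H = {z + \<gamma> | z \<gamma>. z \<in> connected_component_set (fixlift \<Gamma> g) p \<and> \<gamma> \<in> \<Gamma>}"
    using assms unfolding refl_hypertorus_def by blast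
  obtain l where l: "l \<noteq> 0" "\<And>v. pair l v = 0 \<Longrightarrow> g *v v = v" using g(2) unfolding is_reflection_def by blast
  obtain e where e: "\<And>v. g *v v = v + pair l v *s e" using rank_one_form[OF l] by blast
  have "g \<noteq> mat 1" using g(2) by (simp add: is_reflection_def)
  then have e0: "e \<noteq> 0" using e by (auto simp: matrix_eq)
  have "H = {z. \<exists>\<gamma>\<in>\<Gamma>. pair l z = pair l p + pair l \<gamma>}"
    unfolding H component_fixlift[OF e e0 g(3)] by (rule saturation_eq)
  then show ?thesis using that g l(1) e0 e by blast
qed

section \<open>The stabilizer of a hypertorus and its distinguished generator\<close>

lemma stabH_W: "w \<in> stabH W \<Gamma> H \<Longrightarrow> w \<in> W"
  by (simp add: stabH_def)

lemma stabH_1: "mat 1 \<in> stabH W \<Gamma> H"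
  by (simp add: stabH_def W_1 \<Gamma>_0)

lemma stabH_mult:
  assumes "a \<in> stabH W \<Gamma> H" "b \<in> stabH W \<Gamma> H"
  shows "a ** b \<in> stabH W \<Gamma> H"
proof -
  have "(a ** b) *v z - z \<in> \<Gamma>" if "z \<in> H" for z
  proof -
    have "(a ** b) *v z - z = a *v (b *v z - z) + (a *v z - z)"
      by (simp add: matrix_vector_mul_assoc matrix_vector_mult_diff_distrib)
    moreover have "a *v (b *v z - z) \<in> \<Gamma>" "a *v z - z \<in> \<Gamma>" using assms that by (auto simp: stabH_def intro: inv\<Gamma>)
    ultimately show ?thesis using \<Gamma>_add by metis
  qed
  then show ?thesis using assms W_mult by (auto simp: stabH_def)
qed

lemma stabH_inv:
  assumes "a \<in> stabH W \<Gamma> H"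
  shows "matrix_inv a \<in> stabH W \<Gamma> H"
proof -
  have a: "a \<in> W" using assms stabH_W by blast
  have "matrix_inv a *v z - z \<in> \<Gamma>" if "z \<in> H" for z
  proof -
    have "matrix_inv a *v z - z = - (matrix_inv a *v (a *v z - z))"
      by (simp add: matrix_vector_mult_diff_distrib W_inv_mult[OF a])
    moreover have "matrix_inv a *v (a *v z - z) \<in> \<Gamma>" using assms that by (auto simp: stabH_def intro: inv\<Gamma> W_inv)
    ultimately show ?thesis using \<Gamma>_minus by metis
  qed
  then show ?thesis using a W_inv by (simp add: stabH_def)
qed

lemma stabH_mpow: "a \<in> stabH W \<Gamma> H \<Longrightarrow> mpow a j \<in> stabH W \<Gamma> H"
  by (induction j) (simp_all add: stabH_1 mpow_Suc stabH_mult)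

text \<open>For \<open>v\<close> in the kernel of \<open>l\<close> the hypertorus contains the whole
  real line through \<open>p\<close> in direction \<open>v\<close>. Hence all real multiples of
  \<open>w *v v - v\<close> are lattice vectors, and this vector is zero.\<close>

lemma stabH_rank_one:
  assumes l: "l \<noteq> 0" and H: "H = {z. \<exists>\<gamma>\<in>\<Gamma>. pair l z = pair l p + pair l \<gamma>}" and w: "w \<in> stabH W \<Gamma> H"
  shows "\<exists>e. \<forall>v. w *v v = v + pair l v *s e"
proof (rule rank_one_form[OF l])
  fix v assume v: "pair l v = 0"
  have pH: "p + s *\<^sub>R v \<in> H" for s :: real
  proof -
    have "pair l (s *\<^sub>R v) = s *\<^sub>R pair l v"
      using bounded_linear_pair[of l] by (simp add: bounded_linear.linear linear_scale)
    then show ?thesis unfolding H using v \<Gamma>_0 by (auto simp: pair_add intro!: bexI[of _ 0])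
  qed
  have "s *\<^sub>R (w *v v - v) \<in> \<Gamma>" for s :: real
  proof -
    have "w *v (s *\<^sub>R v) = s *\<^sub>R (w *v v)"
      by (simp add: vec_eq_iff matrix_vector_mult_def scaleR_sum_right)
    then have "s *\<^sub>R (w *v v - v) = (w *v (p + s *\<^sub>R v) - (p + s *\<^sub>R v)) - (w *v (p + 0 *\<^sub>R v) - (p + 0 *\<^sub>R v))"
      by (simp add: matrix_vector_right_distrib scaleR_diff_right)
    also have "\<dots> \<in> \<Gamma>"
    proof -
      have "w *v (p + r *\<^sub>R v) - (p + r *\<^sub>R v) \<in> \<Gamma>" for r :: real using w pH[of r] unfolding stabH_def by blast
      from \<Gamma>_diff[OF this[of s] this[of 0]] show ?thesis .
    qed
    finally show ?thesis .
  qed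
  from smult_small_eq_0[OF this] show "w *v v = v" by simp
qed

text \<open>Determinant 1 means \<open>pair l e = 0\<close>, so \<open>w\<close> is unipotent and
  finiteness of the group makes it trivial.\<close>

lemma stabH_det_1:
  assumes l: "l \<noteq> 0" and H: "H = {z. \<exists>\<gamma>\<in>\<Gamma>. pair l z = pair l p + pair l \<gamma>}" and w: "w \<in> stabH W \<Gamma> H"
    and d: "det w = 1"
  shows "w = mat 1"
proof -
  obtain e where e: "\<And>v. w *v v = v + pair l v *s e" using stabH_rank_one[OF l H w] by blast
  have "pair l e = 0" using det_rank_one[OF e] d by simp
  then have "e = 0" using no_unipotent[OF stabH_W[OF w] e l] by blast
  then show ?thesis using e by (simp add: matrix_eq)
qed

text \<open>The determinant thus embeds the stabilizer in the multiplicative group of complex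
  numbers; its cyclic structure comes from here.\<close>

lemma stabH_det_inj:
  assumes l: "l \<noteq> 0" and H: "H = {z. \<exists>\<gamma>\<in>\<Gamma>. pair l z = pair l p + pair l \<gamma>}"
  shows "inj_on det (stabH W \<Gamma> H)"
proof (rule inj_onI)
  fix a b assume ab: "a \<in> stabH W \<Gamma> H" "b \<in> stabH W \<Gamma> H" "det a = det b"
  have bi: "b ** matrix_inv b = mat 1" "matrix_inv b ** b = mat 1" using matrix_inv_mult[OF W_invertible[OF stabH_W[OF ab(2)]]] .
  have "det (a ** matrix_inv b) = det (b ** matrix_inv b)" by (simp add: det_mul ab(3))
  then have "det (a ** matrix_inv b) = 1" by (simp add: bi)
  then have "a ** matrix_inv b = mat 1" by (rule stabH_det_1[OF l H stabH_mult[OF ab(1) stabH_inv[OF ab(2)]]])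
  then have "a ** matrix_inv b ** b = b" by simp
  then show "a = b" by (simp add: matrix_mul_assoc[symmetric] bi)
qed

text \<open>By injectivity the determinants form a group of order \<open>nH\<close>, so they are all
  the roots of unity of that order and the prescribed one occurs. This makes the definite
  description of \<open>gH\<close> meaningful.\<close>

lemma gH_ex1:
  assumes l: "l \<noteq> 0" and H: "H = {z. \<exists>\<gamma>\<in>\<Gamma>. pair l z = pair l p + pair l \<gamma>}"
  shows "\<exists>!g. g \<in> stabH W \<Gamma> H \<and> det g = exp (2 * of_real pi * \<i> / of_nat (nH W \<Gamma> H))"
proof -
  let ?S = "stabH W \<Gamma> H"
  have fin: "finite ?S" using W_fin by (rule finite_subset[rotated]) (auto simp: stabH_def)
  have inj: "inj_on det ?S" by (rule stabH_det_inj[OF l H])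
  have card: "card (det ` ?S) = nH W \<Gamma> H" by (simp add: nH_def card_image[OF inj])
  have n: "nH W \<Gamma> H > 0" unfolding nH_def using fin stabH_1 by (auto simp: card_gt_0_iff)
  have "det ` ?S = {x. x ^ card (det ` ?S) = 1}"
  proof (rule root_of_unity_subgroup)
    show "1 \<in> det ` ?S" using stabH_1[of H] det_I by (metis image_eqI)
    show "0 \<notin> det ` ?S" using W_invertible[OF stabH_W] by (force simp: invertible_det_nz)
    show "x * y \<in> det ` ?S" if xy: "x \<in> det ` ?S" "y \<in> det ` ?S" for x y
    proof -
      obtain a b where "a \<in> ?S" "b \<in> ?S" "x = det a" "y = det b" using xy by auto
      then show ?thesis using stabH_mult[of a H b] by (auto simp: det_mul[symmetric])
    qed
  qed (use fin in auto)
  moreover have "exp (2 * of_real pi * \<i> / of_nat (nH W \<Gamma> H)) ^ nH W \<Gamma> H = 1"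
    using n by (simp add: exp_of_nat_mult[symmetric])
  ultimately have "exp (2 * of_real pi * \<i> / of_nat (nH W \<Gamma> H)) \<in> det ` ?S" unfolding card by blast
  then show ?thesis using inj by (auto simp: inj_on_def)
qed

lemma gH_properties:
  assumes "refl_hypertorus W \<Gamma> H"
  shows "gH W \<Gamma> H \<in> stabH W \<Gamma> H" "det (gH W \<Gamma> H) = exp (2 * of_real pi * \<i> / of_nat (nH W \<Gamma> H))"
    "g \<in> stabH W \<Gamma> H \<Longrightarrow> det g = exp (2 * of_real pi * \<i> / of_nat (nH W \<Gamma> H)) \<Longrightarrow> g = gH W \<Gamma> H"
proof -
  from assms have ex: "\<exists>!g. g \<in> stabH W \<Gamma> H \<and> det g = exp (2 * of_real pi * \<i> / of_nat (nH W \<Gamma> H))"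
    by (rule refl_hypertorusE) (rule gH_ex1)
  from theI'[OF ex] show "gH W \<Gamma> H \<in> stabH W \<Gamma> H" "det (gH W \<Gamma> H) = exp (2 * of_real pi * \<i> / of_nat (nH W \<Gamma> H))"
    by (simp_all add: gH_def)
  then show "g \<in> stabH W \<Gamma> H \<Longrightarrow> det g = exp (2 * of_real pi * \<i> / of_nat (nH W \<Gamma> H)) \<Longrightarrow> g = gH W \<Gamma> H"
    using ex by auto
qed

text \<open>The determinant is the exponential of 2 pi i times \<open>j / n\<close>, and
  \<open>j / n\<close> lies strictly between 0 and 1.\<close>

lemma mpow_gH_nontrivial:
  assumes H: "refl_hypertorus W \<Gamma> H" and j: "1 \<le> j" "j \<le> nH W \<Gamma> H - 1"
  shows "mpow (gH W \<Gamma> H) j \<noteq> mat 1"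
proof
  let ?n = "nH W \<Gamma> H"
  have jn: "j < ?n" using j by linarith
  assume "mpow (gH W \<Gamma> H) j = mat 1"
  then have "det (gH W \<Gamma> H) ^ j = 1" using det_mpow[of "gH W \<Gamma> H" j] by simp
  then have "exp (of_nat j * (2 * of_real pi * \<i> / of_nat ?n)) = (1::complex)"
    by (simp only: gH_properties(2)[OF H] exp_of_nat_mult)
  then obtain k :: int where "Im (of_nat j * (2 * of_real pi * \<i> / of_nat ?n)) = of_int (2 * k) * pi"
    unfolding exp_eq_1 by auto
  moreover have "Im (of_nat j * (2 * of_real pi * \<i> / of_nat ?n)) = 2 * pi * real j / real ?n"
    by (simp add: Im_divide_of_nat)
  ultimately have "real j / real ?n = of_int k" 
  proof -
    assume "Im (of_nat j * (2 * of_real pi * \<i> / of_nat ?n)) = of_int (2 * k) * pi"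
      "Im (of_nat j * (2 * of_real pi * \<i> / of_nat ?n)) = 2 * pi * real j / real ?n"
    then have "2 * pi * (real j / real ?n) = 2 * pi * of_int k" by (simp add: mult_ac)
    then show ?thesis by (metis mult_left_cancel pi_neq_zero zero_neq_numeral mult_eq_0_iff)
  qed
  moreover have "0 < real j / real ?n" "real j / real ?n < 1" using j(1) jn by auto
  ultimately show False by auto
qed

text \<open>\<open>ellH\<close> is an arbitrary choice, so it is known only up to a factor:
  evaluating an eigenform \<open>k\<close> on \<open>v + pair l v *s e\<close> shows that
  \<open>\<mu> - 1\<close> times \<open>k\<close> is \<open>pair k e\<close> times
  \<open>l\<close>.\<close>

lemma ellH_proportional:
  assumes l: "l \<noteq> 0" "e \<noteq> 0" "\<And>v. gH W \<Gamma> H *v v = v + pair l v *s e" and gW: "gH W \<Gamma> H \<in> W"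
  shows "ellH W \<Gamma> H \<noteq> 0" "\<exists>c. c \<noteq> 0 \<and> (\<forall>v. pair (ellH W \<Gamma> H) v = c * pair l v)"
proof -
  have proportional: "\<exists>c. c \<noteq> 0 \<and> (\<forall>v. pair k v = c * pair l v)"
    if k: "k \<noteq> 0" "\<mu> \<noteq> 1" "\<And>v. pair k (gH W \<Gamma> H *v v) = \<mu> * pair k v" for k \<mu>
  proof -
    have eq: "pair k v = (pair k e / (\<mu> - 1)) * pair l v" for v
      using k(3)[of v] k(2) by (simp add: l(3) pair_add pair_scale field_simps)
    obtain v where "pair k v \<noteq> 0" using k(1) pair_eq_0_iff by blast
    then have "pair k e / (\<mu> - 1) \<noteq> 0" using eq[of v] by auto
    then show ?thesis using eq by blast
  qed
  have "pair l e \<noteq> 0" using no_unipotent[OF gW l(3) l(1)] l(2) by blast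
  then have "\<exists>k. k \<noteq> 0 \<and> (\<exists>\<mu>. \<mu> \<noteq> 1 \<and> (\<forall>v. pair k (gH W \<Gamma> H *v v) = \<mu> * pair k v))"
    using l(1) by (intro exI[of _ l] conjI exI[of _ "1 + pair l e"]) (auto simp: l(3) pair_add pair_scale algebra_simps)
  from someI_ex[OF this] have el: "ellH W \<Gamma> H \<noteq> 0" "\<exists>\<mu>. \<mu> \<noteq> 1 \<and> (\<forall>v. pair (ellH W \<Gamma> H) (gH W \<Gamma> H *v v) = \<mu> * pair (ellH W \<Gamma> H) v)"
    unfolding ellH_def by blast+
  then show "ellH W \<Gamma> H \<noteq> 0" "\<exists>c. c \<noteq> 0 \<and> (\<forall>v. pair (ellH W \<Gamma> H) v = c * pair l v)"
    using proportional by blast+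
qed

text \<open>Everything known through the form of the defining reflection is transferred to the
  chosen form \<open>ellH\<close>. The reflection itself lies in the stabilizer, which yields order
  at least 2 and hence a nontrivial \<open>gH\<close>.\<close>

lemma hypertorus_ellH:
  assumes H: "refl_hypertorus W \<Gamma> H"
  shows "ellH W \<Gamma> H \<noteq> 0"
    and "\<exists>p. H = {z. \<exists>\<gamma>\<in>\<Gamma>. pair (ellH W \<Gamma> H) z = pair (ellH W \<Gamma> H) p + pair (ellH W \<Gamma> H) \<gamma>}"
    and "\<And>w. w \<in> stabH W \<Gamma> H \<Longrightarrow> \<exists>e. \<forall>v. w *v v = v + pair (ellH W \<Gamma> H) v *s e"
    and "nH W \<Gamma> H \<ge> 2"
proof -
  let ?L = "ellH W \<Gamma> H"
  obtain g l e p where g: "g \<in> W" "is_reflection g" "l \<noteq> 0" "e \<noteq> 0" "\<And>v. g *v v = v + pair l v *s e"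
    "p \<in> fixlift \<Gamma> g" and Heq: "H = {z. \<exists>\<gamma>\<in>\<Gamma>. pair l z = pair l p + pair l \<gamma>}"
    using H by (rule refl_hypertorusE) blast
  have gst: "g \<in> stabH W \<Gamma> H"
  proof -
    have "g *v z - z \<in> \<Gamma>" if z: "z \<in> H" for z
    proof -
      obtain \<gamma> where \<gamma>: "\<gamma> \<in> \<Gamma>" "pair l z = pair l p + pair l \<gamma>" using z Heq by blast
      then have "g *v z - z = (g *v p - p) + (g *v \<gamma> - \<gamma>)" by (simp add: g(5) vec_eq_iff algebra_simps)
      then show ?thesis using g(1,6) \<gamma>(1) by (auto simp: fixlift_def intro!: \<Gamma>_add \<Gamma>_diff inv\<Gamma>)
    qed
    then show ?thesis using g(1) by (simp add: stabH_def)
  qed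
  have "g \<noteq> mat 1" using g(2) by (simp add: is_reflection_def)
  have fin: "finite (stabH W \<Gamma> H)" using W_fin by (rule finite_subset[rotated]) (auto simp: stabH_def)
  have "card {mat 1, g} \<le> card (stabH W \<Gamma> H)" using gst stabH_1 by (intro card_mono fin) auto
  then show n2: "nH W \<Gamma> H \<ge> 2" using \<open>g \<noteq> mat 1\<close> by (simp add: nH_def)
  have gHst: "gH W \<Gamma> H \<in> stabH W \<Gamma> H" by (rule gH_properties[OF H])
  obtain e0 where e0: "\<And>v. gH W \<Gamma> H *v v = v + pair l v *s e0" using stabH_rank_one[OF g(3) Heq gHst] by blast
  have "mpow (gH W \<Gamma> H) 1 \<noteq> mat 1" using n2 by (intro mpow_gH_nontrivial[OF H]) auto
  then have "gH W \<Gamma> H \<noteq> mat 1" by (simp add: mpow_def)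
  then have e0nz: "e0 \<noteq> 0" using e0 by (auto simp: matrix_eq)
  note el = ellH_proportional[OF g(3) e0nz e0 stabH_W[OF gHst]]
  show "?L \<noteq> 0" by (rule el)
  obtain c where c: "c \<noteq> 0" "\<And>v. pair ?L v = c * pair l v" using el(2) by blast
  show "\<exists>p. H = {z. \<exists>\<gamma>\<in>\<Gamma>. pair ?L z = pair ?L p + pair ?L \<gamma>}"
    using c(1) by (intro exI[of _ p]) (subst Heq, simp add: c(2) distrib_left[symmetric])
  show "\<exists>e. \<forall>v. w *v v = v + pair ?L v *s e" if w: "w \<in> stabH W \<Gamma> H" for w
  proof -
    obtain e where "\<And>v. w *v v = v + pair l v *s e" using stabH_rank_one[OF g(3) Heq w] by blast
    then have "w *v v = v + pair ?L v *s ((1/c) *s e)" for v using c(1) by (simp add: c(2) vec_eq_iff)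
    then show ?thesis by blast
  qed
qed

end

section \<open>Conjugation by the group\<close>

lemma matrix_inv_eqI:
  fixes A B :: "complex^'n^'n"
  assumes "A ** B = mat 1" "B ** A = mat 1"
  shows "matrix_inv A = B"
proof -
  have "invertible A" using assms by (auto simp: invertible_def)
  then have "matrix_inv A ** A = mat 1" by (rule matrix_inv_mult(2))
  then have "matrix_inv A ** A ** B = B" by simp
  then show ?thesis by (simp add: matrix_mul_assoc[symmetric] assms(1))
qed

lemma pair_matrix: "pair l (M *v v) = pair (transpose M *v l) v" for M :: "complex^'n^'n"
proof -
  have "pair l (M *v v) = (\<Sum>i\<in>UNIV. \<Sum>j\<in>UNIV. l $ i * (M $ i $ j * v $ j))"
    by (simp add: pair_def matrix_vector_mult_def sum_distrib_left)
  also have "\<dots> = (\<Sum>j\<in>UNIV. \<Sum>i\<in>UNIV. l $ i * (M $ i $ j * v $ j))" by (rule sum.swap)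
  also have "\<dots> = pair (transpose M *v l) v"
    by (simp add: pair_def matrix_vector_mult_def transpose_def sum_distrib_left sum_distrib_right mult_ac)
  finally show ?thesis .
qed

context crystallographic
begin

lemma W_inv_mat: "w \<in> W \<Longrightarrow> w ** matrix_inv w = mat 1" "w \<in> W \<Longrightarrow> matrix_inv w ** w = mat 1"
  using matrix_inv_mult W_invertible by blast+

lemma W_inv_inv: "w \<in> W \<Longrightarrow> matrix_inv (matrix_inv w) = w"
  using W_inv_mat by (intro matrix_inv_eqI) auto

lemma W_image_iff: "w \<in> W \<Longrightarrow> x \<in> (\<lambda>z. w *v z) ` H \<longleftrightarrow> matrix_inv w *v x \<in> H"
  using W_inv_mult[of w] by (auto intro!: image_eqI[of x _ "matrix_inv w *v x"])

lemma conj_apply: "(w ** g ** matrix_inv w) *v v = w *v (g *v (matrix_inv w *v v))"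
  by (simp add: matrix_vector_mul_assoc matrix_mul_assoc)

text \<open>If \<open>P\<close> diagonalizes \<open>g\<close>, then \<open>P ** matrix_inv w\<close>
  diagonalizes the conjugate, and the form of \<open>g\<close> composed with
  \<open>matrix_inv w\<close> cuts out a hyperplane that the conjugate fixes.\<close>

lemma reflection_conj:
  assumes w: "w \<in> W" and g: "is_reflection g"
  shows "is_reflection (w ** g ** matrix_inv w)"
  unfolding is_reflection_def
proof (intro conjI)
  let ?v = "matrix_inv w"
  note i = W_inv_mat[OF w]
  obtain l where l: "g \<noteq> mat 1" "semisimple g" "l \<noteq> 0" "\<And>v. pair l v = 0 \<Longrightarrow> g *v v = v"
    using g unfolding is_reflection_def by blast
  show "w ** g ** ?v \<noteq> mat 1"
  proof
    assume "w ** g ** ?v = mat 1"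
    then have "?v ** (w ** g ** ?v) ** w = mat 1" by (simp add: i)
    then have "(?v ** w) ** g ** (?v ** w) = mat 1" by (simp only: matrix_mul_assoc)
    then show False using l(1) by (simp add: i)
  qed
  obtain P :: "complex^'n^'n" where P: "invertible P" "\<And>a b. a \<noteq> b \<Longrightarrow> (P ** g ** matrix_inv P) $ a $ b = 0"
    using l(2) unfolding semisimple_def by blast
  note Pi = matrix_inv_mult[OF P(1)]
  have "(P ** ?v) ** (w ** matrix_inv P) = P ** (?v ** w) ** matrix_inv P" by (simp only: matrix_mul_assoc)
  then have 1: "(P ** ?v) ** (w ** matrix_inv P) = mat 1" by (simp add: i Pi)
  have "(w ** matrix_inv P) ** (P ** ?v) = w ** (matrix_inv P ** P) ** ?v" by (simp only: matrix_mul_assoc)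
  then have 2: "(w ** matrix_inv P) ** (P ** ?v) = mat 1" by (simp add: i Pi)
  have "(P ** ?v) ** (w ** g ** ?v) ** (w ** matrix_inv P) = P ** (?v ** w) ** g ** (?v ** w) ** matrix_inv P"
    by (simp only: matrix_mul_assoc)
  then have "(P ** ?v) ** (w ** g ** ?v) ** matrix_inv (P ** ?v) = P ** g ** matrix_inv P"
    by (simp add: i matrix_inv_eqI[OF 1 2])
  moreover have "invertible (P ** ?v)" using 1 2 by (auto simp: invertible_def)
  ultimately show "semisimple (w ** g ** ?v)" using P(2) unfolding semisimple_def by metis
  show "\<exists>l. l \<noteq> 0 \<and> (\<forall>v. pair l v = 0 \<longrightarrow> (w ** g ** ?v) *v v = v)"
  proof (intro exI[of _ "transpose ?v *v l"] conjI allI impI)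
    show "transpose ?v *v l \<noteq> 0"
    proof
      assume "transpose ?v *v l = 0"
      then have "pair l (?v *v v) = 0" for v by (simp add: pair_matrix)
      then have "pair l v = 0" for v using W_inv_mult(2)[OF w] by metis
      then show False using l(3) pair_eq_0_iff by blast
    qed
    fix v assume "pair (transpose ?v *v l) v = 0"
    then have "pair l (?v *v v) = 0" by (simp add: pair_matrix)
    then show "(w ** g ** ?v) *v v = v" by (simp add: conj_apply l(4) W_inv_mult[OF w])
  qed
qed

lemma refl_hypertorus_image:
  assumes w: "w \<in> W" and H: "refl_hypertorus W \<Gamma> H"
  shows "refl_hypertorus W \<Gamma> ((\<lambda>z. w *v z) ` H)"
proof -
  let ?v = "matrix_inv w"
  obtain g l e p where g: "g \<in> W" "is_reflection g" "l \<noteq> 0" "e \<noteq> 0" "\<And>v. g *v v = v + pair l v *s e"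
    "p \<in> fixlift \<Gamma> g" and Heq: "H = {z. \<exists>\<gamma>\<in>\<Gamma>. pair l z = pair l p + pair l \<gamma>}"
    using H by (rule refl_hypertorusE) blast
  define g' where "g' = w ** g ** ?v"
  define l' where "l' = transpose ?v *v l"
  have l': "pair l' v = pair l (?v *v v)" for v by (simp add: l'_def pair_matrix)
  have g': "g' *v v = v + pair l' v *s (w *v e)" for v
    by (simp add: g'_def conj_apply g(5) matrix_vector_right_distrib vector_scalar_commute W_inv_mult[OF w] l')
  have we: "w *v e \<noteq> 0" using W_inv_mult(2)[OF w, of e] g(4) by auto
  have fx: "w *v p \<in> fixlift \<Gamma> g'"
  proof -
    have "g' *v (w *v p) - w *v p = w *v (g *v p - p)"
      by (simp add: g'_def conj_apply W_inv_mult[OF w] matrix_vector_mult_diff_distrib)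
    then show ?thesis using g(6) inv\<Gamma>[OF w] by (simp add: fixlift_def)
  qed
  have "(\<lambda>z. w *v z) ` H = {z. \<exists>\<gamma>\<in>\<Gamma>. pair l' z = pair l' (w *v p) + pair l' \<gamma>}"
  proof (intro set_eqI)
    fix x
    have "x \<in> (\<lambda>z. w *v z) ` H \<longleftrightarrow> (\<exists>\<gamma>\<in>\<Gamma>. pair l (?v *v x) = pair l p + pair l \<gamma>)"
      by (simp only: W_image_iff[OF w] Heq mem_Collect_eq)
    also have "\<dots> \<longleftrightarrow> (\<exists>\<gamma>\<in>\<Gamma>. pair l (?v *v x) = pair l p + pair l (?v *v \<gamma>))"
      by (metis W_inv W_inv_mult inv\<Gamma> w)
    finally show "x \<in> (\<lambda>z. w *v z) ` H \<longleftrightarrow> x \<in> {z. \<exists>\<gamma>\<in>\<Gamma>. pair l' z = pair l' (w *v p) + pair l' \<gamma>}"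
      by (simp add: l' W_inv_mult[OF w])
  qed
  also have "\<dots> = {z + \<gamma> | z \<gamma>. z \<in> connected_component_set (fixlift \<Gamma> g') (w *v p) \<and> \<gamma> \<in> \<Gamma>}"
    unfolding component_fixlift[OF g' we fx] by (rule saturation_eq[symmetric])
  finally show ?thesis
    unfolding refl_hypertorus_def using fx reflection_conj[OF w g(2)] W_mult[OF W_mult[OF w g(1)] W_inv[OF w]]
    by (auto simp: g'_def[symmetric])
qed

lemma stabH_conj:
  assumes w: "w \<in> W" and s: "s \<in> stabH W \<Gamma> H"
  shows "w ** s ** matrix_inv w \<in> stabH W \<Gamma> ((\<lambda>z. w *v z) ` H)"
proof -
  have "w *v (s *v x) - w *v x \<in> \<Gamma>" if "x \<in> H" for x
    using inv\<Gamma>[OF w, of "s *v x - x"] s that by (simp add: stabH_def matrix_vector_mult_diff_distrib)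
  then show ?thesis
    using s w by (auto simp: stabH_def conj_apply W_inv_mult intro!: W_mult W_inv)
qed

lemma image_image_inv: "w \<in> W \<Longrightarrow> (\<lambda>z. matrix_inv w *v z) ` (\<lambda>z. w *v z) ` H = H"
  "w \<in> W \<Longrightarrow> (\<lambda>z. w *v z) ` (\<lambda>z. matrix_inv w *v z) ` H = H"
  by (simp_all add: image_image W_inv_mult)

text \<open>Conjugation injects one stabilizer into the other, which gives an inequality; the
  inverse element gives the opposite one.\<close>

lemma nH_image:
  assumes w: "w \<in> W"
  shows "nH W \<Gamma> ((\<lambda>z. w *v z) ` H) = nH W \<Gamma> H"
proof -
  have le: "card (stabH W \<Gamma> H) \<le> card (stabH W \<Gamma> ((\<lambda>z. w *v z) ` H))" if w: "w \<in> W" for w H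
  proof (rule card_inj_on_le[of "\<lambda>s. w ** s ** matrix_inv w"])
    show "inj_on (\<lambda>s. w ** s ** matrix_inv w) (stabH W \<Gamma> H)"
    proof (rule inj_onI)
      fix a b assume "w ** a ** matrix_inv w = w ** b ** matrix_inv w"
      then have "matrix_inv w ** (w ** a ** matrix_inv w) ** w = matrix_inv w ** (w ** b ** matrix_inv w) ** w" by simp
      then have "(matrix_inv w ** w) ** a ** (matrix_inv w ** w) = (matrix_inv w ** w) ** b ** (matrix_inv w ** w)"
        by (simp only: matrix_mul_assoc)
      then show "a = b" by (simp add: W_inv_mat[OF w])
    qed
    show "(\<lambda>s. w ** s ** matrix_inv w) ` stabH W \<Gamma> H \<subseteq> stabH W \<Gamma> ((\<lambda>z. w *v z) ` H)"
      using stabH_conj[OF w] by auto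
    show "finite (stabH W \<Gamma> ((\<lambda>z. w *v z) ` H))" using W_fin by (rule finite_subset[rotated]) (auto simp: stabH_def)
  qed
  show ?thesis
    using le[OF w, of H] le[OF W_inv[OF w], of "(\<lambda>z. w *v z) ` H"] by (simp add: nH_def image_image_inv[OF w])
qed

text \<open>The conjugate lies in the stabilizer of the image and has the required determinant
  because \<open>nH\<close> is invariant; uniqueness in the description of \<open>gH\<close> does
  the rest.\<close>

lemma gH_image:
  assumes w: "w \<in> W" and H: "refl_hypertorus W \<Gamma> H"
  shows "gH W \<Gamma> ((\<lambda>z. w *v z) ` H) = w ** gH W \<Gamma> H ** matrix_inv w"
proof (rule gH_properties(3)[OF refl_hypertorus_image[OF w H], symmetric])
  show "w ** gH W \<Gamma> H ** matrix_inv w \<in> stabH W \<Gamma> ((\<lambda>z. w *v z) ` H)"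
    by (rule stabH_conj[OF w gH_properties(1)[OF H]])
  have "det w * det (matrix_inv w) = det (w ** matrix_inv w)" by (simp add: det_mul)
  then have "det w * det (matrix_inv w) = 1" by (simp add: W_inv_mat[OF w])
  moreover have "det (w ** gH W \<Gamma> H ** matrix_inv w) = det (gH W \<Gamma> H) * (det w * det (matrix_inv w))"
    by (simp add: det_mul)
  ultimately show "det (w ** gH W \<Gamma> H ** matrix_inv w) = exp (2 * of_real pi * \<i> / of_nat (nH W \<Gamma> ((\<lambda>z. w *v z) ` H)))"
    using gH_properties(2)[OF H] nH_image[OF w] by simp
qed

lemma mpow_conj: "w \<in> W \<Longrightarrow> mpow (w ** g ** matrix_inv w) j = w ** mpow g j ** matrix_inv w"
proof (induction j)
  case 0 then show ?case by (simp add: W_inv_mat)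
next
  case (Suc j)
  have "mpow (w ** g ** matrix_inv w) (Suc j) = w ** g ** (matrix_inv w ** w) ** mpow g j ** matrix_inv w"
    using Suc by (simp add: mpow_Suc matrix_mul_assoc)
  then show ?case using Suc.prems by (simp add: W_inv_mat mpow_Suc matrix_mul_assoc)
qed

section \<open>The indexing set, its group action and the discreteness of the poles\<close>

definition act :: "complex^'n^'n \<Rightarrow> (complex^'n) set \<times> nat \<Rightarrow> (complex^'n) set \<times> nat" where
  "act w S = ((\<lambda>z. w *v z) ` fst S, snd S)"

definition rho :: "(complex^'n) set \<times> nat \<Rightarrow> complex^'n^'n" where
  "rho S = mpow (gH W \<Gamma> (fst S)) (snd S)"

definition ell :: "(complex^'n) set \<times> nat \<Rightarrow> complex^'n" where
  "ell S = ellH W \<Gamma> (fst S)"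

text \<open>Each hypertorus is a union of fibres of one linear form; this is the subset of the plane
  from which it is pulled back.\<close>

definition poles :: "(complex^'n) set \<times> nat \<Rightarrow> complex set" where
  "poles S = pair (ell S) ` fst S"

lemma Sset_iff: "S \<in> Sset W \<Gamma> \<longleftrightarrow> refl_hypertorus W \<Gamma> (fst S) \<and> 1 \<le> snd S \<and> snd S \<le> nH W \<Gamma> (fst S) - 1"
  by (cases S) (simp add: Sset_def)

lemma rho_stab: "S \<in> Sset W \<Gamma> \<Longrightarrow> rho S \<in> stabH W \<Gamma> (fst S)"
  by (simp add: Sset_iff rho_def stabH_mpow gH_properties(1))

lemma rho_W: "S \<in> Sset W \<Gamma> \<Longrightarrow> rho S \<in> W"
  using rho_stab stabH_W by blast

lemma rho_nontrivial: "S \<in> Sset W \<Gamma> \<Longrightarrow> rho S \<noteq> mat 1"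
  by (simp add: Sset_iff rho_def mpow_gH_nontrivial)

lemma ginv_pow_rho: "S \<in> Sset W \<Gamma> \<Longrightarrow> ginv_pow (gH W \<Gamma> (fst S)) (snd S) z = matrix_inv (rho S) *v z"
  by (rule matrix_inv_unique_vector[symmetric])
    (auto simp: W_invertible rho_W Sset_iff rho_def intro!: mpow_ginv_pow W_invertible stabH_W[OF gH_properties(1)],
     simp add: W_invertible rho_W[unfolded rho_def] Sset_iff)

lemma ell_nonzero: "S \<in> Sset W \<Gamma> \<Longrightarrow> ell S \<noteq> 0"
  by (simp add: Sset_iff ell_def hypertorus_ellH)

lemma stabH_ell: "S \<in> Sset W \<Gamma> \<Longrightarrow> w \<in> stabH W \<Gamma> (fst S) \<Longrightarrow> \<exists>e. \<forall>v. w *v v = v + pair (ell S) v *s e"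
  by (simp add: Sset_iff ell_def hypertorus_ellH(3))

lemma rho_inv_stab: "S \<in> Sset W \<Gamma> \<Longrightarrow> z \<in> fst S \<Longrightarrow> matrix_inv (rho S) *v z - z \<in> \<Gamma>"
  using stabH_inv[OF rho_stab] by (auto simp: stabH_def)

lemma rho_inv_form:
  assumes "S \<in> Sset W \<Gamma>"
  obtains e where "\<And>v. matrix_inv (rho S) *v v = v + pair (ell S) v *s e" "e \<noteq> 0"
proof -
  obtain e where e: "\<And>v. matrix_inv (rho S) *v v = v + pair (ell S) v *s e"
    using stabH_ell[OF assms stabH_inv[OF rho_stab[OF assms]]] by blast
  have "e \<noteq> 0"
  proof
    assume "e = 0"
    then have "matrix_inv (rho S) = mat 1" using e by (simp add: matrix_eq)
    then have "rho S = mat 1" using W_inv_mat(1)[OF rho_W[OF assms]] by simp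
    then show False using rho_nontrivial[OF assms] by simp
  qed
  then show ?thesis using e that by blast
qed

lemma hypertorus_eq:
  assumes "S \<in> Sset W \<Gamma>"
  obtains p where "fst S = {z. \<exists>\<gamma>\<in>\<Gamma>. pair (ell S) z = pair (ell S) p + pair (ell S) \<gamma>}" "p \<in> fst S"
proof -
  obtain p where p: "fst S = {z. \<exists>\<gamma>\<in>\<Gamma>. pair (ell S) z = pair (ell S) p + pair (ell S) \<gamma>}"
    using hypertorus_ellH(2) assms unfolding Sset_iff ell_def by blast
  have "p \<in> {z. \<exists>\<gamma>\<in>\<Gamma>. pair (ell S) z = pair (ell S) p + pair (ell S) \<gamma>}" using \<Gamma>_0 by (auto intro!: bexI[of _ 0])
  then have "p \<in> fst S" using p by blast
  then show ?thesis using that p by blast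
qed

lemma poles_iff:
  assumes "S \<in> Sset W \<Gamma>"
  shows "z \<in> fst S \<longleftrightarrow> pair (ell S) z \<in> poles S"
proof -
  obtain p where p: "fst S = {z. \<exists>\<gamma>\<in>\<Gamma>. pair (ell S) z = pair (ell S) p + pair (ell S) \<gamma>}"
    using hypertorus_eq[OF assms] by blast
  have "z \<in> fst S" if y: "y \<in> fst S" and e: "pair (ell S) z = pair (ell S) y" for y z
    using y unfolding p by (simp add: e)
  then show ?thesis unfolding poles_def by blast
qed

text \<open>The image of a lattice under a linear form need not be discrete in general. Here
  \<open>pair (ell S) \<gamma> *s e\<close> is the lattice vector
  \<open>matrix_inv (rho S) *v \<gamma> - \<gamma>\<close>, which transports discreteness from the
  lattice to the image.\<close>

lemma \<Gamma>_ell_discrete: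
  assumes "S \<in> Sset W \<Gamma>"
  obtains d where "d > 0" "\<And>\<gamma>. \<gamma> \<in> \<Gamma> \<Longrightarrow> pair (ell S) \<gamma> \<noteq> 0 \<Longrightarrow> norm (pair (ell S) \<gamma>) \<ge> d"
proof -
  obtain e where e: "\<And>v. matrix_inv (rho S) *v v = v + pair (ell S) v *s e" "e \<noteq> 0"
    using rho_inv_form[OF assms] by blast
  have Q: "c *s e \<in> \<Gamma>" if c: "c \<in> pair (ell S) ` \<Gamma>" for c
  proof -
    obtain \<gamma> where \<gamma>: "\<gamma> \<in> \<Gamma>" "c = pair (ell S) \<gamma>" using c by blast
    have "matrix_inv (rho S) *v \<gamma> - \<gamma> \<in> \<Gamma>" using \<gamma>(1) by (intro \<Gamma>_diff inv\<Gamma> W_inv rho_W assms)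
    then show ?thesis by (simp add: e(1) \<gamma>(2))
  qed
  obtain d where d: "d > 0" "\<And>x y. x \<in> pair (ell S) ` \<Gamma> \<Longrightarrow> y \<in> pair (ell S) ` \<Gamma> \<Longrightarrow> x \<noteq> y \<Longrightarrow> dist x y \<ge> d"
    using form_image_discrete[OF e(2) Q] by blast
  have "norm (pair (ell S) \<gamma>) \<ge> d" if "\<gamma> \<in> \<Gamma>" "pair (ell S) \<gamma> \<noteq> 0" for \<gamma>
    using d(2)[of "pair (ell S) \<gamma>" 0] that imageI[OF \<Gamma>_0, of "pair (ell S)"] by simp
  then show ?thesis using that d(1) by blast
qed

lemma poles_discrete:
  assumes "S \<in> Sset W \<Gamma>"
  obtains d where "d > 0" "\<And>x y. x \<in> poles S \<Longrightarrow> y \<in> poles S \<Longrightarrow> x \<noteq> y \<Longrightarrow> dist x y \<ge> d"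
proof -
  obtain p where p: "fst S = {z. \<exists>\<gamma>\<in>\<Gamma>. pair (ell S) z = pair (ell S) p + pair (ell S) \<gamma>}"
    using hypertorus_eq[OF assms] by blast
  obtain d where d: "d > 0" "\<And>\<gamma>. \<gamma> \<in> \<Gamma> \<Longrightarrow> pair (ell S) \<gamma> \<noteq> 0 \<Longrightarrow> norm (pair (ell S) \<gamma>) \<ge> d"
    using \<Gamma>_ell_discrete[OF assms] by blast
  have "dist x y \<ge> d" if xy: "x \<in> poles S" "y \<in> poles S" "x \<noteq> y" for x y
  proof -
    obtain \<gamma> \<gamma>' where g: "\<gamma> \<in> \<Gamma>" "x = pair (ell S) p + pair (ell S) \<gamma>" "\<gamma>' \<in> \<Gamma>" "y = pair (ell S) p + pair (ell S) \<gamma>'"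
      using xy(1,2) unfolding poles_def p by auto
    have "x - y = pair (ell S) (\<gamma> - \<gamma>')" by (simp add: g pair_diff)
    moreover have "\<gamma> - \<gamma>' \<in> \<Gamma>" by (rule \<Gamma>_diff[OF g(1,3)])
    moreover have "x - y \<noteq> 0" using xy(3) by simp
    ultimately show ?thesis using d(2)[of "\<gamma> - \<gamma>'"] by (metis dist_norm)
  qed
  then show ?thesis using that d(1) by blast
qed

lemma poles_countable: "S \<in> Sset W \<Gamma> \<Longrightarrow> countable (poles S)"
  by (erule poles_discrete) (rule uniformly_discrete_countable)

lemma poles_no_limpt: "S \<in> Sset W \<Gamma> \<Longrightarrow> \<not> x islimpt poles S"
proof
  assume S: "S \<in> Sset W \<Gamma>" and x: "x islimpt poles S"
  obtain d where d: "d > 0" "\<And>x y. x \<in> poles S \<Longrightarrow> y \<in> poles S \<Longrightarrow> x \<noteq> y \<Longrightarrow> dist x y \<ge> d"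
    using poles_discrete[OF S] by blast
  obtain y where y: "y \<in> poles S" "y \<noteq> x" "dist y x < d/2" using x d(1) unfolding islimpt_approachable by (meson half_gt_zero)
  obtain y' where y': "y' \<in> poles S" "y' \<noteq> x" "dist y' x < dist y x"
    using x y(2) unfolding islimpt_approachable by (metis zero_less_dist_iff)
  then have "y' \<noteq> y" by auto
  then have "d \<le> dist y' y" using d(2) y y' by blast
  also have "\<dots> \<le> dist y' x + dist y x" by (rule dist_triangle2)
  finally show False using y y' by linarith
qed

lemma hypertorus_\<Gamma>:
  assumes "S \<in> Sset W \<Gamma>" "\<gamma> \<in> \<Gamma>"
  shows "z + \<gamma> \<in> fst S \<longleftrightarrow> z \<in> fst S"
proof -
  obtain p where p: "fst S = {z. \<exists>\<gamma>\<in>\<Gamma>. pair (ell S) z = pair (ell S) p + pair (ell S) \<gamma>}"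
    using hypertorus_eq[OF assms(1)] by blast
  have imp: "z + \<gamma> \<in> fst S" if z: "z \<in> fst S" and \<gamma>: "\<gamma> \<in> \<Gamma>" for z \<gamma>
  proof -
    obtain \<gamma>' where g: "\<gamma>' \<in> \<Gamma>" "pair (ell S) z = pair (ell S) p + pair (ell S) \<gamma>'" using z p by blast
    have "pair (ell S) (z + \<gamma>) = pair (ell S) p + pair (ell S) (\<gamma>' + \<gamma>)" by (simp add: pair_add g(2))
    then show ?thesis unfolding p using \<Gamma>_add[OF g(1) \<gamma>] by blast
  qed
  show ?thesis using imp[OF _ assms(2)] imp[OF _ \<Gamma>_minus[OF assms(2)], of "z + \<gamma>"] by auto
qed

lemma act_Sset: "w \<in> W \<Longrightarrow> S \<in> Sset W \<Gamma> \<Longrightarrow> act w S \<in> Sset W \<Gamma>"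
  by (simp add: Sset_iff act_def refl_hypertorus_image nH_image)

lemma act_inv: "w \<in> W \<Longrightarrow> act (matrix_inv w) (act w S) = S" "w \<in> W \<Longrightarrow> act w (act (matrix_inv w) S) = S"
  by (simp_all add: act_def image_image_inv)

lemma rho_act: "w \<in> W \<Longrightarrow> S \<in> Sset W \<Gamma> \<Longrightarrow> rho (act w S) = w ** rho S ** matrix_inv w"
  by (simp add: rho_def act_def Sset_iff gH_image mpow_conj)

lemma fst_act_iff: "w \<in> W \<Longrightarrow> x \<in> fst (act w S) \<longleftrightarrow> matrix_inv w *v x \<in> fst S"
  by (simp add: act_def W_image_iff)

text \<open>The forms are chosen independently for each hypertorus, so equivariance holds only up to
  a constant. It is found by comparing the rank-one parts of conjugate matrices in one coordinate
  where \<open>e'\<close> is nonzero.\<close>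

lemma ell_act:
  assumes w: "w \<in> W" and S: "S \<in> Sset W \<Gamma>"
  obtains c where "c \<noteq> 0" "\<And>v. pair (ell (act w S)) (w *v v) = c * pair (ell S) v"
proof -
  obtain e where e: "\<And>v. matrix_inv (rho S) *v v = v + pair (ell S) v *s e" "e \<noteq> 0"
    using rho_inv_form[OF S] by blast
  obtain e' where e': "\<And>v. matrix_inv (rho (act w S)) *v v = v + pair (ell (act w S)) v *s e'" "e' \<noteq> 0"
    using rho_inv_form[OF act_Sset[OF w S]] by blast
  let ?r = "rho S"
  note r = rho_W[OF S]
  have "rho (act w S) *v (w *v (matrix_inv ?r *v v)) = w *v v" for v
    by (simp add: rho_act[OF w S] conj_apply W_inv_mult[OF w] W_inv_mult[OF r])
  then have "matrix_inv (rho (act w S)) *v (w *v v) = w *v (matrix_inv ?r *v v)" for v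
    by (intro matrix_inv_unique_vector W_invertible rho_W act_Sset w S)
  then have eq: "pair (ell (act w S)) (w *v v) *s e' = pair (ell S) v *s (w *v e)" for v
    by (simp add: e'(1) e(1) matrix_vector_right_distrib vector_scalar_commute)
  obtain k where k: "e' $ k \<noteq> 0" using e'(2) by (auto simp: vec_eq_iff)
  define c where "c = (w *v e) $ k / e' $ k"
  have c: "pair (ell (act w S)) (w *v v) = c * pair (ell S) v" for v
  proof -
    have "pair (ell (act w S)) (w *v v) * e' $ k = pair (ell S) v * (w *v e) $ k"
      using arg_cong[OF eq[of v], of "\<lambda>x. x $ k"] by simp
    then show ?thesis using k by (simp add: c_def field_simps)
  qed
  have "c \<noteq> 0"
  proof
    assume "c = 0"
    then have "pair (ell (act w S)) (w *v v) = 0" for v using c by simp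
    then have "pair (ell (act w S)) v = 0" for v using W_inv_mult(1)[OF w] by metis
    then show False using ell_nonzero[OF act_Sset[OF w S]] pair_eq_0_iff by blast
  qed
  then show ?thesis using that c by blast
qed

end

section \<open>The sections with a simple pole along a hypertorus\<close>

lemma holo_compose_pair:
  assumes "\<And>z. z \<in> U \<Longrightarrow> f field_differentiable at (pair l z)"
  shows "holo U (\<lambda>z. f (pair l z))"
  unfolding holo_def
proof
  fix z assume "z \<in> U"
  then obtain f' where f': "(f has_field_derivative f') (at (pair l z))"
    using assms by (auto simp: field_differentiable_def)
  have "((\<lambda>z. f (pair l z)) has_derivative (\<lambda>v. f' * pair l v)) (at z)"
    using has_derivative_compose[OF bounded_linear_imp_has_derivative[OF bounded_linear_pair] f'[unfolded has_field_derivative_def]] .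
  then show "\<exists>D. ((\<lambda>z. f (pair l z)) has_derivative D) (at z) \<and> (\<forall>c v. D (c *s v) = c * D v)"
    by (intro exI[of _ "\<lambda>v. f' * pair l v"]) (simp add: pair_scale)
qed

lemma holo_const: "holo U (\<lambda>_. c)"
  unfolding holo_def by (intro ballI exI[of _ "\<lambda>_. 0"]) simp

locale dunkl_setting = crystallographic W \<Gamma> for W :: "(complex^'n^'n) set" and \<Gamma> +
  fixes \<alpha> :: "complex^'n \<Rightarrow> complex"
  assumes anti: "antilin_form \<alpha>"
    and nontrivial: "\<And>w. w \<in> W \<Longrightarrow> w \<noteq> mat 1 \<Longrightarrow> \<not> holo_trivial \<Gamma> (\<lambda>\<gamma>. \<alpha> \<gamma> - \<alpha> (matrix_inv w *v \<gamma>))"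
begin

lemma \<alpha>_add: "\<alpha> (x + y) = \<alpha> x + \<alpha> y" and \<alpha>_scale: "\<alpha> (c *s x) = cnj c * \<alpha> x"
  using anti by (auto simp: antilin_form_def)

lemma \<alpha>_diff: "\<alpha> (x - y) = \<alpha> x - \<alpha> y"
  using \<alpha>_add[of "x - y" y] by simp

text \<open>If every multiplier were 1, the constant function 1 would trivialize the bundle.\<close>

lemma nontrivial_character:
  assumes "w \<in> W" "w \<noteq> mat 1"
  obtains \<gamma> where "\<gamma> \<in> \<Gamma>" "eC (Im (\<alpha> \<gamma> - \<alpha> (matrix_inv w *v \<gamma>))) \<noteq> 1"
proof -
  have "\<exists>\<gamma>\<in>\<Gamma>. eC (Im (\<alpha> \<gamma> - \<alpha> (matrix_inv w *v \<gamma>))) \<noteq> 1"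
  proof (rule ccontr)
    assume "\<not> ?thesis"
    then have "holo_trivial \<Gamma> (\<lambda>\<gamma>. \<alpha> \<gamma> - \<alpha> (matrix_inv w *v \<gamma>))"
      unfolding holo_trivial_def qp_def by (intro exI[of _ "\<lambda>_. 1"]) (auto simp: holo_const)
    then show False using nontrivial assms by blast
  qed
  then show ?thesis using that by blast
qed

text \<open>If the image lay on the real line through \<open>u\<close>, then
  \<open>Im (pair (ell S) z / u)\<close> would be periodic and hence bounded by compactness,
  although it takes every real value.\<close>

lemma ell_\<Gamma>_spans:
  assumes S: "S \<in> Sset W \<Gamma>" and u: "u \<noteq> 0"
  shows "\<exists>x\<in>pair (ell S) ` \<Gamma>. Im (x / u) \<noteq> 0"
proof (rule ccontr)
  assume "\<not> ?thesis"
  then have 0: "Im (pair (ell S) \<gamma> / u) = 0" if "\<gamma> \<in> \<Gamma>" for \<gamma> using that by auto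
  obtain v0 where v0: "pair (ell S) v0 \<noteq> 0" using ell_nonzero[OF S] pair_eq_0_iff by blast
  define v where "v = (1 / pair (ell S) v0) *s v0"
  have v: "pair (ell S) v = 1" using v0 by (simp add: v_def pair_scale)
  obtain K where K: "compact K" "\<And>z. \<exists>\<gamma>\<in>\<Gamma>. z + \<gamma> \<in> K" using full_lattice_cocompact[OF lat] by blast
  have "compact ((\<lambda>z. Im (pair (ell S) z / u)) ` K)"
    using u by (intro compact_continuous_image K(1) continuous_at_imp_continuous_on ballI continuous_intros isCont_pair) auto
  then obtain M where M: "\<And>z. z \<in> K \<Longrightarrow> norm (Im (pair (ell S) z / u)) \<le> M"
    using compact_imp_bounded bounded_iff by (metis (no_types, lifting) image_eqI)
  define t where "t = \<bar>M\<bar> + 1"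
  obtain \<gamma> where \<gamma>: "\<gamma> \<in> \<Gamma>" "(of_real t * \<i> * u) *s v + \<gamma> \<in> K" using K(2) by blast
  have "pair (ell S) ((of_real t * \<i> * u) *s v + \<gamma>) / u = of_real t * \<i> + pair (ell S) \<gamma> / u"
    using u by (simp add: pair_add pair_scale v add_divide_distrib)
  then have "Im (pair (ell S) ((of_real t * \<i> * u) *s v + \<gamma>) / u) = t" using 0[OF \<gamma>(1)] by simp
  then have "\<bar>t\<bar> \<le> M" using M[OF \<gamma>(2)] by simp
  then show False by (simp add: t_def)
qed

lemma eventually_off_hypertorus:
  assumes S: "S \<in> Sset W \<Gamma>" and e: "pair (ell S) e \<noteq> 0"
  shows "\<forall>\<^sub>F t in at 0. z + t *s e \<notin> fst S"
proof -
  obtain d where d: "d > 0" "\<And>y. y \<in> poles S \<Longrightarrow> dist y (pair (ell S) z) < d \<Longrightarrow> y = pair (ell S) z"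
    using poles_no_limpt[OF S] not_islimpt_ball by blast
  have "z + t *s e \<notin> fst S" if "t \<noteq> 0" "norm t < d / norm (pair (ell S) e)" for t
  proof
    assume "z + t *s e \<in> fst S"
    then have "pair (ell S) (z + t *s e) \<in> poles S" using poles_iff[OF S] by simp
    moreover have "dist (pair (ell S) (z + t *s e)) (pair (ell S) z) < d"
      using that e by (simp add: dist_norm pair_add pair_scale norm_mult field_simps)
    ultimately have "pair (ell S) (z + t *s e) = pair (ell S) z" by (rule d(2))
    then show False using that e by (simp add: pair_add pair_scale)
  qed
  then show ?thesis unfolding eventually_at using d(1) e
    by (intro exI[of _ "d / norm (pair (ell S) e)"]) auto
qed

lemma closed_hypertorus: "S \<in> Sset W \<Gamma> \<Longrightarrow> closed (fst S)"
proof -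
  assume S: "S \<in> Sset W \<Gamma>"
  have "closed (poles S)" using poles_no_limpt[OF S] by (simp add: closed_limpt)
  then have "closed (pair (ell S) -` poles S)" by (intro continuous_closed_vimage isCont_pair)
  moreover have "pair (ell S) -` poles S = fst S" using poles_iff[OF S] by auto
  ultimately show ?thesis by simp
qed

text \<open>The scalar part of the required section as a function of
  \<open>x = pair (ell S) z\<close>. The residue is a phase instead of 1 because the lifts of the
  two bundles are compared at \<open>matrix_inv (rho S) *v z\<close> and \<open>z\<close>, which
  differ by a lattice vector on the hypertorus.\<close>

definition is_section :: "(complex^'n) set \<times> nat \<Rightarrow> (complex \<Rightarrow> complex) \<Rightarrow> bool" where
  "is_section S f \<longleftrightarrow> (\<forall>x. x \<notin> poles S \<longrightarrow> f field_differentiable at x) \<and> (\<forall>x\<in>poles S. f x = 0) \<and>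
     (\<forall>z. \<forall>\<gamma>\<in>\<Gamma>. f (pair (ell S) (z + \<gamma>)) = eC (Im (\<alpha> \<gamma> - \<alpha> (matrix_inv (rho S) *v \<gamma>))) * f (pair (ell S) z)) \<and>
     (\<forall>z\<in>fst S. ((\<lambda>x. (x - pair (ell S) z) * f x) \<longlongrightarrow> eC (- Im (\<alpha> (matrix_inv (rho S) *v z - z)))) (at (pair (ell S) z)))"

lemma section_exists:
  assumes S: "S \<in> Sset W \<Gamma>"
  shows "\<exists>f. is_section S f"
proof -
  let ?l = "pair (ell S)"
  obtain e where e: "\<And>v. matrix_inv (rho S) *v v = v + ?l v *s e"
    using rho_inv_form[OF S] by blast
  \<comment> \<open>Antilinearity pulls \<open>pair (ell S) v\<close> out of
    \<open>\<alpha>\<close>, so the character depends only on the image of the lattice under the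
    form.\<close>
  define c where "c = - \<alpha> e"
  have k: "\<alpha> v - \<alpha> (matrix_inv (rho S) *v v) = c * cnj (?l v)" for v
    by (simp add: e \<alpha>_add \<alpha>_scale c_def)
  have k': "- \<alpha> (matrix_inv (rho S) *v v - v) = c * cnj (?l v)" for v
    using k[of v] by (simp add: \<alpha>_diff)
  obtain p where p: "fst S = {z. \<exists>\<gamma>\<in>\<Gamma>. ?l z = ?l p + ?l \<gamma>}" using hypertorus_eq[OF S] by blast
  define L where "L = ?l ` \<Gamma>"
  have mem: "z \<in> fst S \<longleftrightarrow> ?l z - ?l p \<in> L" for z
    unfolding p L_def by (auto simp: image_iff algebra_simps)
  have poles_L: "x \<in> poles S \<longleftrightarrow> x - ?l p \<in> L" for x
  proof
    assume "x \<in> poles S" then show "x - ?l p \<in> L" using mem by (auto simp: poles_def)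
  next
    assume x: "x - ?l p \<in> L"
    then obtain \<gamma> where "\<gamma> \<in> \<Gamma>" "x = ?l (p + \<gamma>)" by (auto simp: L_def pair_add algebra_simps)
    then show "x \<in> poles S" using mem[of "p + \<gamma>"] x by (auto simp: poles_def)
  qed
  have add: "x + y \<in> L" if "x \<in> L" "y \<in> L" for x y
    using that \<Gamma>_add unfolding L_def by (auto simp: pair_add[symmetric])
  obtain d where d: "d > 0" "\<And>\<gamma>. \<gamma> \<in> \<Gamma> \<Longrightarrow> ?l \<gamma> \<noteq> 0 \<Longrightarrow> norm (?l \<gamma>) \<ge> d"
    using \<Gamma>_ell_discrete[OF S] by blast
  obtain \<gamma>0 where \<gamma>0: "\<gamma>0 \<in> \<Gamma>" "eC (Im (\<alpha> \<gamma>0 - \<alpha> (matrix_inv (rho S) *v \<gamma>0))) \<noteq> 1"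
    using nontrivial_character[OF rho_W[OF S] rho_nontrivial[OF S]] by blast
  have "\<exists>F. (\<forall>x. x \<notin> L \<longrightarrow> F field_differentiable at x) \<and>
     (\<forall>x. \<forall>q\<in>L. F (x + q) = eC (Im (c * cnj q)) * F x) \<and> ((\<lambda>x. x * F x) \<longlongrightarrow> 1) (at 0)"
  proof (rule kronecker_function_exists)
    show "0 \<in> L" using imageI[OF \<Gamma>_0, of ?l] by (simp add: L_def)
    show "x - y \<in> L" if "x \<in> L" "y \<in> L" for x y
      using that \<Gamma>_diff unfolding L_def by (auto simp: pair_diff[symmetric])
    show "d > 0" by (rule d)
    show "d \<le> norm x" if "x \<in> L" "x \<noteq> 0" for x using that d(2) by (auto simp: L_def)
    show "\<exists>x\<in>L. Im (x / u) \<noteq> 0" if "u \<noteq> 0" for u using ell_\<Gamma>_spans[OF S that] by (simp add: L_def)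
    show "?l \<gamma>0 \<in> L" using \<gamma>0 by (simp add: L_def)
    show "eC (Im (c * cnj (?l \<gamma>0))) \<noteq> 1" using \<gamma>0(2) by (simp only: k) simp
  qed
  then obtain F where F: "\<And>x. x \<notin> L \<Longrightarrow> F field_differentiable at x"
    "\<And>x q. q \<in> L \<Longrightarrow> F (x + q) = eC (Im (c * cnj q)) * F x" "((\<lambda>x. x * F x) \<longlongrightarrow> 1) (at 0)"
    by blast
  \<comment> \<open>This phase adjusts the residue at the base point \<open>p\<close>;
    quasi-periodicity propagates it to all other poles.\<close>
  define A where "A = eC (Im (c * cnj (?l p)))"
  define f where "f = (\<lambda>x. if x \<in> poles S then 0 else A * F (x - ?l p))"
  have cl: "closed (poles S)" using poles_no_limpt[OF S] by (simp add: closed_limpt)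
  have "is_section S f"
    unfolding is_section_def
  proof (intro conjI allI impI ballI)
    fix x assume x: "x \<notin> poles S"
    then have "F field_differentiable at (x - ?l p)" using F(1) poles_L by blast
    then have "(F \<circ> (\<lambda>x. x - ?l p)) field_differentiable at x"
      by (intro field_differentiable_compose field_differentiable_diff) auto
    then have "(\<lambda>x. A * F (x - ?l p)) field_differentiable at x"
      unfolding o_def by (intro field_differentiable_mult) auto
    then obtain D where D: "((\<lambda>x. A * F (x - ?l p)) has_field_derivative D) (at x)" by (auto simp: field_differentiable_def)
    have "\<forall>\<^sub>F y in nhds x. f y = A * F (y - ?l p)"
      by (rule eventually_mono[OF eventually_nhds_in_open[of "- poles S" x]]) (use cl x in \<open>auto simp: f_def\<close>)
    then have "(f has_field_derivative D) (at x)" using D DERIV_cong_ev[of x x f "\<lambda>x. A * F (x - ?l p)" D D] by simp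
    then show "f field_differentiable at x" by (auto simp: field_differentiable_def)
  next
    fix x assume "x \<in> poles S" then show "f x = 0" by (simp add: f_def)
  next
    fix z \<gamma> assume \<gamma>: "\<gamma> \<in> \<Gamma>"
    then have g: "?l \<gamma> \<in> L" by (simp add: L_def)
    have "?l (z + \<gamma>) \<in> poles S \<longleftrightarrow> ?l z \<in> poles S"
      using hypertorus_\<Gamma>[OF S \<gamma>] poles_iff[OF S] by simp
    moreover have "F (?l (z + \<gamma>) - ?l p) = eC (Im (c * cnj (?l \<gamma>))) * F (?l z - ?l p)"
      using F(2)[OF g, of "?l z - ?l p"] by (simp add: pair_add algebra_simps)
    ultimately show "f (?l (z + \<gamma>)) = eC (Im (\<alpha> \<gamma> - \<alpha> (matrix_inv (rho S) *v \<gamma>))) * f (?l z)"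
      unfolding f_def k by simp
  next
    fix z assume z: "z \<in> fst S"
    then have q: "?l z - ?l p \<in> L" using mem by blast
    have "((\<lambda>y. (A * eC (Im (c * cnj (?l z - ?l p)))) * (y * F y)) \<longlongrightarrow> (A * eC (Im (c * cnj (?l z - ?l p)))) * 1) (at 0)"
      by (intro tendsto_mult tendsto_const F(3))
    moreover have "\<forall>\<^sub>F y in at 0. (A * eC (Im (c * cnj (?l z - ?l p)))) * (y * F y) = ((?l z + y) - ?l z) * f (?l z + y)"
    proof -
      obtain r where r: "r > 0" "\<And>y. y \<in> poles S \<Longrightarrow> dist y (?l z) < r \<Longrightarrow> y = ?l z"
        using poles_no_limpt[OF S] not_islimpt_ball by blast
      have "(A * eC (Im (c * cnj (?l z - ?l p)))) * (y * F y) = ((?l z + y) - ?l z) * f (?l z + y)"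
        if "y \<noteq> 0" "norm y < r" for y
      proof -
        have "?l z + y \<notin> poles S" using r(2)[of "?l z + y"] that by (auto simp: dist_norm)
        moreover have "F (?l z + y - ?l p) = eC (Im (c * cnj (?l z - ?l p))) * F y"
          using F(2)[OF q, of y] by (simp add: algebra_simps)
        ultimately show ?thesis by (simp add: f_def)
      qed
      then show ?thesis unfolding eventually_at using r(1) by (intro exI[of _ r]) auto
    qed
    ultimately have "((\<lambda>y. ((?l z + y) - ?l z) * f (?l z + y)) \<longlongrightarrow> (A * eC (Im (c * cnj (?l z - ?l p)))) * 1) (at 0)"
      using tendsto_cong by fast
    then have "((\<lambda>x. (x - ?l z) * f x) \<longlongrightarrow> A * eC (Im (c * cnj (?l z - ?l p)))) (at (?l z))"
      unfolding mult_1_right by (rule LIM_offset_zero_cancel)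
    also have "A * eC (Im (c * cnj (?l z - ?l p))) = eC (Im (c * cnj (?l z)))"
      by (simp add: A_def eC_add[symmetric] algebra_simps)
    also have "Im (c * cnj (?l z)) = - Im (\<alpha> (matrix_inv (rho S) *v z - z))" by (simp only: k'[symmetric]) simp
    finally show "((\<lambda>x. (x - ?l z) * f x) \<longlongrightarrow> eC (- Im (\<alpha> (matrix_inv (rho S) *v z - z)))) (at (?l z))" .
  qed
  then show ?thesis by blast
qed

definition Phi :: "(complex^'n) set \<times> nat \<Rightarrow> complex \<Rightarrow> complex" where
  "Phi S = (SOME f. is_section S f)"

definition phi :: "(complex^'n) set \<times> nat \<Rightarrow> complex^'n \<Rightarrow> complex" where
  "phi S z = Phi S (pair (ell S) z)"

lemma Phi_section: "S \<in> Sset W \<Gamma> \<Longrightarrow> is_section S (Phi S)"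
  unfolding Phi_def by (rule someI_ex[OF section_exists])

lemma Phi_differentiable: "S \<in> Sset W \<Gamma> \<Longrightarrow> z \<notin> fst S \<Longrightarrow> Phi S field_differentiable at (pair (ell S) z)"
  using Phi_section poles_iff unfolding is_section_def by blast

lemma phi_0: "S \<in> Sset W \<Gamma> \<Longrightarrow> z \<in> fst S \<Longrightarrow> phi S z = 0"
  using Phi_section poles_iff unfolding is_section_def phi_def by blast

lemma phi_qp: "S \<in> Sset W \<Gamma> \<Longrightarrow> \<gamma> \<in> \<Gamma> \<Longrightarrow> phi S (z + \<gamma>) = eC (Im (\<alpha> \<gamma> - \<alpha> (matrix_inv (rho S) *v \<gamma>))) * phi S z"
  using Phi_section unfolding is_section_def phi_def by blast

lemma phi_holo: "S \<in> Sset W \<Gamma> \<Longrightarrow> holo (- fst S) (phi S)"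
  unfolding phi_def[abs_def] by (rule holo_compose_pair) (simp add: Phi_differentiable)

lemma Phi_residue: "S \<in> Sset W \<Gamma> \<Longrightarrow> z \<in> fst S \<Longrightarrow>
   ((\<lambda>x. (x - pair (ell S) z) * Phi S x) \<longlongrightarrow> eC (- Im (\<alpha> (matrix_inv (rho S) *v z - z)))) (at (pair (ell S) z))"
  using Phi_section unfolding is_section_def by blast

text \<open>The clauses of \<open>fsec\<close>, with the iterated inverse rewritten through
  \<open>rho\<close>.\<close>

definition fsec_char :: "(complex^'n) set \<times> nat \<Rightarrow> (complex^'n \<Rightarrow> complex) \<Rightarrow> bool" where
  "fsec_char S \<phi> \<longleftrightarrow> holo (- fst S) \<phi> \<and> (\<forall>z\<in>fst S. \<phi> z = 0) \<and>
     qp \<Gamma> (\<lambda>\<gamma>. \<alpha> \<gamma> - \<alpha> (matrix_inv (rho S) *v \<gamma>)) UNIV \<phi> \<and>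
     (\<forall>z0\<in>fst S. \<exists>\<rho>>0. \<exists>h. holo (ball z0 \<rho>) h \<and>
        (\<forall>z\<in>ball z0 \<rho>. z \<notin> fst S \<longrightarrow> h z = (pair (ell S) z - pair (ell S) z0) * \<phi> z) \<and>
        (\<forall>z\<in>ball z0 \<rho>. pair (ell S) z = pair (ell S) z0 \<longrightarrow>
            h z = eC (- Im (\<alpha> (matrix_inv (rho S) *v z - z)))))"

lemma fsec_unfold:
  assumes "S \<in> Sset W \<Gamma>"
  shows "fsec W \<Gamma> \<alpha> (fst S) (snd S) = (THE F. \<exists>\<phi>. (\<forall>z v. F z v = \<phi> z * pair (ell S) v) \<and> fsec_char S \<phi>)"
  unfolding fsec_def fsec_char_def ell_def[symmetric] ginv_pow_rho[OF assms] ..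

lemma phi_char:
  assumes S: "S \<in> Sset W \<Gamma>"
  shows "fsec_char S (phi S)"
  unfolding fsec_char_def
proof (intro conjI ballI)
  let ?l = "pair (ell S)"
  show "holo (- fst S) (phi S)" by (rule phi_holo[OF S])
  show "phi S z = 0" if "z \<in> fst S" for z by (rule phi_0[OF S that])
  show "qp \<Gamma> (\<lambda>\<gamma>. \<alpha> \<gamma> - \<alpha> (matrix_inv (rho S) *v \<gamma>)) UNIV (phi S)" by (simp add: qp_def phi_qp[OF S])
  fix z0 assume z0: "z0 \<in> fst S"
  define \<epsilon> where "\<epsilon> = eC (- Im (\<alpha> (matrix_inv (rho S) *v z0 - z0)))"
  \<comment> \<open>\<open>G\<close> fills the removable singularity of the product at the isolated
    pole; composed with the form it is the function \<open>h\<close> asked for by the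
    definition.\<close>
  define G where "G = (\<lambda>x. if x = ?l z0 then \<epsilon> else (x - ?l z0) * Phi S x)"
  obtain r where r: "r > 0" "\<And>y. y \<in> poles S \<Longrightarrow> dist y (?l z0) < r \<Longrightarrow> y = ?l z0"
    using poles_no_limpt[OF S] not_islimpt_ball by blast
  have d0: "Phi S field_differentiable at x" if "x \<notin> poles S" for x
    using Phi_section[OF S] that unfolding is_section_def by blast
  have Gd: "G field_differentiable at x" if x: "x \<in> ball (?l z0) r - {?l z0}" for x
  proof -
    have "x \<notin> poles S" using r(2)[of x] x by (auto simp: dist_commute)
    then have "(\<lambda>x. (x - ?l z0) * Phi S x) field_differentiable at x"
      by (intro field_differentiable_mult field_differentiable_diff d0) auto
    then obtain D where D: "((\<lambda>x. (x - ?l z0) * Phi S x) has_field_derivative D) (at x)" by (auto simp: field_differentiable_def)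
    have "\<forall>\<^sub>F y in nhds x. G y = (y - ?l z0) * Phi S y"
      by (rule eventually_mono[OF eventually_nhds_in_open[of "- {?l z0}" x]]) (use x in \<open>auto simp: G_def\<close>)
    then have "(G has_field_derivative D) (at x)"
      using D DERIV_cong_ev[of x x G "\<lambda>x. (x - ?l z0) * Phi S x" D D] by simp
    then show ?thesis by (auto simp: field_differentiable_def)
  qed
  have G0: "isCont G (?l z0)"
  proof -
    have "\<forall>\<^sub>F x in at (?l z0). G x = (x - ?l z0) * Phi S x"
      unfolding eventually_at_filter by (auto simp: G_def)
    then have "(G \<longlongrightarrow> \<epsilon>) (at (?l z0))"
      using Phi_residue[OF S z0] unfolding \<epsilon>_def by (simp add: tendsto_cong)
    then show ?thesis by (simp add: isCont_def G_def)
  qed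
  have "G holomorphic_on ball (?l z0) r"
  proof (rule no_isolated_singularity[where K = "{?l z0}"])
    have "isCont G x" if "x \<in> ball (?l z0) r" for x
      using Gd[of x] G0 that field_differentiable_imp_continuous_at by (cases "x = ?l z0") auto
    then show "continuous_on (ball (?l z0) r) G" by (intro continuous_at_imp_continuous_on) auto
    show "G holomorphic_on ball (?l z0) r - {?l z0}"
      unfolding holomorphic_on_def using Gd field_differentiable_at_within by blast
  qed auto
  then have Gdd: "G field_differentiable at x" if "x \<in> ball (?l z0) r" for x
    using that by (intro holomorphic_on_imp_differentiable_at[of _ "ball (?l z0) r"]) auto
  have "open (?l -` ball (?l z0) r)" by (intro continuous_open_vimage isCont_pair) auto
  moreover have "z0 \<in> ?l -` ball (?l z0) r" using r(1) by simp
  ultimately obtain \<rho> where \<rho>: "\<rho> > 0" "ball z0 \<rho> \<subseteq> ?l -` ball (?l z0) r"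
    using open_contains_ball by blast
  show "\<exists>\<rho>>0. \<exists>h. holo (ball z0 \<rho>) h \<and>
        (\<forall>z\<in>ball z0 \<rho>. z \<notin> fst S \<longrightarrow> h z = (?l z - ?l z0) * phi S z) \<and>
        (\<forall>z\<in>ball z0 \<rho>. ?l z = ?l z0 \<longrightarrow> h z = eC (- Im (\<alpha> (matrix_inv (rho S) *v z - z))))"
  proof (intro exI[of _ \<rho>] conjI exI[of _ "\<lambda>z. G (?l z)"] ballI impI)
    show "holo (ball z0 \<rho>) (\<lambda>z. G (?l z))" using \<rho>(2) by (intro holo_compose_pair Gdd) auto
    fix z assume "z \<in> ball z0 \<rho>"
    show "G (?l z) = (?l z - ?l z0) * phi S z" if "z \<notin> fst S"
    proof -
      have "?l z \<noteq> ?l z0" using that z0 poles_iff[OF S] by metis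
      then show ?thesis by (simp add: G_def phi_def)
    qed
    show "G (?l z) = eC (- Im (\<alpha> (matrix_inv (rho S) *v z - z)))" if "?l z = ?l z0"
    proof -
      \<comment> \<open>The displacement \<open>matrix_inv (rho S) *v z - z\<close> depends only on
        the value of the form, so the residue phase is constant along the hyperplane.\<close>
      obtain e where e: "\<And>v. matrix_inv (rho S) *v v = v + ?l v *s e" using rho_inv_form[OF S] by blast
      then show ?thesis using that by (simp add: G_def \<epsilon>_def)
    qed
  qed (rule \<rho>)
qed

text \<open>The description in \<open>fsec\<close> ranges over all candidates, also those not known
  to factor through the form. Two of them have equal residues, so their difference is residue-free
  along a single family of parallel hyperplanes.\<close>

lemma fsec_char_unique:
  assumes S: "S \<in> Sset W \<Gamma>" and 1: "fsec_char S \<phi>1" and 2: "fsec_char S \<phi>2"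
  shows "\<phi>1 = \<phi>2"
proof
  fix z
  let ?l = "pair (ell S)"
  interpret removable_along_hyperplanes "{()}" "\<lambda>_. ell S" "\<lambda>_. poles S" "fst S" "\<lambda>z. \<phi>1 z - \<phi>2 z"
  proof
    show "fst S = {z. \<exists>i\<in>{()}. ?l z \<in> poles S}" using poles_iff[OF S] by auto
    show "isCont (\<lambda>z. \<phi>1 z - \<phi>2 z) z" if "z \<notin> fst S" for z
      using 1 2 that unfolding fsec_char_def by (intro continuous_diff holo_isCont[of "- fst S"]) auto
    show "(\<lambda>t. \<phi>1 (z + t *s e) - \<phi>2 (z + t *s e)) field_differentiable at 0" if "z \<notin> fst S" for z e
      using holo_line_deriv[of "- fst S" \<phi>1 z 0 e] holo_line_deriv[of "- fst S" \<phi>2 z 0 e] 1 2 that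
      unfolding fsec_char_def by (intro field_differentiable_diff) (auto simp: field_differentiable_def)
    fix z e assume z: "?l z \<in> poles S" and e: "?l e \<noteq> 0"
    have zS: "z \<in> fst S" using z poles_iff[OF S] by simp
    \<comment> \<open>On the line \<open>z + t *s e\<close> the factor by which \<open>h\<close>
      differs from \<open>\<phi>\<close> is \<open>t * pair (ell S) e\<close>, whence the
      denominator in the limit.\<close>
    have lim: "((\<lambda>t. t * \<phi> (z + t *s e)) \<longlongrightarrow> eC (- Im (\<alpha> (matrix_inv (rho S) *v z - z))) / ?l e) (at 0)"
      if \<phi>: "fsec_char S \<phi>" for \<phi>
    proof -
      have "\<exists>\<rho>>0. \<exists>h. holo (ball z \<rho>) h \<and>
        (\<forall>y\<in>ball z \<rho>. y \<notin> fst S \<longrightarrow> h y = (?l y - ?l z) * \<phi> y) \<and>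
        (\<forall>y\<in>ball z \<rho>. ?l y = ?l z \<longrightarrow> h y = eC (- Im (\<alpha> (matrix_inv (rho S) *v y - y))))"
        using \<phi> zS unfolding fsec_char_def by blast
      then obtain \<rho> h where \<rho>: "\<rho> > 0" "holo (ball z \<rho>) h"
        "\<And>y. y \<in> ball z \<rho> \<Longrightarrow> y \<notin> fst S \<Longrightarrow> h y = (?l y - ?l z) * \<phi> y"
        "\<And>y. y \<in> ball z \<rho> \<Longrightarrow> ?l y = ?l z \<Longrightarrow> h y = eC (- Im (\<alpha> (matrix_inv (rho S) *v y - y)))"
        by blast
      have "isCont h (z + 0 *s e)" using \<rho>(1,2) by (intro holo_isCont[of "ball z \<rho>"]) auto
      then have "isCont (\<lambda>t. h (z + t *s e)) 0" by (rule isCont_o2[OF isCont_line])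
      then have "((\<lambda>t. h (z + t *s e) / ?l e) \<longlongrightarrow> h z / ?l e) (at 0)"
        using e by (intro tendsto_divide tendsto_const) (auto simp: isCont_def)
      moreover have "\<forall>\<^sub>F t in at 0. h (z + t *s e) / ?l e = t * \<phi> (z + t *s e)"
      proof -
        have "open ((\<lambda>t::complex. z + t *s e) -` ball z \<rho>)" by (intro continuous_open_vimage isCont_line) auto
        then have "\<forall>\<^sub>F t in at 0. t \<in> (\<lambda>t::complex. z + t *s e) -` ball z \<rho>"
          using \<rho>(1) by (intro eventually_at_in_open') auto
        with eventually_off_hypertorus[OF S e, of z] show ?thesis
        proof eventually_elim
          case (elim t)
          then show ?case using \<rho>(3)[of "z + t *s e"] e by (simp add: pair_add pair_scale)
        qed
      qed
      ultimately show ?thesis using \<rho>(1) \<rho>(4)[of z] by (simp add: tendsto_cong)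
    qed
    have "((\<lambda>t. t * \<phi>1 (z + t *s e) - t * \<phi>2 (z + t *s e)) \<longlongrightarrow>
       eC (- Im (\<alpha> (matrix_inv (rho S) *v z - z))) / ?l e - eC (- Im (\<alpha> (matrix_inv (rho S) *v z - z))) / ?l e) (at 0)"
      by (intro tendsto_diff lim 1 2)
    then show "((\<lambda>t. t * (\<phi>1 (z + t *s e) - \<phi>2 (z + t *s e))) \<longlongrightarrow> 0) (at 0)"
      by (simp add: right_diff_distrib)
  qed (simp_all add: ell_nonzero[OF S] poles_countable[OF S] poles_no_limpt[OF S])
  have q: "\<phi>i (z + \<gamma>) = eC (Im (\<alpha> \<gamma> - \<alpha> (matrix_inv (rho S) *v \<gamma>))) * \<phi>i z" if "fsec_char S \<phi>i" "\<gamma> \<in> \<Gamma>" for \<phi>i z \<gamma>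
    using that unfolding fsec_char_def qp_def by blast
  obtain K where K: "compact K" "\<And>z. \<exists>\<gamma>\<in>\<Gamma>. z + \<gamma> \<in> K" using full_lattice_cocompact[OF lat] by blast
  obtain \<gamma>0 where \<gamma>0: "\<gamma>0 \<in> \<Gamma>" "eC (Im (\<alpha> \<gamma>0 - \<alpha> (matrix_inv (rho S) *v \<gamma>0))) \<noteq> 1"
    using nontrivial_character[OF rho_W[OF S] rho_nontrivial[OF S]] by blast
  show "\<phi>1 z = \<phi>2 z"
  proof (cases "z \<in> fst S")
    case True
    then show ?thesis using 1 2 unfolding fsec_char_def by simp
  next
    case False
    have "\<phi>1 z - \<phi>2 z = 0"
    proof (rule vanishes[OF K _ _ \<gamma>0(1) _ \<gamma>0(2) False])
      show "norm (\<phi>1 (z + \<gamma>) - \<phi>2 (z + \<gamma>)) = norm (\<phi>1 z - \<phi>2 z)" if "\<gamma> \<in> \<Gamma>" for z \<gamma>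
        using q[OF 1 that, of z] q[OF 2 that, of z] by (simp add: right_diff_distrib[symmetric] norm_mult)
      show "z + \<gamma> \<notin> fst S" if "\<gamma> \<in> \<Gamma>" "z \<notin> fst S" for z \<gamma> using hypertorus_\<Gamma>[OF S that(1)] that(2) by simp
      show "\<phi>1 (z + \<gamma>0) - \<phi>2 (z + \<gamma>0) = eC (Im (\<alpha> \<gamma>0 - \<alpha> (matrix_inv (rho S) *v \<gamma>0))) * (\<phi>1 z - \<phi>2 z)" for z
        using q[OF 1 \<gamma>0(1), of z] q[OF 2 \<gamma>0(1), of z] by (simp add: right_diff_distrib)
    qed
    then show ?thesis by simp
  qed
qed

lemma fsec_eq:
  assumes S: "S \<in> Sset W \<Gamma>"
  shows "fsec W \<Gamma> \<alpha> (fst S) (snd S) z v = phi S z * pair (ell S) v"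
proof -
  have "(THE F. \<exists>\<phi>. (\<forall>z v. F z v = \<phi> z * pair (ell S) v) \<and> fsec_char S \<phi>) = (\<lambda>z v. phi S z * pair (ell S) v)"
  proof (rule the_equality)
    show "\<exists>\<phi>. (\<forall>z v. phi S z * pair (ell S) v = \<phi> z * pair (ell S) v) \<and> fsec_char S \<phi>"
      using phi_char[OF S] by blast
    show "F = (\<lambda>z v. phi S z * pair (ell S) v)" if F: "\<exists>\<phi>. (\<forall>z v. F z v = \<phi> z * pair (ell S) v) \<and> fsec_char S \<phi>" for F
    proof -
      obtain \<phi> where \<phi>: "\<And>z v. F z v = \<phi> z * pair (ell S) v" "fsec_char S \<phi>" using F by blast
      have "\<phi> = phi S" by (rule fsec_char_unique[OF S \<phi>(2) phi_char[OF S]])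
      then show ?thesis using \<phi>(1) by (intro ext) simp
    qed
  qed
  then show ?thesis using fsec_unfold[OF S] by simp
qed

end

section \<open>Cancellation of residues\<close>

lemma bounded_linear_matrix: "bounded_linear (\<lambda>z. M *v z)" for M :: "complex^'n^'n"
proof -
  have "linear (\<lambda>z. M *v z)"
    by (rule linearI) (simp add: matrix_vector_right_distrib, simp add: vec_eq_iff matrix_vector_mult_def scaleR_sum_right)
  then show ?thesis by (simp add: linear_conv_bounded_linear)
qed

lemma isCont_matrix: "isCont (\<lambda>z. M *v z) z" for M :: "complex^'n^'n"
  using bounded_linear_matrix by (rule linear_continuous_at)

lemma pair_smult_left: "pair (c *s l) v = c * pair l v"
  by (simp add: pair_def sum_distrib_left mult_ac)

lemma matrix_line: "M *v (z + t *s e) = M *v z + t *s (M *v e)" for M :: "complex^'n^'n"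
  by (simp add: matrix_vector_right_distrib vector_scalar_commute)

context dunkl_setting
begin

abbreviation rinv :: "(complex^'n) set \<times> nat \<Rightarrow> complex^'n \<Rightarrow> complex^'n" where
  "rinv S z \<equiv> matrix_inv (rho S) *v z"

definition pole_locus :: "(complex^'n) set" where
  "pole_locus = (\<Union>S\<in>Sset W \<Gamma>. fst S)"

definition wedge :: "complex^'n \<Rightarrow> complex^'n \<Rightarrow> (complex^'n) set \<times> nat \<Rightarrow> (complex^'n) set \<times> nat \<Rightarrow> complex" where
  "wedge v u S T = pair (ell S) v * pair (ell T) u - pair (ell S) u * pair (ell T) v"

text \<open>The residue of \<open>phi S\<close> with respect to its form, set to 0 off the
  hypertorus so that one formula for products covers all positions of \<open>z\<close>.\<close>

definition res :: "(complex^'n) set \<times> nat \<Rightarrow> complex^'n \<Rightarrow> complex" where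
  "res S z = (if z \<in> fst S then eC (- Im (\<alpha> (rinv S z - z))) else 0)"

lemma pole_locus_inv: "w \<in> W \<Longrightarrow> z \<notin> pole_locus \<Longrightarrow> matrix_inv w *v z \<notin> pole_locus"
  using fst_act_iff act_Sset unfolding pole_locus_def by blast

lemma rho_form:
  assumes "S \<in> Sset W \<Gamma>"
  obtains e where "\<And>v. rho S *v v = v + pair (ell S) v *s e"
  using stabH_ell[OF assms rho_stab[OF assms]] by blast

lemma phi_isCont: "S \<in> Sset W \<Gamma> \<Longrightarrow> z \<notin> fst S \<Longrightarrow> isCont (phi S) z"
  using phi_holo holo_isCont by blast

lemma phi_line_lim:
  assumes "S \<in> Sset W \<Gamma>" "z \<notin> fst S"
  shows "((\<lambda>t. phi S (z + t *s e)) \<longlongrightarrow> phi S z) (at 0)"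
proof -
  have "isCont (phi S) (z + 0 *s e)" using phi_isCont[OF assms] by simp
  then have "isCont (\<lambda>t. phi S (z + t *s e)) 0" by (rule isCont_o2[OF isCont_line])
  then show ?thesis by (simp add: isCont_def)
qed

lemma phi_line_residue:
  assumes S: "S \<in> Sset W \<Gamma>" and e: "z \<in> fst S \<Longrightarrow> pair (ell S) e \<noteq> 0"
  shows "((\<lambda>t. t * phi S (z + t *s e)) \<longlongrightarrow> res S z / pair (ell S) e) (at 0)"
proof (cases "z \<in> fst S")
  case False
  have "((\<lambda>t. t * phi S (z + t *s e)) \<longlongrightarrow> 0 * phi S z) (at 0)"
    by (intro tendsto_mult phi_line_lim[OF S False] tendsto_ident_at)
  then show ?thesis using False by (simp add: res_def)
next
  case True
  let ?l = "pair (ell S)"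
  have le: "?l e \<noteq> 0" by (rule e[OF True])
  have "filterlim (\<lambda>t. ?l z + t * ?l e) (at (?l z)) (at 0)"
    using le by (auto simp: filterlim_at eventually_at_filter intro!: tendsto_eq_intros)
  from filterlim_compose[OF Phi_residue[OF S True] this]
  have "((\<lambda>t. t * ?l e * Phi S (?l z + t * ?l e)) \<longlongrightarrow> res S z) (at 0)"
    using True by (simp add: res_def)
  then have "((\<lambda>t. t * ?l e * Phi S (?l z + t * ?l e) / ?l e) \<longlongrightarrow> res S z / ?l e) (at 0)"
    by (intro tendsto_divide tendsto_const le)
  then show ?thesis using le by (simp add: phi_def pair_add pair_scale)
qed

lemma wedge_parallel_0:
  assumes "\<And>v. pair (ell S) v = a * pair k v" "\<And>v. pair (ell T) v = b * pair k v"
  shows "wedge v u S T = 0"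
  by (simp add: wedge_def assms)

text \<open>\<open>rho S\<close> is the inverse of \<open>rho T\<close>, so both matrices have the
  same rank-one part and the forms are proportional.\<close>

lemma wedge_inverse_0:
  assumes S: "S \<in> Sset W \<Gamma>" and T: "T \<in> Sset W \<Gamma>" and i: "rho S ** rho T = mat 1"
  shows "wedge v u S T = 0"
proof -
  obtain e where e: "\<And>v. rinv T v = v + pair (ell T) v *s e" "e \<noteq> 0" using rho_inv_form[OF T] by blast
  obtain e' where e': "\<And>v. rho S *v v = v + pair (ell S) v *s e'" using rho_form[OF S] by blast
  have "rho S *v v = rinv T v" for v
  proof -
    have "(rho S ** rho T) *v rinv T v = rho S *v v"
      by (simp add: matrix_vector_mul_assoc[symmetric] W_inv_mult[OF rho_W[OF T]])
    then show ?thesis using i by simp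
  qed
  then have eq: "pair (ell S) v *s e' = pair (ell T) v *s e" for v using e(1) e' by (metis add_left_cancel)
  obtain k where k: "e $ k \<noteq> 0" using e(2) by (auto simp: vec_eq_iff)
  have "pair (ell T) v = (e' $ k / e $ k) * pair (ell S) v" for v
    using arg_cong[OF eq[of v], of "\<lambda>x. x $ k"] k by (simp add: field_simps)
  then show ?thesis by (rule wedge_parallel_0[of S 1 "ell S" T, rotated]) simp
qed

text \<open>The coefficient of the group element \<open>w\<close> in the commutator;
  \<open>phi T (rinv S z)\<close> is the second section moved by \<open>rho S\<close>.\<close>

definition comm_coeff :: "((complex^'n) set \<times> nat \<Rightarrow> complex) \<Rightarrow> complex^'n \<Rightarrow> complex^'n \<Rightarrow> complex^'n^'n \<Rightarrow> complex^'n \<Rightarrow> complex" where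
  "comm_coeff C v u w z = (\<Sum>(S,T)\<in>{(S,T)\<in>Sset W \<Gamma> \<times> Sset W \<Gamma>. rho S ** rho T = w}.
     C S * C T * (phi S z * phi T (rinv S z) * wedge v u S T))"

text \<open>The first factor can be singular on \<open>fst S\<close>, the second on
  \<open>fst (act (rho S) T)\<close>. One singular factor gives a simple pole times a continuous
  function; for two, all relevant forms are proportional to \<open>l0\<close> and the wedge is
  zero.\<close>

lemma term_residue:
  assumes S: "S \<in> Sset W \<Gamma>" and T: "T \<in> Sset W \<Gamma>"
    and par: "\<And>k. k \<in> Sset W \<Gamma> \<Longrightarrow> z \<in> fst k \<Longrightarrow> \<exists>c. ell k = c *s l0" and e: "pair l0 e \<noteq> 0"
  shows "((\<lambda>t. t * (phi S (z + t *s e) * phi T (rinv S (z + t *s e)) * wedge v u S T)) \<longlongrightarrow>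
     (res S z / pair (ell S) e * phi T (rinv S z) + phi S z * (res T (rinv S z) / pair (ell T) (rinv S e))) * wedge v u S T) (at 0)"
proof -
  note r = rho_W[OF S]
  let ?T' = "act (rho S) T"
  have T': "?T' \<in> Sset W \<Gamma>" by (rule act_Sset[OF r T])
  have T'iff: "z \<in> fst ?T' \<longleftrightarrow> rinv S z \<in> fst T" by (rule fst_act_iff[OF r])
  obtain c where c: "c \<noteq> 0" "\<And>v. pair (ell ?T') (rho S *v v) = c * pair (ell T) v"
    using ell_act[OF r T] by blast
  have active: "pair (ell k) e \<noteq> 0" if k: "k \<in> Sset W \<Gamma>" "z \<in> fst k" for k
  proof -
    obtain b where b: "ell k = b *s l0" using par[OF k] by blast
    have "b \<noteq> 0" using b ell_nonzero[OF k(1)] by auto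
    then show ?thesis using e by (simp add: b pair_smult_left)
  qed
  have aT: "pair (ell T) (rinv S e) \<noteq> 0" if "rinv S z \<in> fst T"
  proof -
    have "pair (ell ?T') e \<noteq> 0" using active[OF T'] that T'iff by blast
    moreover have "pair (ell ?T') e = c * pair (ell T) (rinv S e)"
      using c(2)[of "rinv S e"] by (simp add: W_inv_mult[OF r])
    ultimately show ?thesis by auto
  qed
  have l1: "((\<lambda>t. t * phi S (z + t *s e)) \<longlongrightarrow> res S z / pair (ell S) e) (at 0)"
    by (rule phi_line_residue[OF S]) (rule active[OF S])
  have l2: "((\<lambda>t. t * phi T (rinv S (z + t *s e))) \<longlongrightarrow> res T (rinv S z) / pair (ell T) (rinv S e)) (at 0)"
    unfolding matrix_line by (rule phi_line_residue[OF T]) (rule aT)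
  show ?thesis
  proof (cases "rinv S z \<in> fst T")
    case False
    have "((\<lambda>t. (t * phi S (z + t *s e)) * phi T (rinv S (z + t *s e)) * wedge v u S T) \<longlongrightarrow>
       (res S z / pair (ell S) e) * phi T (rinv S z) * wedge v u S T) (at 0)"
      unfolding matrix_line by (intro tendsto_mult l1 phi_line_lim[OF T False] tendsto_const)
    then show ?thesis using False by (simp add: res_def[of T] mult.assoc)
  next
    case True
    show ?thesis
    proof (cases "z \<in> fst S")
      case zS: False
      have "((\<lambda>t. phi S (z + t *s e) * (t * phi T (rinv S (z + t *s e))) * wedge v u S T) \<longlongrightarrow>
         phi S z * (res T (rinv S z) / pair (ell T) (rinv S e)) * wedge v u S T) (at 0)"
        by (intro tendsto_mult l2 phi_line_lim[OF S zS] tendsto_const)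
      then show ?thesis using zS by (simp add: res_def[of S] mult_ac)
    next
      case zS: True
      obtain b1 where b1: "ell S = b1 *s l0" using par[OF S zS] by blast
      obtain b2 where b2: "ell ?T' = b2 *s l0" using par[OF T'] True T'iff by blast
      obtain e' where e': "\<And>v. rho S *v v = v + pair (ell S) v *s e'" using rho_form[OF S] by blast
      \<comment> \<open>Up to \<open>c\<close>, \<open>ell T\<close> is the form of
        \<open>act (rho S) T\<close> composed with \<open>rho S\<close>, and \<open>rho S\<close>
        changes \<open>l0\<close> only by a multiple of \<open>ell S\<close>, itself a multiple of
        \<open>l0\<close>.\<close>
      have "pair (ell T) v = (b2 * (1 + b1 * pair l0 e') / c) * pair l0 v" for v
        using c(2)[of v] c(1) by (simp add: e' b2 b1 pair_smult_left pair_add pair_scale field_simps)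
      then have "wedge v u S T = 0" by (rule wedge_parallel_0[of S b1 l0 T, rotated]) (simp add: b1 pair_smult_left)
      then show ?thesis by simp
    qed
  qed
qed

text \<open>The bijection \<open>(S, T) \<mapsto> (T, g\<^sub>T\<^sup>-\<^sup>1 S)\<close> preserves the product \<open>g\<^sub>S g\<^sub>T\<close> and exchanges the two ways in
  which a product can be singular along a hypertorus through \<open>z\<close>.\<close>
lemma residue_cancel:
  assumes S: "S \<in> Sset W \<Gamma>" and T: "T \<in> Sset W \<Gamma>" and S': "S' = act (matrix_inv (rho T)) S"
  shows "phi T z * (res S' (rinv T z) / pair (ell S') (rinv T e)) * wedge v u T S' =
     - (res S z / pair (ell S) e * phi T (rinv S z) * wedge v u S T)"
proof -
  note rT = rho_W[OF T] and rS = rho_W[OF S]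
  note iT = W_inv[OF rT]
  have S'S: "S' \<in> Sset W \<Gamma>" unfolding S' by (rule act_Sset[OF iT S])
  have mem: "rinv T z \<in> fst S' \<longleftrightarrow> z \<in> fst S"
    unfolding S' by (simp add: fst_act_iff[OF iT] W_inv_inv[OF rT] W_inv_mult[OF rT])
  show ?thesis
  proof (cases "z \<in> fst S")
    case False
    then show ?thesis using mem by (simp add: res_def)
  next
    case True
    define \<gamma> where "\<gamma> = rinv S z - z"
    have \<gamma>: "\<gamma> \<in> \<Gamma>" unfolding \<gamma>_def by (rule rho_inv_stab[OF S True])
    have Sz: "rinv S z = z + \<gamma>" by (simp add: \<gamma>_def)
    \<comment> \<open>Quasi-periodicity contributes the phase of \<open>\<alpha> \<gamma>\<close>,
      which the residue of \<open>S\<close> cancels; what remains is the phase that the residue of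
      \<open>S'\<close> turns out to have.\<close>
    have "phi T (rinv S z) = eC (Im (\<alpha> \<gamma> - \<alpha> (rinv T \<gamma>))) * phi T z" unfolding Sz by (rule phi_qp[OF T \<gamma>])
    moreover have "res S z = eC (- Im (\<alpha> \<gamma>))" using True by (simp add: res_def \<gamma>_def)
    ultimately have 1: "res S z * phi T (rinv S z) = eC (- Im (\<alpha> (rinv T \<gamma>))) * phi T z"
      by (simp add: mult.assoc[symmetric] eC_add[symmetric])
    have "rho S' *v (rinv T (rinv S z)) = rinv T z"
      unfolding S' rho_act[OF iT S] conj_apply by (simp add: W_inv_inv[OF rT] W_inv_mult[OF rT] W_inv_mult[OF rS])
    then have "rinv S' (rinv T z) = rinv T (rinv S z)"
      by (intro matrix_inv_unique_vector W_invertible rho_W S'S)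
    then have "rinv S' (rinv T z) - rinv T z = rinv T \<gamma>"
      by (simp add: \<gamma>_def matrix_vector_mult_diff_distrib)
    then have 2: "res S' (rinv T z) = eC (- Im (\<alpha> (rinv T \<gamma>)))" using True mem by (simp add: res_def)
    obtain c where c: "c \<noteq> 0" "\<And>v. pair (ell S') (rinv T v) = c * pair (ell S) v"
      using ell_act[OF iT S] unfolding S' by blast
    obtain e' where e': "\<And>v. rho T *v v = v + pair (ell T) v *s e'" using rho_form[OF T] by blast
    have lS': "pair (ell S') v = c * (pair (ell S) v + pair (ell T) v * pair (ell S) e')" for v
      using c(2)[of "rho T *v v"] unfolding W_inv_mult(2)[OF rT] by (simp add: e' pair_add pair_scale)
    \<comment> \<open>Up to \<open>c\<close> the form of \<open>S'\<close> is that of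
      \<open>S\<close> plus a multiple of that of \<open>T\<close>. The multiple disappears in the
      wedge, exchanging the two forms gives the sign, and \<open>c\<close> cancels against the
      denominator.\<close>
    have 3: "wedge v u T S' = - c * wedge v u S T"
      unfolding wedge_def lS' by (simp add: algebra_simps)
    have "phi T z * (res S' (rinv T z) / pair (ell S') (rinv T e)) * wedge v u T S'
        = - (eC (- Im (\<alpha> (rinv T \<gamma>))) * phi T z) / pair (ell S) e * wedge v u S T"
      using c(1) by (simp add: 2 3 c(2))
    also have "\<dots> = - (res S z / pair (ell S) e * phi T (rinv S z) * wedge v u S T)"
      by (simp add: 1[symmetric])
    finally show ?thesis .
  qed
qed

lemma comm_coeff_vanishes:
  assumes fin: "finite (Sset W \<Gamma>)" and Cinv: "\<And>w S. w \<in> W \<Longrightarrow> S \<in> Sset W \<Gamma> \<Longrightarrow> C (act w S) = C S"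
    and w: "w \<in> W" and z: "z \<notin> pole_locus"
  shows "comm_coeff C v u w z = 0"
proof (cases "w = mat 1")
  case True
  then show ?thesis unfolding comm_coeff_def by (intro sum.neutral) (auto simp: wedge_inverse_0)
next
  case False
  define Q where "Q = {(S,T)\<in>Sset W \<Gamma> \<times> Sset W \<Gamma>. rho S ** rho T = w}"
  have Qfin: "finite Q" by (rule finite_subset[of _ "Sset W \<Gamma> \<times> Sset W \<Gamma>"]) (auto simp: Q_def fin)
  have comm_coeff: "comm_coeff C v u w = (\<lambda>z. \<Sum>x\<in>Q. C (fst x) * C (snd x) * (phi (fst x) z * phi (snd x) (rinv (fst x) z) * wedge v u (fst x) (snd x)))"
    by (simp add: comm_coeff_def Q_def fun_eq_iff case_prod_unfold)
  have Q: "fst x \<in> Sset W \<Gamma>" "snd x \<in> Sset W \<Gamma>" "rho (fst x) ** rho (snd x) = w" if "x \<in> Q" for x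
    using that by (auto simp: Q_def)
  have off: "z \<notin> fst S" if "z \<notin> pole_locus" "S \<in> Sset W \<Gamma>" for z S using that by (auto simp: pole_locus_def)
  have off': "rinv S z \<notin> fst T" if "z \<notin> pole_locus" "S \<in> Sset W \<Gamma>" "T \<in> Sset W \<Gamma>" for z S T
    using pole_locus_inv[OF rho_W[OF that(2)] that(1)] that(3) by (auto simp: pole_locus_def)
  interpret removable_along_hyperplanes "Sset W \<Gamma>" ell poles pole_locus "comm_coeff C v u w"
  proof
    show "pole_locus = {z. \<exists>i\<in>Sset W \<Gamma>. pair (ell i) z \<in> poles i}" unfolding pole_locus_def using poles_iff by auto
    show "isCont (comm_coeff C v u w) z" if z: "z \<notin> pole_locus" for z
      unfolding comm_coeff
    proof (intro continuous_sum continuous_mult continuous_const)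
      fix x assume x: "x \<in> Q"
      show "isCont (phi (fst x)) z" by (intro phi_isCont Q[OF x] off[OF z])
      show "isCont (\<lambda>z. phi (snd x) (rinv (fst x) z)) z"
        by (rule isCont_o2[OF isCont_matrix]) (intro phi_isCont Q[OF x] off'[OF z])
    qed
    show "(\<lambda>t. comm_coeff C v u w (z + t *s e)) field_differentiable at 0" if z: "z \<notin> pole_locus" for z e
      unfolding comm_coeff
    proof (intro field_differentiable_sum field_differentiable_mult field_differentiable_const)
      fix x assume x: "x \<in> Q"
      show "(\<lambda>t. phi (fst x) (z + t *s e)) field_differentiable at 0"
        using holo_line_deriv[OF phi_holo[OF Q(1)[OF x]], of z 0 e] off[OF z Q(1)[OF x]]
        by (auto simp: field_differentiable_def)
      show "(\<lambda>t. phi (snd x) (rinv (fst x) (z + t *s e))) field_differentiable at 0"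
        unfolding matrix_line
        using holo_line_deriv[OF phi_holo[OF Q(2)[OF x]], of "rinv (fst x) z" 0 "rinv (fst x) e"] off'[OF z Q(1,2)[OF x]]
        by (auto simp: field_differentiable_def)
    qed
    fix z e i assume i: "i \<in> Sset W \<Gamma>" "pair (ell i) z \<in> poles i"
      and par: "\<And>k. k \<in> Sset W \<Gamma> \<Longrightarrow> pair (ell k) z \<in> poles k \<Longrightarrow> \<exists>c. ell k = c *s ell i"
      and e: "pair (ell i) e \<noteq> 0"
    have par': "\<exists>c. ell k = c *s ell i" if "k \<in> Sset W \<Gamma>" "z \<in> fst k" for k
      using par that poles_iff by blast
    define L1 where "L1 = (\<lambda>x. res (fst x) z / pair (ell (fst x)) e * phi (snd x) (rinv (fst x) z) * wedge v u (fst x) (snd x))"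
    define L2 where "L2 = (\<lambda>x. phi (fst x) z * (res (snd x) (rinv (fst x) z) / pair (ell (snd x)) (rinv (fst x) e)) * wedge v u (fst x) (snd x))"
    define CC where "CC = (\<lambda>x. C (fst x) * C (snd x))"
    have "((\<lambda>t. \<Sum>x\<in>Q. CC x * (t * (phi (fst x) (z + t *s e) * phi (snd x) (rinv (fst x) (z + t *s e)) * wedge v u (fst x) (snd x))))
       \<longlongrightarrow> (\<Sum>x\<in>Q. CC x * (L1 x + L2 x))) (at 0)"
    proof (intro tendsto_sum tendsto_mult tendsto_const)
      fix x assume x: "x \<in> Q"
      from term_residue[OF Q(1,2)[OF x] par' e]
      show "((\<lambda>t. t * (phi (fst x) (z + t *s e) * phi (snd x) (rinv (fst x) (z + t *s e)) * wedge v u (fst x) (snd x))) \<longlongrightarrow> L1 x + L2 x) (at 0)"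
        unfolding L1_def L2_def by (simp only: distrib_right)
    qed
    moreover have "(\<Sum>x\<in>Q. CC x * (L1 x + L2 x)) = 0"
    proof -
      \<comment> \<open>The residue from the second factor of \<open>(T, S')\<close> is matched with
        that from the first factor of \<open>(act (rho T) S', T)\<close>. Invariance of
        \<open>C\<close> makes the weights equal, and conjugation keeps the pair in
        \<open>Q\<close>.\<close>
      have "(\<Sum>x\<in>Q. CC x * L2 x) = (\<Sum>x\<in>Q. - (CC x * L1 x))"
      proof (rule sum.reindex_bij_witness[where j = "\<lambda>(T,S'). (act (rho T) S', T)" and i = "\<lambda>(S,T). (T, act (matrix_inv (rho T)) S)"])
        fix x assume x: "x \<in> Q"
        obtain T S' where xx: "x = (T, S')" by (cases x)
        have T: "T \<in> Sset W \<Gamma>" and S': "S' \<in> Sset W \<Gamma>" and p: "rho T ** rho S' = w" using x by (auto simp: xx Q_def)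
        note rT = rho_W[OF T]
        let ?S = "act (rho T) S'"
        have S: "?S \<in> Sset W \<Gamma>" by (rule act_Sset[OF rT S'])
        have S'eq: "S' = act (matrix_inv (rho T)) ?S" by (simp add: act_inv[OF rT])
        show "(case case x of (T, S') \<Rightarrow> (act (rho T) S', T) of (S, T) \<Rightarrow> (T, act (matrix_inv (rho T)) S)) = x"
          by (simp add: xx act_inv[OF rT])
        have "rho ?S ** rho T = rho T ** rho S' ** (matrix_inv (rho T) ** rho T)"
          unfolding rho_act[OF rT S'] by (simp only: matrix_mul_assoc)
        then have "rho ?S ** rho T = w" by (simp add: W_inv_mat[OF rT] p)
        then show "(case x of (T, S') \<Rightarrow> (act (rho T) S', T)) \<in> Q" using S T by (simp add: xx Q_def)
        have "C ?S = C S'" by (rule Cinv[OF rT S'])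
        then show "- (CC (case x of (T, S') \<Rightarrow> (act (rho T) S', T)) * L1 (case x of (T, S') \<Rightarrow> (act (rho T) S', T))) = CC x * L2 x"
          using residue_cancel[OF S T S'eq, of z e v u] by (simp add: xx L1_def L2_def CC_def)
      next
        fix x assume x: "x \<in> Q"
        obtain S T where xx: "x = (S, T)" by (cases x)
        have S: "S \<in> Sset W \<Gamma>" and T: "T \<in> Sset W \<Gamma>" and p: "rho S ** rho T = w" using x by (auto simp: xx Q_def)
        note rT = rho_W[OF T]
        show "(case case x of (S, T) \<Rightarrow> (T, act (matrix_inv (rho T)) S) of (T, S') \<Rightarrow> (act (rho T) S', T)) = x"
          by (simp add: xx act_inv[OF rT])
        have "rho T ** rho (act (matrix_inv (rho T)) S) = (rho T ** matrix_inv (rho T)) ** rho S ** rho T"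
          unfolding rho_act[OF W_inv[OF rT] S] W_inv_inv[OF rT] by (simp only: matrix_mul_assoc)
        then have "rho T ** rho (act (matrix_inv (rho T)) S) = w" by (simp add: W_inv_mat[OF rT] p)
        then show "(case x of (S, T) \<Rightarrow> (T, act (matrix_inv (rho T)) S)) \<in> Q"
          using T act_Sset[OF W_inv[OF rT] S] by (simp add: xx Q_def)
      qed
      then show ?thesis by (simp add: distrib_left sum.distrib sum_negf)
    qed
    ultimately show "((\<lambda>t. t * comm_coeff C v u w (z + t *s e)) \<longlongrightarrow> 0) (at 0)"
      unfolding comm_coeff CC_def by (simp add: sum_distrib_left mult_ac)
  qed (simp_all add: fin ell_nonzero poles_countable poles_no_limpt)
  \<comment> \<open>The two multipliers telescope: \<open>rinv S \<gamma>\<close> enters with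
    opposite signs, and \<open>rinv T (rinv S \<gamma>)\<close> is the image of
    \<open>\<gamma>\<close> under the inverse of \<open>w\<close>, so all summands share one
    multiplier.\<close>
  have q: "comm_coeff C v u w (z + \<gamma>) = eC (Im (\<alpha> \<gamma> - \<alpha> (matrix_inv w *v \<gamma>))) * comm_coeff C v u w z" if \<gamma>: "\<gamma> \<in> \<Gamma>" for z \<gamma>
    unfolding comm_coeff sum_distrib_left
  proof (rule sum.cong[OF refl])
    fix x assume x: "x \<in> Q"
    obtain S T where xx: "x = (S, T)" by (cases x)
    have S: "S \<in> Sset W \<Gamma>" and T: "T \<in> Sset W \<Gamma>" and p: "rho S ** rho T = w" using x by (auto simp: xx Q_def)
    have g: "rinv S \<gamma> \<in> \<Gamma>" by (intro inv\<Gamma> W_inv rho_W S \<gamma>)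
    have "w *v (rinv T (rinv S \<gamma>)) = \<gamma>"
      by (simp add: p[symmetric] matrix_vector_mul_assoc[symmetric] W_inv_mult[OF rho_W[OF T]] W_inv_mult[OF rho_W[OF S]])
    then have wi: "matrix_inv w *v \<gamma> = rinv T (rinv S \<gamma>)" by (intro matrix_inv_unique_vector W_invertible w)
    have pT: "phi T (rinv S (z + \<gamma>)) = eC (Im (\<alpha> (rinv S \<gamma>) - \<alpha> (rinv T (rinv S \<gamma>)))) * phi T (rinv S z)"
      using phi_qp[OF T g, of "rinv S z"] by (simp add: matrix_vector_right_distrib)
    have ee: "eC (Im (\<alpha> \<gamma> - \<alpha> (rinv S \<gamma>))) * eC (Im (\<alpha> (rinv S \<gamma>) - \<alpha> (rinv T (rinv S \<gamma>)))) =
       eC (Im (\<alpha> \<gamma> - \<alpha> (matrix_inv w *v \<gamma>)))" by (simp add: wi eC_add[symmetric])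
    have "phi S (z + \<gamma>) * phi T (rinv S (z + \<gamma>)) = eC (Im (\<alpha> \<gamma> - \<alpha> (matrix_inv w *v \<gamma>))) * (phi S z * phi T (rinv S z))"
      unfolding ee[symmetric] pT phi_qp[OF S \<gamma>, of z] by (simp only: mult_ac)
    then show "C (fst x) * C (snd x) * (phi (fst x) (z + \<gamma>) * phi (snd x) (rinv (fst x) (z + \<gamma>)) * wedge v u (fst x) (snd x)) =
      eC (Im (\<alpha> \<gamma> - \<alpha> (matrix_inv w *v \<gamma>))) * (C (fst x) * C (snd x) * (phi (fst x) z * phi (snd x) (rinv (fst x) z) * wedge v u (fst x) (snd x)))"
      by (simp add: xx mult_ac)
  qed
  obtain K where K: "compact K" "\<And>z. \<exists>\<gamma>\<in>\<Gamma>. z + \<gamma> \<in> K" using full_lattice_cocompact[OF lat] by blast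
  obtain \<gamma>0 where \<gamma>0: "\<gamma>0 \<in> \<Gamma>" "eC (Im (\<alpha> \<gamma>0 - \<alpha> (matrix_inv w *v \<gamma>0))) \<noteq> 1"
    using nontrivial_character[OF w False] by blast
  show ?thesis
  proof (rule vanishes[OF K _ _ \<gamma>0(1) q[OF \<gamma>0(1)] \<gamma>0(2) z])
    show "norm (comm_coeff C v u w (z + \<gamma>)) = norm (comm_coeff C v u w z)" if "\<gamma> \<in> \<Gamma>" for z \<gamma>
      by (simp add: q[OF that] norm_mult)
    show "z + \<gamma> \<notin> pole_locus" if "\<gamma> \<in> \<Gamma>" "z \<notin> pole_locus" for z \<gamma>
      using that hypertorus_\<Gamma> by (auto simp: pole_locus_def)
  qed
qed

end

section \<open>Commutativity\<close>

text \<open>Bounded by periodicity, the form is constant on the line from 0 to \<open>z\<close>. In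
  the commutator this makes it take the same value at \<open>z\<close> and at
  \<open>rinv S z\<close>, so that its mixed terms with the sections are symmetric in
  \<open>u\<close> and \<open>v\<close>.\<close>

lemma flat_hol_conn_constant:
  assumes L: "full_lattice \<Gamma>" and A: "flat_hol_conn \<Gamma> A"
  shows "A z v = A 0 v"
proof -
  define f where "f = (\<lambda>z. A z v)"
  have f: "holo UNIV f" "\<And>z \<gamma>. \<gamma> \<in> \<Gamma> \<Longrightarrow> f (z + \<gamma>) = f z"
    using A unfolding flat_hol_conn_def f_def by blast+
  obtain K where K: "compact K" "\<And>z. \<exists>\<gamma>\<in>\<Gamma>. z + \<gamma> \<in> K" using full_lattice_cocompact[OF L] by blast
  have "compact (f ` K)"
    using f(1) by (intro compact_continuous_image K(1) continuous_at_imp_continuous_on ballI holo_isCont[of UNIV]) auto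
  then obtain M where M: "\<And>x. x \<in> K \<Longrightarrow> norm (f x) \<le> M"
    using compact_imp_bounded bounded_iff by (metis image_eqI)
  have B: "norm (f x) \<le> M" for x using K(2)[of x] M f(2) by metis
  define g where "g = (\<lambda>t. f (0 + t *s z))"
  have "g holomorphic_on UNIV"
    unfolding holomorphic_on_def field_differentiable_def g_def using holo_line_deriv[OF f(1), of 0 _ z] by blast
  moreover have "bounded (range g)" using B by (auto simp: bounded_iff g_def)
  ultimately have "g constant_on UNIV" by (rule Liouville_theorem)
  then have "g 1 = g 0" by (auto simp: constant_on_def)
  then show ?thesis by (simp add: g_def f_def)
qed

section \<open>Points near which a meromorphic section is holomorphic\<close>

definition holo_locus :: "(complex^'n \<Rightarrow> complex) \<Rightarrow> (complex^'n) set" where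
  "holo_locus s = {z. \<exists>r>0. holo (ball z r) s}"

lemma holo_locus_iff: "z \<in> holo_locus s \<longleftrightarrow> (\<exists>X. open X \<and> z \<in> X \<and> holo X s)"
proof
  assume "\<exists>X. open X \<and> z \<in> X \<and> holo X s"
  then obtain X r where "holo X s" "r > 0" "ball z r \<subseteq> X" using open_contains_ball by metis
  then have "holo (ball z r) s" using holo_subset by blast
  then show "z \<in> holo_locus s" using \<open>r > 0\<close> by (auto simp: holo_locus_def)
next
  assume "z \<in> holo_locus s"
  then obtain r where "r > 0" "holo (ball z r) s" by (auto simp: holo_locus_def)
  then show "\<exists>X. open X \<and> z \<in> X \<and> holo X s" by (intro exI[of _ "ball z r"]) auto
qed

lemma open_holo_locus: "open (holo_locus s)"
proof (subst open_subopen, intro ballI)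
  fix z assume "z \<in> holo_locus s"
  then obtain X where X: "open X" "z \<in> X" "holo X s" using holo_locus_iff by blast
  then have "X \<subseteq> holo_locus s" using holo_locus_iff by blast
  then show "\<exists>T. open T \<and> z \<in> T \<and> T \<subseteq> holo_locus s" using X by blast
qed

lemma holo_holo_locus: "holo (holo_locus s) s"
  unfolding holo_def
proof
  fix z assume "z \<in> holo_locus s"
  then obtain X where "z \<in> X" "holo X s" using holo_locus_iff by blast
  then show "\<exists>D. (s has_derivative D) (at z) \<and> (\<forall>c v. D (c *s v) = c * D v)"
    unfolding holo_def by blast
qed

text \<open>\<open>meromorphic\<close> prescribes \<open>s\<close> only where the denominator is
  nonzero; there it is a quotient of holomorphic functions, and the identity theorem makes such
  points dense.\<close>

lemma holo_locus_dense:
  assumes m: "meromorphic U s" and B: "open B" "B \<subseteq> U" "B \<noteq> {}"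
  shows "B \<inter> holo_locus s \<noteq> {}"
proof -
  obtain z0 where z0: "z0 \<in> B" using B by blast
  then have "z0 \<in> U" using B(2) by blast
  then have "\<exists>r>0. \<exists>g h. holo (ball z0 r) g \<and> holo (ball z0 r) h \<and>
     (\<exists>z\<in>ball z0 r. h z \<noteq> 0) \<and> (\<forall>z\<in>ball z0 r. h z \<noteq> 0 \<longrightarrow> s z = g z / h z)"
    using m unfolding meromorphic_def by blast
  then obtain r g h where r: "r > 0" and g: "holo (ball z0 r) g" and h: "holo (ball z0 r) h" "\<exists>z\<in>ball z0 r. h z \<noteq> 0"
    and s: "\<And>z. z \<in> ball z0 r \<Longrightarrow> h z \<noteq> 0 \<Longrightarrow> s z = g z / h z"
    by blast
  have "B \<inter> ball z0 r \<noteq> {}" using z0 r by auto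
  from holo_nonzero_dense[OF h B(1) this] obtain z where z: "z \<in> B" "z \<in> ball z0 r" "h z \<noteq> 0" by blast
  define X where "X = {x \<in> ball z0 r. h x \<noteq> 0}"
  have "continuous_on (ball z0 r) h" using h(1) by (intro continuous_at_imp_continuous_on ballI holo_isCont)
  then have "open (ball z0 r \<inter> h -` (- {0}))" by (intro continuous_open_preimage) auto
  moreover have "ball z0 r \<inter> h -` (- {0}) = X" by (auto simp: X_def)
  ultimately have X: "open X" by simp
  have "holo X s"
    unfolding holo_def
  proof
    fix x assume x: "x \<in> X"
    then have xb: "x \<in> ball z0 r" "h x \<noteq> 0" by (auto simp: X_def)
    note gd = holo_has_derivative[OF g xb(1)] and hd = holo_has_derivative[OF h(1) xb(1)]
    let ?D = "\<lambda>v. (dd v g x * h x - g x * dd v h x) / (h x * h x)"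
    have "((\<lambda>x. g x / h x) has_derivative ?D) (at x)"
      by (rule has_derivative_divide'[OF gd(1) hd(1) xb(2)])
    then have "(s has_derivative ?D) (at x)"
      using X x by (rule has_derivative_transform_within_open) (auto simp: X_def s)
    moreover have "?D (c *s v) = c * ?D v" for c v
      by (simp add: gd(2) hd(2) field_simps)
    ultimately show "\<exists>D. (s has_derivative D) (at x) \<and> (\<forall>c v. D (c *s v) = c * D v)" by blast
  qed
  then have "z \<in> holo_locus s" using X z holo_locus_iff by (auto simp: X_def)
  then show ?thesis using z(1) by blast
qed

section \<open>The composition of two Dunkl operators\<close>

context dunkl_setting
begin

lemma dunkl_eq:
  assumes "\<And>f :: _ \<Rightarrow> complex. sum f (Sset W \<Gamma>) = sum f S0" "S0 \<subseteq> Sset W \<Gamma>"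
  shows "dunkl W \<Gamma> \<alpha> A C v s z = dd v s z + A z v * s z - (\<Sum>S\<in>S0. C S * (phi S z * pair (ell S) v) * s (rinv S z))"
proof -
  have "(\<Sum>(Ht, j)\<in>Sset W \<Gamma>. C (Ht, j) * fsec W \<Gamma> \<alpha> Ht j z v * s (ginv_pow (gH W \<Gamma> Ht) j z))
      = (\<Sum>S\<in>S0. C S * fsec W \<Gamma> \<alpha> (fst S) (snd S) z v * s (ginv_pow (gH W \<Gamma> (fst S)) (snd S) z))"
    by (simp add: case_prod_unfold assms(1))
  also have "\<dots> = (\<Sum>S\<in>S0. C S * (phi S z * pair (ell S) v) * s (rinv S z))"
  proof (rule sum.cong[OF refl])
    fix S assume "S \<in> S0"
    then have S: "S \<in> Sset W \<Gamma>" using assms(2) by blast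
    show "C S * fsec W \<Gamma> \<alpha> (fst S) (snd S) z v * s (ginv_pow (gH W \<Gamma> (fst S)) (snd S) z) =
       C S * (phi S z * pair (ell S) v) * s (rinv S z)" by (simp only: fsec_eq[OF S] ginv_pow_rho[OF S])
  qed
  finally show ?thesis by (simp add: dunkl_def)
qed

text \<open>The derivative in direction \<open>v\<close> is a multiple of
  \<open>pair (ell S) v\<close>, so after pairing the section with \<open>u\<close> it is symmetric
  in both directions.\<close>

lemma phi_line_deriv:
  assumes S: "S \<in> Sset W \<Gamma>" and z: "z \<notin> fst S"
  shows "((\<lambda>t. phi S (z + t *s v)) has_field_derivative deriv (Phi S) (pair (ell S) z) * pair (ell S) v) (at 0)"
proof -
  let ?l = "pair (ell S)"
  have "(Phi S has_field_derivative deriv (Phi S) (?l z)) (at (?l z + 0 * ?l v))"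
    using Phi_differentiable[OF S z] by (simp add: DERIV_deriv_iff_field_differentiable)
  moreover have "((\<lambda>t. ?l z + t * ?l v) has_field_derivative ?l v) (at 0)"
    by (auto intro!: derivative_eq_intros)
  ultimately have "((\<lambda>t. Phi S (?l z + t * ?l v)) has_field_derivative deriv (Phi S) (?l z) * ?l v) (at 0)"
    by (rule DERIV_chain2)
  then show ?thesis by (simp add: phi_def pair_add pair_scale)
qed

text \<open>All pairs with product \<open>w\<close> move \<open>s\<close> to the same point, so its
  value factors out and leaves \<open>comm_coeff\<close>.\<close>

lemma double_sum_vanishes:
  assumes fin: "finite (Sset W \<Gamma>)" and Cinv: "\<And>w S. w \<in> W \<Longrightarrow> S \<in> Sset W \<Gamma> \<Longrightarrow> C (act w S) = C S"
    and z: "z \<notin> pole_locus"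
  shows "(\<Sum>S\<in>Sset W \<Gamma>. \<Sum>T\<in>Sset W \<Gamma>. C S * C T * (phi S z * phi T (rinv S z) * wedge v u S T) * s (rinv T (rinv S z))) = 0"
proof -
  define g where "g = (\<lambda>(S,T). C S * C T * (phi S z * phi T (rinv S z) * wedge v u S T) * s (rinv T (rinv S z)))"
  have "(\<Sum>S\<in>Sset W \<Gamma>. \<Sum>T\<in>Sset W \<Gamma>. C S * C T * (phi S z * phi T (rinv S z) * wedge v u S T) * s (rinv T (rinv S z)))
     = sum g (Sset W \<Gamma> \<times> Sset W \<Gamma>)" by (simp add: sum.cartesian_product g_def)
  also have "\<dots> = (\<Sum>w\<in>W. sum g {x \<in> Sset W \<Gamma> \<times> Sset W \<Gamma>. rho (fst x) ** rho (snd x) = w})"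
    using fin W_fin by (intro sum.group[symmetric]) (auto intro!: W_mult rho_W)
  also have "\<dots> = (\<Sum>w\<in>W. comm_coeff C v u w z * s (matrix_inv w *v z))"
  proof (rule sum.cong[OF refl])
    fix w assume w: "w \<in> W"
    have "sum g {x \<in> Sset W \<Gamma> \<times> Sset W \<Gamma>. rho (fst x) ** rho (snd x) = w} =
      (\<Sum>(S,T)\<in>{(S,T)\<in>Sset W \<Gamma> \<times> Sset W \<Gamma>. rho S ** rho T = w}.
        C S * C T * (phi S z * phi T (rinv S z) * wedge v u S T) * s (matrix_inv w *v z))"
    proof (rule sum.cong)
      fix x assume "x \<in> {(S,T)\<in>Sset W \<Gamma> \<times> Sset W \<Gamma>. rho S ** rho T = w}"
      then obtain S T where x: "x = (S,T)" and S: "S \<in> Sset W \<Gamma>" and T: "T \<in> Sset W \<Gamma>" and p: "rho S ** rho T = w" by auto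
      have "w *v (rinv T (rinv S z)) = z"
        by (simp add: p[symmetric] matrix_vector_mul_assoc[symmetric] W_inv_mult[OF rho_W[OF T]] W_inv_mult[OF rho_W[OF S]])
      then have "matrix_inv w *v z = rinv T (rinv S z)" by (intro matrix_inv_unique_vector W_invertible w)
      then show "g x = (case x of (S,T) \<Rightarrow> C S * C T * (phi S z * phi T (rinv S z) * wedge v u S T) * s (matrix_inv w *v z))"
        by (simp add: g_def x)
    qed auto
    also have "\<dots> = comm_coeff C v u w z * s (matrix_inv w *v z)"
      unfolding comm_coeff_def sum_distrib_right by (simp add: case_prod_unfold)
    finally show "sum g {x \<in> Sset W \<Gamma> \<times> Sset W \<Gamma>. rho (fst x) ** rho (snd x) = w} = comm_coeff C v u w z * s (matrix_inv w *v z)" .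
  qed
  also have "\<dots> = 0" using comm_coeff_vanishes[OF fin Cinv _ z] by (intro sum.neutral) simp
  finally show ?thesis .
qed

text \<open>Sums over an infinite set are \<open>0\<close>, so replacing an infinite index set by the empty one makes a proof
  of its finiteness unnecessary.\<close>
lemma dunkl_commute_at:
  assumes A: "flat_hol_conn \<Gamma> A" and Cinv: "\<And>w S. w \<in> W \<Longrightarrow> S \<in> Sset W \<Gamma> \<Longrightarrow> C (act w S) = C S"
    and S0: "S0 = (if finite (Sset W \<Gamma>) then Sset W \<Gamma> else {})"
    and z: "\<And>S. S \<in> S0 \<Longrightarrow> z \<notin> fst S" and holo_locus: "\<And>w. w \<in> W \<Longrightarrow> w *v z \<in> holo_locus s"
  shows "dunkl W \<Gamma> \<alpha> A C v (dunkl W \<Gamma> \<alpha> A C u s) z = dunkl W \<Gamma> \<alpha> A C u (dunkl W \<Gamma> \<alpha> A C v s) z"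
proof -
  have sumS0: "sum f (Sset W \<Gamma>) = sum f S0" for f :: "_ \<Rightarrow> complex" by (simp add: S0)
  have sub: "S0 \<subseteq> Sset W \<Gamma>" by (simp add: S0)
  note D = dunkl_eq[OF sumS0 sub]
  define a where "a = A 0"
  have Aa: "A y x = a x" for y x unfolding a_def by (rule flat_hol_conn_constant[OF lat A])
  have zr: "z \<in> holo_locus s" using holo_locus[OF W_1] by simp
  have Sr: "rinv S z \<in> holo_locus s" if "S \<in> S0" for S using that sub by (intro holo_locus W_inv rho_W) auto
  have "\<forall>S. \<exists>e. S \<in> S0 \<longrightarrow> (\<forall>v. rinv S v = v + pair (ell S) v *s e)"
    using rho_inv_form sub by (metis subsetD)
  \<comment> \<open>The inverse of \<open>rho S\<close> moves a direction \<open>v\<close> only by a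
    multiple of \<open>e S\<close>. This splits the derivative of \<open>s\<close> at
    \<open>rinv S z\<close> into two terms whose symmetry is visible.\<close>
  then obtain e where e: "\<And>S v. S \<in> S0 \<Longrightarrow> rinv S v = v + pair (ell S) v *s e S" by metis
  define dp where "dp = (\<lambda>S. deriv (Phi S) (pair (ell S) z))"
  \<comment> \<open>All terms of the composed operators except the double sum over two reflections,
    arranged so that, apart from the mixed second derivative, swapping \<open>u\<close> and
    \<open>v\<close> only permutes summands.\<close>
  define sym where "sym = (\<lambda>v u. dd v (dd u s) z + a u * dd v s z + a v * (dd u s z + a u * s z)
     - (\<Sum>S\<in>S0. C S * (pair (ell S) u * (dp S * pair (ell S) v) * s (rinv S z) +
          pair (ell S) u * phi S z * (dd v s (rinv S z) + pair (ell S) v * dd (e S) s (rinv S z)) +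
          a v * (phi S z * pair (ell S) u * s (rinv S z)) +
          phi S z * pair (ell S) v * (dd u s (rinv S z) + a u * s (rinv S z)))))" for v u
  define dbl where "dbl = (\<lambda>v u. \<Sum>S\<in>S0. \<Sum>T\<in>S0. C S * C T * (phi S z * phi T (rinv S z) * (pair (ell S) v * pair (ell T) u)) * s (rinv T (rinv S z)))" for v u
  have main: "dunkl W \<Gamma> \<alpha> A C v (dunkl W \<Gamma> \<alpha> A C u s) z = sym v u + dbl v u" for v u
  proof -
    let ?X = "dd v (dd u s) z + a u * dd v s z -
      (\<Sum>S\<in>S0. C S * (pair (ell S) u * (dp S * pair (ell S) v) * s (rinv S z) +
          pair (ell S) u * phi S z * (dd v s (rinv S z) + pair (ell S) v * dd (e S) s (rinv S z))))"
    have "((\<lambda>t. dunkl W \<Gamma> \<alpha> A C u s (z + t *s v)) has_field_derivative ?X) (at 0)"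
      unfolding D Aa
    proof (intro DERIV_diff DERIV_add DERIV_sum)
      show "((\<lambda>t. dd u s (z + t *s v)) has_field_derivative dd v (dd u s) z) (at 0)"
        by (rule holo_second_derivative(1)[OF holo_holo_locus open_holo_locus zr])
      have "((\<lambda>t. s (z + t *s v)) has_field_derivative dd v s z) (at 0)"
        using holo_line_deriv[OF holo_holo_locus, of z 0 v s] zr by simp
      then show "((\<lambda>t. a u * s (z + t *s v)) has_field_derivative a u * dd v s z) (at 0)" by (rule DERIV_cmult)
      fix S assume S: "S \<in> S0"
      have S': "S \<in> Sset W \<Gamma>" using S sub by blast
      have p: "((\<lambda>t. phi S (z + t *s v)) has_field_derivative dp S * pair (ell S) v) (at 0)"
        unfolding dp_def by (rule phi_line_deriv[OF S' z[OF S]])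
      have "((\<lambda>t. s (rinv S z + t *s rinv S v)) has_field_derivative dd (rinv S v) s (rinv S z)) (at 0)"
        using holo_line_deriv[OF holo_holo_locus, of "rinv S z" 0 "rinv S v" s] Sr[OF S] by simp
      moreover have "dd (rinv S v) s (rinv S z) = dd v s (rinv S z) + pair (ell S) v * dd (e S) s (rinv S z)"
        unfolding e[OF S, of v] using holo_has_derivative(2,3)[OF holo_holo_locus Sr[OF S]] by simp
      ultimately have "((\<lambda>t. s (rinv S (z + t *s v))) has_field_derivative dd v s (rinv S z) + pair (ell S) v * dd (e S) s (rinv S z)) (at 0)"
        by (simp add: matrix_line)
      from DERIV_mult[OF p this]
      have "((\<lambda>t. C S * pair (ell S) u * (phi S (z + t *s v) * s (rinv S (z + t *s v)))) has_field_derivative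
         C S * pair (ell S) u * (dp S * pair (ell S) v * s (rinv S z) +
          (dd v s (rinv S z) + pair (ell S) v * dd (e S) s (rinv S z)) * phi S z)) (at 0)"
        by (intro DERIV_cmult) simp
      then show "((\<lambda>t. C S * (phi S (z + t *s v) * pair (ell S) u) * s (rinv S (z + t *s v))) has_field_derivative
        C S * (pair (ell S) u * (dp S * pair (ell S) v) * s (rinv S z) +
          pair (ell S) u * phi S z * (dd v s (rinv S z) + pair (ell S) v * dd (e S) s (rinv S z)))) (at 0)"
        by (simp add: algebra_simps)
    qed
    then have X: "dd v (dunkl W \<Gamma> \<alpha> A C u s) z = ?X" unfolding dd_def[of v "dunkl W \<Gamma> \<alpha> A C u s"] by (rule DERIV_imp_deriv)
    have "dunkl W \<Gamma> \<alpha> A C v (dunkl W \<Gamma> \<alpha> A C u s) z = ?X + a v * dunkl W \<Gamma> \<alpha> A C u s z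
        - (\<Sum>S\<in>S0. C S * (phi S z * pair (ell S) v) * dunkl W \<Gamma> \<alpha> A C u s (rinv S z))"
      by (subst D) (simp only: X Aa)
    also have "(\<Sum>S\<in>S0. C S * (phi S z * pair (ell S) v) * dunkl W \<Gamma> \<alpha> A C u s (rinv S z)) =
      (\<Sum>S\<in>S0. C S * (phi S z * pair (ell S) v * (dd u s (rinv S z) + a u * s (rinv S z)))) - dbl v u"
      unfolding dbl_def sum_subtractf[symmetric]
    proof (rule sum.cong[OF refl])
      fix S
      have "C S * (phi S z * pair (ell S) v) * (\<Sum>T\<in>S0. C T * (phi T (rinv S z) * pair (ell T) u) * s (rinv T (rinv S z))) =
         (\<Sum>T\<in>S0. C S * C T * (phi S z * phi T (rinv S z) * (pair (ell S) v * pair (ell T) u)) * s (rinv T (rinv S z)))"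
        unfolding sum_distrib_left by (intro sum.cong refl) (simp only: mult_ac)
      then show "C S * (phi S z * pair (ell S) v) * dunkl W \<Gamma> \<alpha> A C u s (rinv S z) =
         C S * (phi S z * pair (ell S) v * (dd u s (rinv S z) + a u * s (rinv S z))) -
         (\<Sum>T\<in>S0. C S * C T * (phi S z * phi T (rinv S z) * (pair (ell S) v * pair (ell T) u)) * s (rinv T (rinv S z)))"
        unfolding D Aa right_diff_distrib by (simp only: mult.assoc)
    qed
    also have "a v * dunkl W \<Gamma> \<alpha> A C u s z = a v * (dd u s z + a u * s z) - (\<Sum>S\<in>S0. C S * (a v * (phi S z * pair (ell S) u * s (rinv S z))))"
      unfolding D Aa right_diff_distrib sum_distrib_left by (simp only: mult_ac)
    finally show ?thesis unfolding sym_def by (simp add: distrib_left sum.distrib)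
  qed
  have "sym v u = sym u v"
  proof -
    have "dd v (dd u s) z = dd u (dd v s) z" by (rule holo_second_derivative(2)[OF holo_holo_locus open_holo_locus zr])
    then show ?thesis unfolding sym_def by (intro arg_cong2[of _ _ _ _ "(-)"] sum.cong refl) (simp_all add: algebra_simps)
  qed
  moreover have "dbl v u - dbl u v = 0"
  proof (cases "finite (Sset W \<Gamma>)")
    case False then show ?thesis by (simp add: dbl_def S0)
  next
    case True
    then have "z \<notin> pole_locus" using z by (auto simp: pole_locus_def S0)
    from double_sum_vanishes[where s = s and v = v and u = u, OF True Cinv this] True
    show ?thesis unfolding dbl_def S0 wedge_def
      by (simp add: sum_subtractf[symmetric] right_diff_distrib left_diff_distrib mult_ac)
  qed
  ultimately show ?thesis unfolding main by simp
qed

text \<open>Induction over the finite group shrinks an open set until all its translates lie where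
  \<open>s\<close> is holomorphic; each step uses density in the translated open set. The hypertori
  are avoided last, being countable unions of hyperplanes.\<close>

lemma good_dense:
  assumes m: "meromorphic U s" and UW: "\<And>w z. w \<in> W \<Longrightarrow> z \<in> U \<Longrightarrow> w *v z \<in> U"
    and B: "open B" "B \<subseteq> U" "B \<noteq> {}" and S0: "finite S0" "S0 \<subseteq> Sset W \<Gamma>"
  shows "\<exists>z\<in>B. (\<forall>S\<in>S0. z \<notin> fst S) \<and> (\<forall>w\<in>W. w *v z \<in> holo_locus s)"
proof -
  have "\<exists>B'. open B' \<and> B' \<subseteq> B \<and> B' \<noteq> {} \<and> (\<forall>w\<in>V. \<forall>z\<in>B'. w *v z \<in> holo_locus s)" if "finite V" "V \<subseteq> W" for V
    using that
  proof (induction rule: finite_induct)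
    case empty
    then show ?case using B by blast
  next
    case (insert w V)
    then obtain B' where B': "open B'" "B' \<subseteq> B" "B' \<noteq> {}" "\<forall>w\<in>V. \<forall>z\<in>B'. w *v z \<in> holo_locus s" by auto
    have w: "w \<in> W" using insert by simp
    have im: "(\<lambda>z. w *v z) ` B' = (\<lambda>z. matrix_inv w *v z) -` B'" using W_image_iff[OF w] by auto
    have "open ((\<lambda>z. matrix_inv w *v z) -` B')" using B'(1) by (intro continuous_open_vimage isCont_matrix)
    then have "(\<lambda>z. w *v z) ` B' \<inter> holo_locus s \<noteq> {}"
      using B' B(2) UW[OF w] by (intro holo_locus_dense[OF m]) (auto simp: im[symmetric])
    then obtain y where y: "y \<in> B'" "w *v y \<in> holo_locus s" by auto
    have "open (B' \<inter> (\<lambda>z. w *v z) -` holo_locus s)"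
      using B'(1) by (intro open_Int continuous_open_vimage isCont_matrix open_holo_locus)
    then show ?case using y B' by (intro exI[of _ "B' \<inter> (\<lambda>z. w *v z) -` holo_locus s"]) auto
  qed
  from this[OF W_fin subset_refl] obtain B' where B': "open B'" "B' \<subseteq> B" "B' \<noteq> {}" "\<And>w z. w \<in> W \<Longrightarrow> z \<in> B' \<Longrightarrow> w *v z \<in> holo_locus s"
    by blast
  obtain z0 where "z0 \<in> B'" using B' by blast
  then have "\<exists>z\<in>B'. \<forall>S\<in>S0. pair (ell S) z \<notin> poles S"
    using S0 by (intro dense_off_countable_hyperplanes[OF S0(1) _ _ B'(1)] ell_nonzero poles_countable) blast+
  then show ?thesis using B' S0(2) poles_iff by blast
qed

end

theorem theorem4p1:
  fixes W :: "(complex^'n^'n) set" and \<Gamma> :: "(complex^'n) set"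
    and \<alpha> :: "complex^'n \<Rightarrow> complex"
    and A :: "complex^'n \<Rightarrow> complex^'n \<Rightarrow> complex"
    and C :: "(complex^'n) set \<times> nat \<Rightarrow> complex"
  assumes "finite_matrix_group W"
    and "full_lattice \<Gamma>"
    and "\<forall>w\<in>W. \<forall>\<gamma>\<in>\<Gamma>. w *v \<gamma> \<in> \<Gamma>"
    and "antilin_form \<alpha>"
    and "\<forall>w\<in>W - {mat 1}. \<not> holo_trivial \<Gamma> (\<lambda>\<gamma>. \<alpha> \<gamma> - \<alpha> (matrix_inv w *v \<gamma>))"
    and "flat_hol_conn \<Gamma> A"
    and "\<forall>g\<in>W. \<forall>(Ht, j)\<in>Sset W \<Gamma>. C ((\<lambda>z. g *v z) ` Ht, j) = C (Ht, j)"
  shows "\<forall>u v U s. open U \<and> (\<forall>z\<in>U. \<forall>\<gamma>\<in>\<Gamma>. z + \<gamma> \<in> U) \<and> (\<forall>w\<in>W. \<forall>z\<in>U. w *v z \<in> U) \<and>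
           meromorphic U s \<and> qp \<Gamma> \<alpha> U s \<longrightarrow>
           (\<exists>Z. closed Z \<and> interior Z = {} \<and>
              (\<forall>z\<in>U - Z. dunkl W \<Gamma> \<alpha> A C v (dunkl W \<Gamma> \<alpha> A C u s) z =
                          dunkl W \<Gamma> \<alpha> A C u (dunkl W \<Gamma> \<alpha> A C v s) z))"
proof (intro allI impI)
  fix u v U s
  assume U: "open U \<and> (\<forall>z\<in>U. \<forall>\<gamma>\<in>\<Gamma>. z + \<gamma> \<in> U) \<and> (\<forall>w\<in>W. \<forall>z\<in>U. w *v z \<in> U) \<and>
           meromorphic U s \<and> qp \<Gamma> \<alpha> U s"
  interpret dunkl_setting W \<Gamma> \<alpha>
    by unfold_locales (use assms in auto)
  have Cinv: "C (act w S) = C S" if "w \<in> W" "S \<in> Sset W \<Gamma>" for w S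
    using assms(7) that by (cases S) (auto simp: act_def)
  define S0 where "S0 = (if finite (Sset W \<Gamma>) then Sset W \<Gamma> else {})"
  have S0: "finite S0" "S0 \<subseteq> Sset W \<Gamma>" by (auto simp: S0_def)
  \<comment> \<open>The composed operators at \<open>z\<close> involve \<open>s\<close> along the
    orbit of \<open>z\<close>, so holomorphy is asked at every translate.\<close>
  define G where "G = {z\<in>U. (\<forall>S\<in>S0. z \<notin> fst S) \<and> (\<forall>w\<in>W. w *v z \<in> holo_locus s)}"
  have "G = U \<inter> - (\<Union>S\<in>S0. fst S) \<inter> (\<Inter>w\<in>W. (\<lambda>z. w *v z) -` holo_locus s)" by (auto simp: G_def)
  also have "open \<dots>"
    using U S0 closed_hypertorus
    by (intro open_Int open_Compl closed_UN open_INT W_fin ballI continuous_open_vimage isCont_matrix open_holo_locus) auto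
  finally have openG: "open G" .
  show "\<exists>Z. closed Z \<and> interior Z = {} \<and>
              (\<forall>z\<in>U - Z. dunkl W \<Gamma> \<alpha> A C v (dunkl W \<Gamma> \<alpha> A C u s) z =
                          dunkl W \<Gamma> \<alpha> A C u (dunkl W \<Gamma> \<alpha> A C v s) z)"
  \<comment> \<open>The exceptional set must be closed in the whole space, so \<open>G\<close> is
    removed from the closure of \<open>U\<close>; the points of \<open>U\<close> outside it are
    exactly those of \<open>G\<close>.\<close>
  proof (intro exI[of _ "closure U - G"] conjI ballI)
    show "closed (closure U - G)" using openG by (intro closed_Diff) auto
    show "interior (closure U - G) = {}"
    proof (rule ccontr)
      assume ne: "interior (closure U - G) \<noteq> {}"
      let ?B = "interior (closure U - G) \<inter> U"
      \<comment> \<open>A nonempty open subset of the closure of \<open>U\<close> meets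
        \<open>U\<close>, where density of good points applies.\<close>
      have "?B \<noteq> {}"
        using ne interior_subset[of "closure U - G"] open_Int_closure_eq_empty[of "interior (closure U - G)" U] by auto
      then have "\<exists>z\<in>?B. (\<forall>S\<in>S0. z \<notin> fst S) \<and> (\<forall>w\<in>W. w *v z \<in> holo_locus s)"
        using U by (intro good_dense[of U s, OF _ _ _ _ _ S0]) auto
      then obtain z where "z \<in> ?B" "z \<in> G" by (auto simp: G_def)
      then show False using interior_subset by blast
    qed
    fix z assume "z \<in> U - (closure U - G)"
    then have "z \<in> G" using closure_subset by blast
    then show "dunkl W \<Gamma> \<alpha> A C v (dunkl W \<Gamma> \<alpha> A C u s) z = dunkl W \<Gamma> \<alpha> A C u (dunkl W \<Gamma> \<alpha> A C v s) z"
      by (intro dunkl_commute_at[OF assms(6) Cinv S0_def]) (auto simp: G_def)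
  qed
qed

end
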